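(* Fix $r>0$ and let $f\in \mathbf{L}^2(\Omega)$, $g\in L^2(\Omega)$, $u_\Gamma\in\mathbf{H}^{1/2}(\Gamma)$, $r_\Gamma\in H^{-1/2}(\Gamma)$ be such that $$\frac{\gamma_1^*}{r}\max\{\gamma_1^*\kappa_2 r,1\}\,\big(\|g\|_{0,\Omega}+\|r_\Gamma\|_{-1/2,\Gamma}+\|u_\Gamma\|_{1/2,\Gamma}+\|f\|_{0,\Omega}\big)<1 .$$ Then the operator $\mathcal{J}_h$ has a unique fixed point $\underline{d}_h\in\mathbf{W}_h$. Equivalently, the discrete problem (P$_h$) has a unique solution $((\underline{d}_h,\sigma_h),u_h)\in(\mathbf{X}_h\times\mathbf{Y}_h)\times\mathbf{Z}_h$ with $\underline{d}_h\in\mathbf{W}_h$. In addition, there exists $C^*>0$ such that $$\|((\underline{d}_h,\sigma_h),u_h)\|\le C^*\big(\|g\|_{0,\Omega}+\|r_\Gamma\|_{-1/2,\Gamma}+\|u_\Gamma\|_{1/2,\Gamma}+\|f\|_{0,\Omega}\big).$$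
   Context: Setting. $\Omega\subset\mathbb{R}^n$ with $n=2$ (the Arnold--Winther spaces below are for the 2D case) is an open bounded domain with Lipschitz boundary $\Gamma$ and unit outward normal $\boldsymbol{n}$, such that $\overline\Omega$ admits a regular partition $\mathcal{T}_h$ into triangles $K$ of diameter $h_K$, $h:=\max_K h_K$. Bold spaces $\mathbf{L}^2,\mathbf{H}^m$ are vector-valued, blackboard ones tensor-valued ($n\times n$); $\|\cdot\|_{m,\Omega}$ is the $H^m(\Omega)$ norm ($H^0=L^2$). $\mathbb{I}$ is the identity tensor; $\mathbf{div}$ of a tensor is the row-wise divergence; $\langle\cdot,\cdot\rangle_\Gamma$ is the duality between $H^{-1/2}(\Gamma)$ and $H^{1/2}(\Gamma)$ (also vector-valued). Parameters: constants $\lambda,\mu>0$, $0\le\alpha\le1$, $c_0>0$; $\mathcal{C}d:=\lambda(\operatorname{tr}d)\mathbb{I}+2\mu d$. Spaces: $\mathbf{X}:=\mathbb{L}^2_{\rm sym}(\Omega)\times H^1(\Omega)$, $\mathbf{Y}:=\{\tau\in\mathbb{L}^2_{\rm sym}(\Omega):\mathbf{div}\,\tau\in\mathbf{L}^2(\Omega)\}$, $\mathbf{Z}:=\mathbf{L}^2(\Omega)$, with $\mathbb{L}^2_{\rm sym}(\Omega)$ the symmetric tensors in $\mathbb{L}^2(\Omega)$. Elements of $\mathbf{X}$ are written $\underline{d}=(d,p)$, $\underline{e}=(e,q)$, $\underline{w}=(w,s)$. Norms: $\|\underline{e}\|_{\mathbf{X}}^2=\|e\|_{0,\Omega}^2+\|q\|_{1,\Omega}^2$,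 $\|\tau\|_{\mathbf{Y}}^2=\|\tau\|_{0,\Omega}^2+\|\mathbf{div}\,\tau\|_{0,\Omega}^2$, $\|v\|_{\mathbf{Z}}=\|v\|_{0,\Omega}$; product spaces carry the Euclidean combination of norms. Permeability: $\kappa$ assigns to each $(d,p)$ an $n\times n$ tensor $\kappa(d,p)\in\mathbb{L}^\infty(\Omega)$, and there are constants $\kappa_1,\kappa_2>0$ with $\kappa_1|v|^2\le v^{t}\kappa(\cdot,\cdot)v$ for all $v\in\mathbb{R}^n\setminus\{0\}$ (for all arguments, a.e. in $\Omega$) and $\|\kappa(\cdot,p_1)-\kappa(\cdot,p_2)\|_{\mathbb{L}^\infty(\Omega)}\le\kappa_2\|p_1-p_2\|_{1,\Omega}$ for all $p_1,p_2\in H^1(\Omega)$, where each dot stands for an arbitrary (possibly different) first argument. Forms: for $\underline{w}\in\mathbf{X}$, $$a_{\underline{w}}(\underline{d},\underline{e}):=\int_\Omega\mathcal{C}d:e+\int_\Omega\kappa(\underline{w})\nabla p\cdot\nabla q+c_0\int_\Omega pq+\alpha\int_\Omega q\operatorname{tr}d-\alpha\int_\Omega p\operatorname{tr}e,$$ $a(\underline{d},\underline{e}):=a_{\underline{d}}(\underline{d},\underline{e})$, $b_1(\underline{e},\tau):=-\int_\Omega\tau:e$, $b_2((\underline{e},\tau),v):=-\int_\Omega v\cdot\mathbf{div}\,\tau$. Functionals: $G(\underline{e}):=\int_\Omega gq+\langle r_\Gamma,q\rangle_\Gamma$, $H(\tau):=-\langle\tau\boldsymbol{n},u_\Gamma\rangle_\Gamma$,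 $F(v):=\int_\Omega f\cdot v$. Discrete spaces, for an integer $k\ge1$ ($\mathrm{P}_\ell(K)$, $\mathbf{P}_\ell(K)$, $\mathbb{P}_\ell(K)$: scalar, vector, tensor polynomials of degree $\le\ell$ on $K$): $\mathbf{X}_{1,h}:=\{e_h\in\mathbb{L}^2_{\rm sym}(\Omega):e_h|_K\in\mathbb{P}_{k+2}(K),\ \mathbf{div}\,e_h|_K\in\mathbf{P}_k(K)\ \forall K\in\mathcal{T}_h\}$; $\mathbf{X}_{2,h}:=\{q_h\in C(\overline\Omega):q_h|_K\in\mathrm{P}_{k+1}(K)\ \forall K\}$; $\mathbf{X}_h:=\mathbf{X}_{1,h}\times\mathbf{X}_{2,h}$; $\mathbf{Y}_h:=\{\tau_h\in\mathbf{Y}:\tau_h|_K\in\mathbb{P}_{k+2}(K),\ \mathbf{div}\,\tau_h|_K\in\mathbf{P}_k(K)\ \forall K\}$; $\mathbf{Z}_h:=\{v_h\in\mathbf{L}^2(\Omega):v_h|_K\in\mathbf{P}_k(K)\ \forall K\}$. Problem (P$_h$): find $((\underline{d}_h,\sigma_h),u_h)\in(\mathbf{X}_h\times\mathbf{Y}_h)\times\mathbf{Z}_h$ such that for all $((\underline{e}_h,\tau_h),v_h)\in(\mathbf{X}_h\times\mathbf{Y}_h)\times\mathbf{Z}_h$: $a(\underline{d}_h,\underline{e}_h)+b_1(\underline{e}_h,\sigma_h)=G(\underline{e}_h)$, $\;b_1(\underline{d}_h,\tau_h)+b_2((\underline{e}_h,\tau_h),u_h)=H(\tau_h)$, $\;b_2((\underline{d}_h,\sigma_h),v_h)=F(v_h)$.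 Linearised discrete problem (P$_{h,\underline{w}_h}$): the same with $a$ replaced by $a_{\underline{w}_h}$. $\mathbf{W}_h:=\{\underline{w}_h\in\mathbf{X}_h:\|\underline{w}_h\|_{\mathbf{X}}\le r\}$, and $\mathcal{J}_h:\mathbf{W}_h\to\mathbf{X}_h$ maps $\underline{w}_h$ to the first component $\underline{d}_h$ of the solution of (P$_{h,\underline{w}_h}$). Constants: $\beta_2^*>0$ is a constant such that $\sup_{0\ne(\underline{e}_h,\tau_h)\in\mathbf{X}_h\times\mathbf{Y}_h}\frac{b_2((\underline{e}_h,\tau_h),v_h)}{\|(\underline{e}_h,\tau_h)\|_{\mathbf{X}\times\mathbf{Y}}}\ge\beta_2^*\|v_h\|_{\mathbf{Z}}$ for all $v_h\in\mathbf{Z}_h$; $C_a:=\max\{2\mu+n\lambda,c_0,n\alpha,\kappa_2r\}$, $c_a:=\min\{\kappa_1,2\mu,c_0\}$, $$\gamma_2:=\frac{(C_a+2)(c_a+1+C_a)}{c_a},\qquad\gamma_1^*:=\frac{(C_a+1+\beta_2^*+\gamma_2)^2}{(\beta_2^* )^2\gamma_2}.$$ *)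

theory Defs
  imports "HOL-Analysis.Analysis"
begin

text \<open>
  Everything is for \<open>n = 2\<close>: points and vectors are \<open>real^2\<close>, tensors \<open>real^2^2\<close>.  The inner
  product \<open>\<bullet>\<close> of \<open>real^2^2\<close> is the contraction \<open>\<tau> : e\<close>, its norm is the Frobenius norm.
  Elements of Lebesgue spaces are functions (on the whole plane, their values outside the domain
  being irrelevant), identified when they agree almost everywhere on the domain; uniqueness
  statements are accordingly up to a.e. equality.
\<close>

type_synonym scalar_field = "real^2 \<Rightarrow> real"
type_synonym vector_field = "real^2 \<Rightarrow> real^2"
type_synonym tensor_field = "real^2 \<Rightarrow> real^2^2"
type_synonym xfield = "tensor_field \<times> scalar_field"
type_synonym perm = "tensor_field \<Rightarrow> scalar_field \<Rightarrow> tensor_field"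

text \<open>Near each boundary point, in suitable orthonormal coordinates \<open>(s, t)\<close> centred at that
  point, the set is the strict epigraph of a Lipschitz function and its boundary is the graph.\<close>

definition lipschitz_boundary :: "(real^2) set \<Rightarrow> bool" where
  "lipschitz_boundary \<Omega> \<longleftrightarrow>
     (\<forall>x\<in>frontier \<Omega>. \<exists>a b \<phi> L \<delta> \<eta>.
        norm a = 1 \<and> norm b = 1 \<and> a \<bullet> b = 0 \<and> \<delta> > 0 \<and> \<eta> > 0 \<and>
        lipschitz_on L (UNIV :: real set) (\<phi> :: real \<Rightarrow> real) \<and>
        (\<forall>s t. \<bar>s\<bar> < \<delta> \<and> \<bar>t\<bar> < \<eta> \<longrightarrow>
           (x + s *\<^sub>R a + t *\<^sub>R b \<in> \<Omega> \<longleftrightarrow> \<phi> s < t) \<and>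
           (x + s *\<^sub>R a + t *\<^sub>R b \<in> frontier \<Omega> \<longleftrightarrow> t = \<phi> s)))"

definition lipschitz_domain :: "(real^2) set \<Rightarrow> bool" where
  "lipschitz_domain \<Omega> \<longleftrightarrow>
     open \<Omega> \<and> connected \<Omega> \<and> \<Omega> \<noteq> {} \<and> bounded \<Omega> \<and> lipschitz_boundary \<Omega>"

text \<open>\<open>triangulation\<close> says that any two triangles meet in a common face (possibly empty), i.e.
  that there are no hanging nodes.\<close>

definition regular_partition :: "(real^2) set \<Rightarrow> (real^2) set set \<Rightarrow> bool" where
  "regular_partition \<Omega> T \<longleftrightarrow> triangulation T \<and> (\<forall>K\<in>T. 2 simplex K) \<and> \<Union>T = closure \<Omega>"

definition ae_eq :: "(real^2) set \<Rightarrow> (real^2 \<Rightarrow> 'a) \<Rightarrow> (real^2 \<Rightarrow> 'a) \<Rightarrow> bool" where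
  "ae_eq \<Omega> f g \<longleftrightarrow> (AE x in lebesgue_on \<Omega>. f x = g x)"

definition L2 :: "(real^2) set \<Rightarrow> (real^2 \<Rightarrow> 'a::euclidean_space) set" where
  "L2 \<Omega> = {f. f \<in> borel_measurable (lebesgue_on \<Omega>) \<and>
               integrable (lebesgue_on \<Omega>) (\<lambda>x. (norm (f x))\<^sup>2)}"

definition L2_norm :: "(real^2) set \<Rightarrow> (real^2 \<Rightarrow> 'a::euclidean_space) \<Rightarrow> real" where
  "L2_norm \<Omega> f = sqrt (LINT x|lebesgue_on \<Omega>. (norm (f x))\<^sup>2)"

definition Linf :: "(real^2) set \<Rightarrow> (real^2 \<Rightarrow> 'a::euclidean_space) set" where
  "Linf \<Omega> = {f. f \<in> borel_measurable (lebesgue_on \<Omega>) \<and>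
                 (\<exists>C. AE x in lebesgue_on \<Omega>. norm (f x) \<le> C)}"

definition Linf_norm :: "(real^2) set \<Rightarrow> (real^2 \<Rightarrow> 'a::euclidean_space) \<Rightarrow> real" where
  "Linf_norm \<Omega> f = Inf {C. 0 \<le> C \<and> (AE x in lebesgue_on \<Omega>. norm (f x) \<le> C)}"

definition L2_sym :: "(real^2) set \<Rightarrow> tensor_field set" where
  "L2_sym \<Omega> = {e \<in> L2 \<Omega>. AE x in lebesgue_on \<Omega>. transpose (e x) = e x}"

definition partial_deriv :: "2 \<Rightarrow> scalar_field \<Rightarrow> scalar_field" where
  "partial_deriv i \<phi> = (\<lambda>x. frechet_derivative \<phi> (at x) (axis i 1))"

text \<open>\<open>C\<^sup>\<infinity>\<close>: all iterated partial derivatives are (totally) differentiable everywhere.\<close>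

definition smooth :: "scalar_field \<Rightarrow> bool" where
  "smooth \<phi> \<longleftrightarrow> (\<forall>js x. fold partial_deriv js \<phi> differentiable (at x))"

definition test_functions :: "(real^2) set \<Rightarrow> scalar_field set" where
  "test_functions S =
     {\<phi>. smooth \<phi> \<and> compact (closure {x. \<phi> x \<noteq> 0}) \<and> closure {x. \<phi> x \<noteq> 0} \<subseteq> S}"

definition has_weak_grad :: "(real^2) set \<Rightarrow> scalar_field \<Rightarrow> vector_field \<Rightarrow> bool" where
  "has_weak_grad \<Omega> q G \<longleftrightarrow>
     (\<forall>\<phi>\<in>test_functions \<Omega>. \<forall>i.
        (LINT x|lebesgue_on \<Omega>. q x * partial_deriv i \<phi> x) =
        - (LINT x|lebesgue_on \<Omega>. G x $ i * \<phi> x))"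

definition weak_grad :: "(real^2) set \<Rightarrow> scalar_field \<Rightarrow> vector_field" where
  "weak_grad \<Omega> q = (SOME G. G \<in> L2 \<Omega> \<and> has_weak_grad \<Omega> q G)"

definition H1 :: "(real^2) set \<Rightarrow> scalar_field set" where
  "H1 \<Omega> = {q \<in> L2 \<Omega>. \<exists>G\<in>L2 \<Omega>. has_weak_grad \<Omega> q G}"

definition H1_norm :: "(real^2) set \<Rightarrow> scalar_field \<Rightarrow> real" where
  "H1_norm \<Omega> q = sqrt ((L2_norm \<Omega> q)\<^sup>2 + (L2_norm \<Omega> (weak_grad \<Omega> q))\<^sup>2)"

text \<open>Row-wise divergence in the sense of distributions on \<open>S\<close>; \<open>\<tau> x $ i\<close> is the \<open>i\<close>-th row.\<close>

definition has_weak_div :: "(real^2) set \<Rightarrow> tensor_field \<Rightarrow> vector_field \<Rightarrow> bool" where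
  "has_weak_div S \<tau> D \<longleftrightarrow>
     (\<forall>\<phi>\<in>test_functions S. \<forall>i.
        (LINT x|lebesgue_on S. (\<tau> x $ i) \<bullet> (\<chi> j. partial_deriv j \<phi> x)) =
        - (LINT x|lebesgue_on S. D x $ i * \<phi> x))"

definition weak_div :: "(real^2) set \<Rightarrow> tensor_field \<Rightarrow> vector_field" where
  "weak_div \<Omega> \<tau> = (SOME D. D \<in> L2 \<Omega> \<and> has_weak_div \<Omega> \<tau> D)"

text \<open>
  The trace space \<open>H\<^sup>1\<^sup>/\<^sup>2(\<Gamma>)\<close> is taken in its intrinsic form, as the range of the trace operator
  on \<open>H\<^sup>1(\<Omega>)\<close> with the norm \<open>\<parallel>u\<parallel> = inf {\<parallel>v\<parallel>\<^sub>1 | trace v = u}\<close>.  On a Lipschitz domain the kernel of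
  the trace operator is \<open>H\<^sup>1\<^sub>0(\<Omega>)\<close>, the closure of the test functions, so a boundary value is
  represented by the set of all its liftings: the trace of \<open>q\<close> is the class of \<open>q\<close> modulo
  \<open>H\<^sup>1\<^sub>0(\<Omega>)\<close>, and its norm is the infimum over that class.
\<close>

type_synonym bvalue = "scalar_field set"

definition H10 :: "(real^2) set \<Rightarrow> scalar_field set" where
  "H10 \<Omega> = {q \<in> H1 \<Omega>. \<forall>\<epsilon>>0. \<exists>\<phi>\<in>test_functions \<Omega>. H1_norm \<Omega> (\<lambda>x. q x - \<phi> x) < \<epsilon>}"

definition bdry_trace :: "(real^2) set \<Rightarrow> scalar_field \<Rightarrow> bvalue" where
  "bdry_trace \<Omega> q = {v \<in> H1 \<Omega>. (\<lambda>x. v x - q x) \<in> H10 \<Omega>}"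

definition H_half :: "(real^2) set \<Rightarrow> bvalue set" where
  "H_half \<Omega> = bdry_trace \<Omega> ` H1 \<Omega>"

definition H_half_norm :: "(real^2) set \<Rightarrow> bvalue \<Rightarrow> real" where
  "H_half_norm \<Omega> u = Inf (H1_norm \<Omega> ` u)"

definition H_half_vec :: "(real^2) set \<Rightarrow> (bvalue^2) set" where
  "H_half_vec \<Omega> = {u. \<forall>i. u $ i \<in> H_half \<Omega>}"

definition H_half_vec_norm :: "(real^2) set \<Rightarrow> bvalue^2 \<Rightarrow> real" where
  "H_half_vec_norm \<Omega> u = sqrt (\<Sum>i\<in>UNIV. (H_half_norm \<Omega> (u $ i))\<^sup>2)"

text \<open>\<open>H\<^sup>-\<^sup>1\<^sup>/\<^sup>2(\<Gamma>)\<close> is the dual of \<open>H\<^sup>1\<^sup>/\<^sup>2(\<Gamma>)\<close>; the pairing of \<open>r\<close> with (the trace of) \<open>q\<close> is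
  \<open>r (bdry_trace \<Omega> q)\<close>.\<close>

definition H_mhalf :: "(real^2) set \<Rightarrow> (bvalue \<Rightarrow> real) set" where
  "H_mhalf \<Omega> =
     {r. (\<forall>p\<in>H1 \<Omega>. \<forall>q\<in>H1 \<Omega>. \<forall>a b.
            r (bdry_trace \<Omega> (\<lambda>x. a * p x + b * q x)) =
              a * r (bdry_trace \<Omega> p) + b * r (bdry_trace \<Omega> q)) \<and>
         (\<exists>C. \<forall>u\<in>H_half \<Omega>. \<bar>r u\<bar> \<le> C * H_half_norm \<Omega> u)}"

definition H_mhalf_norm :: "(real^2) set \<Rightarrow> (bvalue \<Rightarrow> real) \<Rightarrow> real" where
  "H_mhalf_norm \<Omega> r = Sup {\<bar>r u\<bar> |u. u \<in> H_half \<Omega> \<and> H_half_norm \<Omega> u \<le> 1}"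

text \<open>\<open>\<langle>\<tau> n, u\<rangle>\<^sub>\<Gamma>\<close> for \<open>\<tau>\<close> in \<open>H(div)\<close>: the normal component exists only as the functional given by
  Green's formula, with any lifting of \<open>u\<close> (the value does not depend on the choice).\<close>

definition normal_trace_pairing :: "(real^2) set \<Rightarrow> tensor_field \<Rightarrow> bvalue^2 \<Rightarrow> real" where
  "normal_trace_pairing \<Omega> \<tau> u =
     (\<Sum>i\<in>UNIV. let v = (SOME v. v \<in> u $ i) in
        (LINT x|lebesgue_on \<Omega>. (\<tau> x $ i) \<bullet> weak_grad \<Omega> v x) +
        (LINT x|lebesgue_on \<Omega>. weak_div \<Omega> \<tau> x $ i * v x))"

definition X_space :: "(real^2) set \<Rightarrow> xfield set" where
  "X_space \<Omega> = L2_sym \<Omega> \<times> H1 \<Omega>"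

definition Y_space :: "(real^2) set \<Rightarrow> tensor_field set" where
  "Y_space \<Omega> = {\<tau> \<in> L2_sym \<Omega>. \<exists>D\<in>L2 \<Omega>. has_weak_div \<Omega> \<tau> D}"

definition Z_space :: "(real^2) set \<Rightarrow> vector_field set" where
  "Z_space \<Omega> = L2 \<Omega>"

definition X_norm :: "(real^2) set \<Rightarrow> xfield \<Rightarrow> real" where
  "X_norm \<Omega> e = sqrt ((L2_norm \<Omega> (fst e))\<^sup>2 + (H1_norm \<Omega> (snd e))\<^sup>2)"

definition Y_norm :: "(real^2) set \<Rightarrow> tensor_field \<Rightarrow> real" where
  "Y_norm \<Omega> \<tau> = sqrt ((L2_norm \<Omega> \<tau>)\<^sup>2 + (L2_norm \<Omega> (weak_div \<Omega> \<tau>))\<^sup>2)"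

definition Z_norm :: "(real^2) set \<Rightarrow> vector_field \<Rightarrow> real" where
  "Z_norm \<Omega> v = L2_norm \<Omega> v"

definition XY_norm :: "(real^2) set \<Rightarrow> xfield \<times> tensor_field \<Rightarrow> real" where
  "XY_norm \<Omega> s = sqrt ((X_norm \<Omega> (fst s))\<^sup>2 + (Y_norm \<Omega> (snd s))\<^sup>2)"

definition XYZ_norm :: "(real^2) set \<Rightarrow> (xfield \<times> tensor_field) \<times> vector_field \<Rightarrow> real" where
  "XYZ_norm \<Omega> s = sqrt ((XY_norm \<Omega> (fst s))\<^sup>2 + (Z_norm \<Omega> (snd s))\<^sup>2)"

definition X_eq :: "(real^2) set \<Rightarrow> xfield \<Rightarrow> xfield \<Rightarrow> bool" where
  "X_eq \<Omega> d e \<longleftrightarrow> ae_eq \<Omega> (fst d) (fst e) \<and> ae_eq \<Omega> (snd d) (snd e)"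

definition XYZ_eq :: "(real^2) set \<Rightarrow> (xfield \<times> tensor_field) \<times> vector_field \<Rightarrow>
    (xfield \<times> tensor_field) \<times> vector_field \<Rightarrow> bool" where
  "XYZ_eq \<Omega> s t \<longleftrightarrow> X_eq \<Omega> (fst (fst s)) (fst (fst t)) \<and>
     ae_eq \<Omega> (snd (fst s)) (snd (fst t)) \<and> ae_eq \<Omega> (snd s) (snd t)"

definition ex1_upto :: "('a \<Rightarrow> 'a \<Rightarrow> bool) \<Rightarrow> ('a \<Rightarrow> bool) \<Rightarrow> bool" where
  "ex1_upto E P \<longleftrightarrow> (\<exists>x. P x) \<and> (\<forall>x y. P x \<and> P y \<longrightarrow> E x y)"

text \<open>Polynomials of total degree at most \<open>l\<close> with coefficients in \<open>'a\<close>: scalar, vector or tensor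
  valued according to \<open>'a\<close>.\<close>

definition polys :: "nat \<Rightarrow> (real^2 \<Rightarrow> 'a::real_vector) set" where
  "polys l = {p. \<exists>c. \<forall>x. p x = (\<Sum>i\<le>l. \<Sum>j\<le>l - i. ((x $ 1) ^ i * (x $ 2) ^ j) *\<^sub>R c i j)}"

definition poly_on :: "nat \<Rightarrow> (real^2) set \<Rightarrow> (real^2 \<Rightarrow> 'a::real_vector) \<Rightarrow> bool" where
  "poly_on l K f \<longleftrightarrow> (\<exists>p\<in>polys l. ae_eq K f p)"

definition X1h :: "(real^2) set \<Rightarrow> (real^2) set set \<Rightarrow> nat \<Rightarrow> tensor_field set" where
  "X1h \<Omega> T k = {e \<in> L2_sym \<Omega>. \<forall>K\<in>T. poly_on (k + 2) K e \<and>
                   (\<exists>D. has_weak_div (interior K) e D \<and> poly_on k K D)}"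

definition X2h :: "(real^2) set \<Rightarrow> (real^2) set set \<Rightarrow> nat \<Rightarrow> scalar_field set" where
  "X2h \<Omega> T k = {q. continuous_on (closure \<Omega>) q \<and> (\<forall>K\<in>T. \<exists>p\<in>polys (k + 1). \<forall>x\<in>K. q x = p x)}"

definition Xh :: "(real^2) set \<Rightarrow> (real^2) set set \<Rightarrow> nat \<Rightarrow> xfield set" where
  "Xh \<Omega> T k = X1h \<Omega> T k \<times> X2h \<Omega> T k"

definition Yh :: "(real^2) set \<Rightarrow> (real^2) set set \<Rightarrow> nat \<Rightarrow> tensor_field set" where
  "Yh \<Omega> T k = {\<tau> \<in> Y_space \<Omega>. \<forall>K\<in>T. poly_on (k + 2) K \<tau> \<and> poly_on k K (weak_div \<Omega> \<tau>)}"

definition Zh :: "(real^2) set \<Rightarrow> (real^2) set set \<Rightarrow> nat \<Rightarrow> vector_field set" where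
  "Zh \<Omega> T k = {v \<in> L2 \<Omega>. \<forall>K\<in>T. poly_on k K v}"

definition Wh :: "(real^2) set \<Rightarrow> (real^2) set set \<Rightarrow> nat \<Rightarrow> real \<Rightarrow> xfield set" where
  "Wh \<Omega> T k r = {w \<in> Xh \<Omega> T k. X_norm \<Omega> w \<le> r}"

text \<open>The first arguments in the Lipschitz condition are arbitrary and unrelated.\<close>

definition permeability :: "(real^2) set \<Rightarrow> real \<Rightarrow> real \<Rightarrow> perm \<Rightarrow> bool" where
  "permeability \<Omega> \<kappa>1 \<kappa>2 \<kappa> \<longleftrightarrow>
     (\<forall>d p. (d, p) \<in> X_space \<Omega> \<longrightarrow> \<kappa> d p \<in> Linf \<Omega> \<and>
        (AE x in lebesgue_on \<Omega>. \<forall>v. v \<noteq> 0 \<longrightarrow> \<kappa>1 * (norm v)\<^sup>2 \<le> v \<bullet> (\<kappa> d p x *v v))) \<and>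
     (\<forall>d1 d2 p1 p2. (d1, p1) \<in> X_space \<Omega> \<and> (d2, p2) \<in> X_space \<Omega> \<longrightarrow>
        Linf_norm \<Omega> (\<lambda>x. \<kappa> d1 p1 x - \<kappa> d2 p2 x) \<le> \<kappa>2 * H1_norm \<Omega> (\<lambda>x. p1 x - p2 x))"

definition elast :: "real \<Rightarrow> real \<Rightarrow> real^2^2 \<Rightarrow> real^2^2" where
  "elast lam mu d = (lam * trace d) *\<^sub>R mat 1 + (2 * mu) *\<^sub>R d"

definition a_lin :: "(real^2) set \<Rightarrow> real \<Rightarrow> real \<Rightarrow> real \<Rightarrow> real \<Rightarrow> perm \<Rightarrow>
    xfield \<Rightarrow> xfield \<Rightarrow> xfield \<Rightarrow> real" where
  "a_lin \<Omega> lam mu \<alpha> c0 \<kappa> w d e =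
     (LINT x|lebesgue_on \<Omega>. elast lam mu (fst d x) \<bullet> fst e x) +
     (LINT x|lebesgue_on \<Omega>.
        (\<kappa> (fst w) (snd w) x *v weak_grad \<Omega> (snd d) x) \<bullet> weak_grad \<Omega> (snd e) x) +
     c0 * (LINT x|lebesgue_on \<Omega>. snd d x * snd e x) +
     \<alpha> * (LINT x|lebesgue_on \<Omega>. snd e x * trace (fst d x)) -
     \<alpha> * (LINT x|lebesgue_on \<Omega>. snd d x * trace (fst e x))"

definition a_form :: "(real^2) set \<Rightarrow> real \<Rightarrow> real \<Rightarrow> real \<Rightarrow> real \<Rightarrow> perm \<Rightarrow>
    xfield \<Rightarrow> xfield \<Rightarrow> real" where
  "a_form \<Omega> lam mu \<alpha> c0 \<kappa> d e = a_lin \<Omega> lam mu \<alpha> c0 \<kappa> d d e"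

definition b1 :: "(real^2) set \<Rightarrow> xfield \<Rightarrow> tensor_field \<Rightarrow> real" where
  "b1 \<Omega> e \<tau> = - (LINT x|lebesgue_on \<Omega>. \<tau> x \<bullet> fst e x)"

definition b2 :: "(real^2) set \<Rightarrow> xfield \<times> tensor_field \<Rightarrow> vector_field \<Rightarrow> real" where
  "b2 \<Omega> s v = - (LINT x|lebesgue_on \<Omega>. v x \<bullet> weak_div \<Omega> (snd s) x)"

definition G_fun :: "(real^2) set \<Rightarrow> scalar_field \<Rightarrow> (bvalue \<Rightarrow> real) \<Rightarrow> xfield \<Rightarrow> real" where
  "G_fun \<Omega> g r\<Gamma> e = (LINT x|lebesgue_on \<Omega>. g x * snd e x) + r\<Gamma> (bdry_trace \<Omega> (snd e))"

definition H_fun :: "(real^2) set \<Rightarrow> bvalue^2 \<Rightarrow> tensor_field \<Rightarrow> real" where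
  "H_fun \<Omega> u\<Gamma> \<tau> = - normal_trace_pairing \<Omega> \<tau> u\<Gamma>"

definition F_fun :: "(real^2) set \<Rightarrow> vector_field \<Rightarrow> vector_field \<Rightarrow> real" where
  "F_fun \<Omega> f v = (LINT x|lebesgue_on \<Omega>. f x \<bullet> v x)"

text \<open>The common shape of the nonlinear problem (\<open>A = a\<close>) and of the linearised one
  (\<open>A = a\<^sub>w\<close>).\<close>

definition mixed_solution :: "(real^2) set \<Rightarrow> (real^2) set set \<Rightarrow> nat \<Rightarrow>
    (xfield \<Rightarrow> xfield \<Rightarrow> real) \<Rightarrow> (xfield \<Rightarrow> real) \<Rightarrow> (tensor_field \<Rightarrow> real) \<Rightarrow>
    (vector_field \<Rightarrow> real) \<Rightarrow> (xfield \<times> tensor_field) \<times> vector_field \<Rightarrow> bool" where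
  "mixed_solution \<Omega> T k A G H F s \<longleftrightarrow>
     s \<in> (Xh \<Omega> T k \<times> Yh \<Omega> T k) \<times> Zh \<Omega> T k \<and>
     (case s of ((d, \<sigma>), u) \<Rightarrow>
        \<forall>e\<in>Xh \<Omega> T k. \<forall>\<tau>\<in>Yh \<Omega> T k. \<forall>v\<in>Zh \<Omega> T k.
          A d e + b1 \<Omega> e \<sigma> = G e \<and>
          b1 \<Omega> d \<tau> + b2 \<Omega> (e, \<tau>) u = H \<tau> \<and>
          b2 \<Omega> (d, \<sigma>) v = F v)"

definition Ph_solution where
  "Ph_solution \<Omega> T k lam mu \<alpha> c0 \<kappa> f g u\<Gamma> r\<Gamma> s \<longleftrightarrow>
     mixed_solution \<Omega> T k (a_form \<Omega> lam mu \<alpha> c0 \<kappa>) (G_fun \<Omega> g r\<Gamma>) (H_fun \<Omega> u\<Gamma>) (F_fun \<Omega> f) s"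

definition Phw_solution where
  "Phw_solution \<Omega> T k lam mu \<alpha> c0 \<kappa> f g u\<Gamma> r\<Gamma> w s \<longleftrightarrow>
     mixed_solution \<Omega> T k (a_lin \<Omega> lam mu \<alpha> c0 \<kappa> w) (G_fun \<Omega> g r\<Gamma>) (H_fun \<Omega> u\<Gamma>) (F_fun \<Omega> f) s"

text \<open>The solution of the linearised problem is determined only up to a.e. equality; \<open>SOME\<close> picks
  a representative.\<close>

definition Jh :: "(real^2) set \<Rightarrow> (real^2) set set \<Rightarrow> nat \<Rightarrow> real \<Rightarrow> real \<Rightarrow> real \<Rightarrow> real \<Rightarrow> perm \<Rightarrow>
    vector_field \<Rightarrow> scalar_field \<Rightarrow> bvalue^2 \<Rightarrow> (bvalue \<Rightarrow> real) \<Rightarrow> xfield \<Rightarrow> xfield" where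
  "Jh \<Omega> T k lam mu \<alpha> c0 \<kappa> f g u\<Gamma> r\<Gamma> w =
     fst (fst (SOME s. Phw_solution \<Omega> T k lam mu \<alpha> c0 \<kappa> f g u\<Gamma> r\<Gamma> w s))"

definition discrete_inf_sup :: "(real^2) set \<Rightarrow> (real^2) set set \<Rightarrow> nat \<Rightarrow> real \<Rightarrow> bool" where
  "discrete_inf_sup \<Omega> T k \<beta> \<longleftrightarrow>
     (\<forall>v\<in>Zh \<Omega> T k.
        (SUP s\<in>{s \<in> Xh \<Omega> T k \<times> Yh \<Omega> T k. XY_norm \<Omega> s \<noteq> 0}. b2 \<Omega> s v / XY_norm \<Omega> s)
          \<ge> \<beta> * Z_norm \<Omega> v)"

text \<open>\<open>max {2\<mu> + n\<lambda>, c\<^sub>0, n\<alpha>, \<kappa>\<^sub>2 r}\<close> with \<open>n = 2\<close>.\<close>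

definition Ca :: "real \<Rightarrow> real \<Rightarrow> real \<Rightarrow> real \<Rightarrow> real \<Rightarrow> real \<Rightarrow> real" where
  "Ca lam mu \<alpha> c0 \<kappa>2 r = Max {2 * mu + 2 * lam, c0, 2 * \<alpha>, \<kappa>2 * r}"

definition ca :: "real \<Rightarrow> real \<Rightarrow> real \<Rightarrow> real" where
  "ca mu c0 \<kappa>1 = Min {\<kappa>1, 2 * mu, c0}"

definition gamma2 :: "real \<Rightarrow> real \<Rightarrow> real" where
  "gamma2 C c = (C + 2) * (c + 1 + C) / c"

definition gamma1 :: "real \<Rightarrow> real \<Rightarrow> real \<Rightarrow> real" where
  "gamma1 C c \<beta> = (C + 1 + \<beta> + gamma2 C c)\<^sup>2 / (\<beta>\<^sup>2 * gamma2 C c)"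

definition data_norm :: "(real^2) set \<Rightarrow> vector_field \<Rightarrow> scalar_field \<Rightarrow> bvalue^2 \<Rightarrow>
    (bvalue \<Rightarrow> real) \<Rightarrow> real" where
  "data_norm \<Omega> f g u\<Gamma> r\<Gamma> =
     L2_norm \<Omega> g + H_mhalf_norm \<Omega> r\<Gamma> + H_half_vec_norm \<Omega> u\<Gamma> + L2_norm \<Omega> f"

end

theory Submission
  imports Defs "HOL-Library.Function_Algebras"
begin

text \<open>
  The solution is a fixed point of \<open>\<J>\<^sub>h\<close>, found by Banach's theorem.  All discrete spaces are, modulo
  almost everywhere equality, finite-dimensional, and their norms come from semi-inner products.
  Hence they are complete, and a linear problem with bilinear form \<open>B\<close> is solvable for every right
  hand side as soon as the adjoint problem has only null solutions (\<open>solve_bilinear\<close>).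

  For the linearised problem with data functionals of norms \<open>NG\<close>, \<open>NH\<close>, \<open>NF\<close> everything rests on the
  bound \<open>\<parallel>d\<parallel> \<le> \<gamma> (NG + NH + NF)\<close> of lemma \<open>apriori\<close>.  Four steps give it:
    \<^item> \<open>v = div \<sigma>\<close>, possible because \<open>div Y\<^sub>h \<subseteq> Z\<^sub>h\<close>, gives \<open>\<parallel>div \<sigma>\<parallel> \<le> NF\<close>;
    \<^item> \<open>e = (\<sigma>, 0)\<close>, possible because \<open>Y\<^sub>h \<subseteq> X\<^sub>1\<^sub>h\<close>, gives \<open>\<parallel>\<sigma>\<parallel> \<le> 2 C \<parallel>d\<parallel>\<close>;
    \<^item> the inf-sup condition gives \<open>\<beta> \<parallel>u\<parallel> \<le> NH + \<parallel>d\<parallel>\<close>;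
    \<^item> testing with the solution itself gives \<open>c \<parallel>d\<parallel>\<^sup>2 \<le> a(d, d) = G d - H \<sigma> + F u\<close>.
  Together they bound \<open>\<parallel>d\<parallel>\<close> by a quadratic inequality whose solution is at most \<open>\<gamma>\<close> times the data,
  because \<open>\<beta> \<le> 1\<close>: no inf-sup constant of \<open>b\<^sub>2\<close> can exceed the norm of \<open>b\<^sub>2\<close>.
  The pressure component of \<open>(\<sigma>, 0)\<close> vanishes, so the permeability drops out of the second step, and
  only its lower bound \<open>\<kappa>\<^sub>1\<close> enters the last one.  This matters since the Lipschitz condition bounds
  differences of \<open>\<kappa>\<close> but not \<open>\<kappa>\<close> itself, and \<open>C\<^sub>a\<close> depends on \<open>\<kappa>\<close> only through \<open>\<kappa>\<^sub>2 r\<close>.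

  Two solutions for \<open>w\<close> and \<open>w'\<close> differ by a solution of the linearised problem with \<open>H = F = 0\<close>
  and a \<open>G\<close> of norm at most \<open>\<kappa>\<^sub>2 \<parallel>w - w'\<parallel> \<parallel>d'\<parallel>\<close>.  The same bound therefore shows that \<open>\<J>\<^sub>h\<close> has
  Lipschitz constant \<open>\<gamma>\<^sup>2 \<kappa>\<^sub>2\<close> times the data, and the smallness assumption says both that this is
  below one and that \<open>\<J>\<^sub>h\<close> maps the ball of radius \<open>r\<close> into itself.

  To apply these arguments the forms must be well defined on classes of functions.  Weak derivatives
  are unique almost everywhere (\<open>fundamental_lemma\<close>); continuous piecewise polynomials have weak
  gradients (\<open>has_weak_grad_piecewise\<close>); the boundary functionals are bounded by the quotient norms of
  the data (\<open>H_mhalf_bound\<close>, \<open>H_fun_bound\<close>); and a Lipschitz domain is the interior of its closure, so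
  that the open triangles lie in it and fill it up to a null set (\<open>ae_eq_on_T\<close>).
\<close>

section \<open>Functionals on subspaces\<close>

text \<open>Fields form a vector space pointwise, so that spans, subspaces and linear combinations of
  fields are those of the type class.\<close>

instantiation "fun" :: (type, real_vector) real_vector
begin

definition scaleR_fun_def: "c *\<^sub>R f = (\<lambda>x. c *\<^sub>R f x)"

instance
  by standard (simp_all add: scaleR_fun_def fun_eq_iff scaleR_add_right scaleR_add_left)

end

lemma scaleR_fun_apply [simp]: "(c *\<^sub>R f) x = c *\<^sub>R f x"
  by (simp add: scaleR_fun_def)

text \<open>Linearity on a subspace only: integrals of products are additive only for square-integrable
  arguments, so that the functionals below need not be linear on the whole type.\<close>

definition lin_on :: "'a::real_vector set \<Rightarrow> ('a \<Rightarrow> real) \<Rightarrow> bool" where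
  "lin_on V l \<longleftrightarrow> (\<forall>x\<in>V. \<forall>y\<in>V. l (x + y) = l x + l y) \<and> (\<forall>c. \<forall>x\<in>V. l (c *\<^sub>R x) = c * l x)"

lemma lin_onI:
  assumes "\<And>x y. x \<in> V \<Longrightarrow> y \<in> V \<Longrightarrow> l (x + y) = l x + l y"
    and "\<And>c x. x \<in> V \<Longrightarrow> l (c *\<^sub>R x) = c * l x"
  shows "lin_on V l"
  using assms by (auto simp: lin_on_def)

lemma lin_on_add: "lin_on V l \<Longrightarrow> x \<in> V \<Longrightarrow> y \<in> V \<Longrightarrow> l (x + y) = l x + l y"
  and lin_on_scale: "lin_on V l \<Longrightarrow> x \<in> V \<Longrightarrow> l (c *\<^sub>R x) = c * l x"
  by (auto simp: lin_on_def)

lemma lin_on_zero: "lin_on V l \<Longrightarrow> subspace V \<Longrightarrow> l 0 = 0"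
  using lin_on_scale[of V l 0 0] by (simp add: subspace_0)

lemma lin_on_diff:
  assumes "lin_on V l" "subspace V" "x \<in> V" "y \<in> V"
  shows "l (x - y) = l x - l y"
proof -
  have "l (x + (-1) *\<^sub>R y) = l x + (-1) * l y"
    using assms by (metis lin_on_add lin_on_scale subspace_scale)
  then show ?thesis by simp
qed

lemma lin_on_sum:
  assumes "lin_on V l" "subspace V" "finite B" "\<And>b. b \<in> B \<Longrightarrow> f b \<in> V"
  shows "l (\<Sum>b\<in>B. c b *\<^sub>R f b) = (\<Sum>b\<in>B. c b * l (f b))"
  using assms(3,4)
proof (induction B rule: finite_induct)
  case empty
  then show ?case using lin_on_zero[OF assms(1,2)] by simp
next
  case (insert a B)
  have "(\<Sum>b\<in>B. c b *\<^sub>R f b) \<in> V"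
    using insert.prems by (intro subspace_sum[OF assms(2)] subspace_scale[OF assms(2)]) auto
  with insert show ?case
    using assms(1,2) by (simp add: lin_on_add lin_on_scale subspace_scale)
qed

lemma lin_on_zero_span:
  assumes "lin_on V l" "subspace V" "F \<subseteq> V" "\<And>b. b \<in> F \<Longrightarrow> l b = 0" "x \<in> span F"
  shows "l x = 0"
proof -
  have "subspace {x \<in> V. l x = 0}"
    using assms(1,2)
    by (auto simp: subspace_def lin_on_add lin_on_scale lin_on_zero[OF assms(1,2)])
  then have "span F \<subseteq> {x \<in> V. l x = 0}"
    using assms(3,4) by (intro span_minimal) auto
  then show ?thesis using assms(5) by auto
qed

text \<open>\<open>V\<close> is finite-dimensional modulo \<open>N\<close>, with generators inside \<open>V\<close>.\<close>

definition fin_gen :: "'a::real_vector set \<Rightarrow> 'a set \<Rightarrow> bool" where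
  "fin_gen V N \<longleftrightarrow> (\<exists>F. finite F \<and> F \<subseteq> V \<and> (\<forall>x\<in>V. \<exists>y\<in>span F. x - y \<in> N))"

text \<open>Generators outside \<open>V\<close> suffice: the combinations of \<open>F\<close> that lie in \<open>V + N\<close> form a subspace of
  the finite-dimensional span of \<open>F\<close>, and each element of a basis of it can be moved into \<open>V\<close> along \<open>N\<close>.\<close>

lemma fin_gen_of_outer:
  assumes V: "subspace V" and N: "subspace N" and F: "finite F"
    and near: "\<And>x. x \<in> V \<Longrightarrow> \<exists>y\<in>span F. x - y \<in> N"
  shows "fin_gen V N"
proof -
  define V' where "V' = {f \<in> span F. \<exists>v\<in>V. v - f \<in> N}"
  obtain B where B: "B \<subseteq> V'" "independent B" "V' \<subseteq> span B"
    using basis_exists[of V'] by metis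
  have "B \<subseteq> span F" using B(1) by (auto simp: V'_def)
  then have finB: "finite B"
    using independent_span_bound[OF F B(2)] by simp
  have "\<forall>b\<in>B. \<exists>v\<in>V. v - b \<in> N" using B(1) by (auto simp: V'_def)
  then obtain g where g: "\<And>b. b \<in> B \<Longrightarrow> g b \<in> V \<and> g b - b \<in> N" by metis
  have "\<exists>y\<in>span (g ` B). x - y \<in> N" if "x \<in> V" for x
  proof -
    obtain f where f: "f \<in> span F" "x - f \<in> N" using near[OF \<open>x \<in> V\<close>] by blast
    then have "f \<in> V'" using that by (auto simp: V'_def)
    then have "f \<in> span B" using B(3) by auto
    then obtain c where c: "f = (\<Sum>b\<in>B. c b *\<^sub>R b)"
      using span_finite[OF finB] by auto
    define y where "y = (\<Sum>b\<in>B. c b *\<^sub>R g b)"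
    have "y \<in> span (g ` B)"
      unfolding y_def by (intro span_sum span_scale span_base) auto
    moreover have "y - f = (\<Sum>b\<in>B. c b *\<^sub>R (g b - b))"
      by (simp add: y_def c scaleR_diff_right sum_subtractf)
    then have "y - f \<in> N"
      using g by (auto intro!: subspace_sum[OF N] subspace_scale[OF N])
    then have "x - y \<in> N"
      using subspace_diff[OF N f(2), of "y - f"] by simp
    ultimately show ?thesis by blast
  qed
  then show ?thesis
    unfolding fin_gen_def using finB g by (intro exI[of _ "g ` B"]) auto
qed

section \<open>Semi-inner products on finitely generated subspaces\<close>

text \<open>The form may vanish on nonzero vectors, since fields that agree almost everywhere are different
  functions.  Its null vectors play the role of zero.\<close>

locale semi_inner =
  fixes V :: "'a::real_vector set" and ip :: "'a \<Rightarrow> 'a \<Rightarrow> real"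
  assumes sub: "subspace V"
    and sym: "x \<in> V \<Longrightarrow> y \<in> V \<Longrightarrow> ip x y = ip y x"
    and lin: "y \<in> V \<Longrightarrow> lin_on V (\<lambda>x. ip x y)"
    and nonneg: "x \<in> V \<Longrightarrow> 0 \<le> ip x x"
begin

definition sn :: "'a \<Rightarrow> real" where "sn x = sqrt (ip x x)"

definition null :: "'a set" where "null = {x \<in> V. ip x x = 0}"

lemma sn_sq: "x \<in> V \<Longrightarrow> (sn x)\<^sup>2 = ip x x"
  by (simp add: sn_def nonneg)

lemma sn_nonneg [simp]: "x \<in> V \<Longrightarrow> 0 \<le> sn x"
  by (simp add: sn_def nonneg)

lemma lin_right: "y \<in> V \<Longrightarrow> lin_on V (ip y)"
  using lin sym sub by (auto simp: lin_on_def subspace_def)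

lemma add_left: "x \<in> V \<Longrightarrow> y \<in> V \<Longrightarrow> z \<in> V \<Longrightarrow> ip (x + y) z = ip x z + ip y z"
  using lin_on_add[OF lin] by auto

lemma diff_left: "x \<in> V \<Longrightarrow> y \<in> V \<Longrightarrow> z \<in> V \<Longrightarrow> ip (x - y) z = ip x z - ip y z"
  using lin_on_diff[OF lin sub] by auto

lemma scale_left: "x \<in> V \<Longrightarrow> z \<in> V \<Longrightarrow> ip (c *\<^sub>R x) z = c * ip x z"
  using lin_on_scale[OF lin] by auto

lemma add_right: "x \<in> V \<Longrightarrow> y \<in> V \<Longrightarrow> z \<in> V \<Longrightarrow> ip z (x + y) = ip z x + ip z y"
  using lin_on_add[OF lin_right] by auto

lemma diff_right: "x \<in> V \<Longrightarrow> y \<in> V \<Longrightarrow> z \<in> V \<Longrightarrow> ip z (x - y) = ip z x - ip z y"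
  using lin_on_diff[OF lin_right sub] by auto

lemma scale_right: "x \<in> V \<Longrightarrow> z \<in> V \<Longrightarrow> ip z (c *\<^sub>R x) = c * ip z x"
  using lin_on_scale[OF lin_right] by auto

lemma expand_square:
  assumes "x \<in> V" "y \<in> V"
  shows "ip (x - t *\<^sub>R y) (x - t *\<^sub>R y) = ip x x - 2 * t * ip x y + t\<^sup>2 * ip y y"
  using assms sym[of x y]
  by (simp add: diff_left diff_right scale_left scale_right subspace_scale[OF sub]
      subspace_diff[OF sub] power2_eq_square algebra_simps)

lemma cauchy_schwarz:
  assumes "x \<in> V" "y \<in> V"
  shows "\<bar>ip x y\<bar> \<le> sn x * sn y"
proof -
  have key: "0 \<le> ip x x - 2 * t * ip x y + t\<^sup>2 * ip y y" for t
    using expand_square[OF assms, of t] assms nonneg[of "x - t *\<^sub>R y"]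
    by (simp add: subspace_scale[OF sub] subspace_diff[OF sub])
  have "(ip x y)\<^sup>2 \<le> ip x x * ip y y"
  proof (cases "ip y y = 0")
    case True
    have "ip x y = 0"
    proof (rule ccontr)
      assume "ip x y \<noteq> 0"
      \<comment> \<open>With \<open>ip y y = 0\<close> the quadratic in \<open>t\<close> is affine; at this \<open>t\<close> its value is \<open>- 1\<close>.\<close>
      then show False
        using key[of "(ip x x + 1) / (2 * ip x y)"] True by (simp add: field_simps)
    qed
    then show ?thesis using True by simp
  next
    case False
    then have "ip y y > 0" using nonneg[OF assms(2)] by simp
    then show ?thesis
      using key[of "ip x y / ip y y"] by (simp add: field_simps power2_eq_square)
  qed
  then have "sqrt ((ip x y)\<^sup>2) \<le> sqrt (ip x x * ip y y)"
    by (rule real_sqrt_le_mono)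
  then show ?thesis by (simp add: sn_def real_sqrt_mult)
qed

lemma sn_scale: "x \<in> V \<Longrightarrow> sn (c *\<^sub>R x) = \<bar>c\<bar> * sn x"
  by (simp add: sn_def scale_left scale_right subspace_scale[OF sub] real_sqrt_mult
      flip: mult.assoc power2_eq_square)

lemma sn_triangle:
  assumes "x \<in> V" "y \<in> V"
  shows "sn (x + y) \<le> sn x + sn y"
proof (rule power2_le_imp_le)
  have "(sn (x + y))\<^sup>2 = ip x x + 2 * ip x y + ip y y"
    using assms sym[of x y] by (simp add: sn_sq subspace_add[OF sub] add_left add_right)
  also have "\<dots> \<le> (sn x)\<^sup>2 + 2 * (sn x * sn y) + (sn y)\<^sup>2"
    using cauchy_schwarz[OF assms] assms by (simp add: sn_sq)
  also have "\<dots> = (sn x + sn y)\<^sup>2" by (simp add: power2_eq_square algebra_simps)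
  finally show "(sn (x + y))\<^sup>2 \<le> (sn x + sn y)\<^sup>2" .
qed (use assms in auto)

lemma sn_zero [simp]: "sn 0 = 0"
  using sn_scale[of 0 0] sub by (simp add: subspace_0)

lemma sn_minus: "x \<in> V \<Longrightarrow> sn (- x) = sn x"
  using sn_scale[of x "-1"] by simp

lemma sn_diff_commute: "x \<in> V \<Longrightarrow> y \<in> V \<Longrightarrow> sn (x - y) = sn (y - x)"
  using sn_minus[of "x - y"] by (simp add: subspace_diff[OF sub])

lemma sn_triangle_diff: "x \<in> V \<Longrightarrow> y \<in> V \<Longrightarrow> z \<in> V \<Longrightarrow> sn (x - z) \<le> sn (x - y) + sn (y - z)"
  using sn_triangle[of "x - y" "y - z"] by (simp add: subspace_diff[OF sub])

lemma sn_sum: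
  assumes "finite B" "\<And>b. b \<in> B \<Longrightarrow> f b \<in> V"
  shows "sn (\<Sum>b\<in>B. f b) \<le> (\<Sum>b\<in>B. sn (f b))"
  using assms
proof (induction B rule: finite_induct)
  case (insert a B)
  have "(\<Sum>b\<in>B. f b) \<in> V" using insert.prems by (intro subspace_sum[OF sub]) auto
  then show ?case using insert sn_triangle[of "f a" "\<Sum>b\<in>B. f b"] by simp
qed simp

lemma null_iff: "x \<in> null \<longleftrightarrow> x \<in> V \<and> sn x = 0"
  using nonneg by (auto simp: null_def sn_def)

lemma null_left: "x \<in> null \<Longrightarrow> y \<in> V \<Longrightarrow> ip x y = 0"
  using cauchy_schwarz[of x y] by (auto simp: null_iff)

lemma subspace_null: "subspace null"
proof -
  have "sn (x + y) = 0" if "x \<in> V" "y \<in> V" "sn x = 0" "sn y = 0" for x y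
    using sn_triangle[OF that(1,2)] sn_nonneg[OF subspace_add[OF sub that(1,2)]] that(3,4) by simp
  then show ?thesis
    using sub sn_scale by (auto simp: subspace_def null_iff)
qed

text \<open>Gram-Schmidt: a new vector whose orthogonal remainder is null is skipped, otherwise its normalised
  remainder is added.\<close>

lemma orthonormal_exists:
  assumes "finite F" "F \<subseteq> V"
  shows "\<exists>B. finite B \<and> B \<subseteq> span F \<and> (\<forall>b\<in>B. \<forall>b'\<in>B. ip b b' = (if b = b' then 1 else 0)) \<and>
    (\<forall>x\<in>span F. x - (\<Sum>b\<in>B. ip x b *\<^sub>R b) \<in> null)"
  using assms
proof (induction F rule: finite_induct)
  case empty
  show ?case using subspace_0[OF subspace_null] by (intro exI[of _ "{}"]) auto
next
  case (insert a F)
  then obtain B where B: "finite B" "B \<subseteq> span F"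
      "\<forall>b\<in>B. \<forall>b'\<in>B. ip b b' = (if b = b' then 1 else 0)"
      "\<forall>x\<in>span F. x - (\<Sum>b\<in>B. ip x b *\<^sub>R b) \<in> null"
    by auto
  have aV: "a \<in> V" and FV: "F \<subseteq> V" using insert.prems by auto
  have spV: "span F \<subseteq> V" using span_minimal[OF FV sub] .
  have spV': "span (insert a F) \<subseteq> V" using span_minimal[OF insert.prems sub] .
  have BV: "B \<subseteq> V" using B(2) spV by auto
  have BaF: "B \<subseteq> span (insert a F)" using B(2) span_mono[of F "insert a F"] by auto
  define p where "p C x = (\<Sum>b\<in>C. ip x b *\<^sub>R b)" for C x
  have pV: "p C x \<in> V" if "C \<subseteq> V" for C x
    unfolding p_def using that by (intro subspace_sum[OF sub] subspace_scale[OF sub]) auto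
  have plin: "p C (x - k *\<^sub>R y) = p C x - k *\<^sub>R p C y"
    if "C \<subseteq> V" "x \<in> V" "y \<in> V" for C x y k
    unfolding p_def scaleR_sum_right sum_subtractf[symmetric]
    using that by (intro sum.cong) (auto simp: diff_left scale_left subspace_scale[OF sub] scaleR_diff_left)
  \<comment> \<open>\<open>p B\<close> is the orthogonal projection onto the span of \<open>B\<close>, and \<open>a'\<close> the remainder of \<open>a\<close>.\<close>
  define a' where "a' = a - p B a"
  have a'V: "a' \<in> V" unfolding a'_def using aV pV[OF BV] subspace_diff[OF sub] by auto
  have paF: "p B a \<in> span F"
    unfolding p_def using B(2) by (intro span_sum span_scale) auto
  have a'sp: "a' \<in> span (insert a F)"
    unfolding a'_def using paF span_mono[of F "insert a F"]
    by (intro span_diff) (auto intro: span_base)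
  have orth: "ip a' b = 0" if "b \<in> B" for b
  proof -
    have "ip (p B a) b = (\<Sum>c\<in>B. ip a c * ip c b)"
      unfolding p_def using BV that
      by (intro lin_on_sum[OF lin sub B(1)]) auto
    also have "\<dots> = (\<Sum>c\<in>B. if c = b then ip a c else 0)"
      using B(3) that by (intro sum.cong) auto
    also have "\<dots> = ip a b" using that B(1) by simp
    finally show ?thesis
      using that BV aV pV[OF BV] by (auto simp: a'_def diff_left)
  qed
  have orth': "ip b a' = 0" if "b \<in> B" for b
    using orth[OF that] sym[of b a'] that BV a'V by auto
  have decomp: "\<exists>k. \<exists>y\<in>span F. x = y + k *\<^sub>R a" if x: "x \<in> span (insert a F)" for x
    using x span_breakdown_eq[of x a F] by (metis diff_add_cancel)
  show ?case
  proof (cases "ip a' a' = 0")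
    case True
    then have a'null: "a' \<in> null" by (auto simp: null_def a'V)
    have "x - p B x \<in> null" if x: "x \<in> span (insert a F)" for x
    proof -
      obtain k y where y: "y \<in> span F" "x = y + k *\<^sub>R a" using decomp[OF x] by auto
      then have yV: "y \<in> V" using spV by auto
      have "x - p B x = (y - p B y) + k *\<^sub>R a'"
        using plin[OF BV yV aV, of "-k"] y(2) by (simp add: a'_def algebra_simps)
      moreover have "y - p B y \<in> null" using B(4) y(1) by (auto simp: p_def)
      ultimately show ?thesis
        using a'null subspace_null by (simp add: subspace_add subspace_scale)
    qed
    then show ?thesis using B(1,3) BaF by (intro exI[of _ B]) (auto simp: p_def)
  next
    case False
    define e where "e = (1 / sn a') *\<^sub>R a'"
    have pos: "sn a' > 0" using False a'V nonneg[of a'] by (simp add: sn_def)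
    have eV: "e \<in> V" by (simp add: e_def a'V subspace_scale[OF sub])
    have ee: "ip e e = 1"
      using pos a'V False sn_sq[OF a'V]
      by (simp add: e_def scale_left scale_right subspace_scale[OF sub] field_simps power2_eq_square)
    have eb: "ip e b = 0" "ip b e = 0" if "b \<in> B" for b
      using orth[OF that] orth'[OF that] that a'V BV
      by (auto simp: e_def scale_left scale_right subspace_scale[OF sub])
    have eB: "e \<notin> B" using eb ee by force
    have esp: "e \<in> span (insert a F)" by (simp add: e_def a'sp span_scale)
    let ?C = "insert e B"
    have CV: "?C \<subseteq> V" using BV eV by auto
    have pC: "p ?C x = p B x + ip x e *\<^sub>R e" for x
      using eB B(1) by (simp add: p_def)
    have "ip a e *\<^sub>R e = a'"
    proof -
      have "ip (p B a) e = (\<Sum>c\<in>B. ip a c * ip c e)"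
        unfolding p_def using BV eV
        by (intro lin_on_sum[OF lin sub B(1)]) auto
      also have "\<dots> = 0" using eb by simp
      finally have "ip a e = ip a' e"
        using aV eV pV[OF BV] by (simp add: a'_def diff_left)
      also have "\<dots> = sn a'"
        using pos a'V sn_sq[OF a'V]
        by (simp add: e_def scale_right power2_eq_square field_simps)
      finally show ?thesis using pos by (simp add: e_def)
    qed
    then have pa: "p ?C a = a" by (simp add: pC a'_def)
    have "x - p ?C x \<in> null" if x: "x \<in> span (insert a F)" for x
    proof -
      obtain k y where y: "y \<in> span F" "x = y + k *\<^sub>R a" using decomp[OF x] by auto
      then have yV: "y \<in> V" using spV by auto
      have null: "y - p B y \<in> null" using B(4) y(1) by (auto simp: p_def)
      have "ip (p B y) e = (\<Sum>c\<in>B. ip y c * ip c e)"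
        unfolding p_def using BV eV
        by (intro lin_on_sum[OF lin sub B(1)]) auto
      also have "\<dots> = 0" using eb by simp
      finally have "ip y e = ip (y - p B y) e"
        using yV eV pV[OF BV] by (simp add: diff_left)
      also have "\<dots> = 0" using null_left[OF null eV] .
      finally have "p ?C y = p B y" by (simp add: pC)
      moreover have "x - p ?C x = y - p ?C y"
        using plin[OF CV yV aV, of "-k"] y(2) by (simp add: pa algebra_simps)
      ultimately show ?thesis using null by simp
    qed
    then show ?thesis using B(1,3) BaF esp ee eb
      by (intro exI[of _ ?C]) (auto simp: p_def)
  qed
qed

lemma orthonormal_basis:
  assumes "fin_gen V null"
  obtains B where "finite B" "B \<subseteq> V" "\<And>b b'. b \<in> B \<Longrightarrow> b' \<in> B \<Longrightarrow> ip b b' = (if b = b' then 1 else 0)"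
    "\<And>x. x \<in> V \<Longrightarrow> x - (\<Sum>b\<in>B. ip x b *\<^sub>R b) \<in> null"
proof -
  obtain F where F: "finite F" "F \<subseteq> V" "\<And>x. x \<in> V \<Longrightarrow> \<exists>y\<in>span F. x - y \<in> null"
    using assms by (auto simp: fin_gen_def)
  obtain B where B: "finite B" "B \<subseteq> span F"
      "\<forall>b\<in>B. \<forall>b'\<in>B. ip b b' = (if b = b' then 1 else 0)"
      "\<forall>x\<in>span F. x - (\<Sum>b\<in>B. ip x b *\<^sub>R b) \<in> null"
    using orthonormal_exists[OF F(1,2)] by auto
  have spV: "span F \<subseteq> V" using span_minimal[OF F(2) sub] .
  then have BV: "B \<subseteq> V" using B(2) by auto
  have "x - (\<Sum>b\<in>B. ip x b *\<^sub>R b) \<in> null" if x: "x \<in> V" for x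
  proof -
    obtain y where y: "y \<in> span F" "x - y \<in> null" using F(3)[OF x] by auto
    have "ip x b = ip y b" if "b \<in> B" for b
      using null_left[OF y(2), of b] diff_left[of x y b] x y(1) spV that BV by auto
    then have "x - (\<Sum>b\<in>B. ip x b *\<^sub>R b) = (x - y) + (y - (\<Sum>b\<in>B. ip y b *\<^sub>R b))"
      by simp
    then show ?thesis using B(4) y subspace_add[OF subspace_null] by metis
  qed
  with B(1,3) BV show ?thesis using that by auto
qed

lemma riesz:
  assumes "fin_gen V null" and l: "lin_on V l" and l0: "\<And>x. x \<in> null \<Longrightarrow> l x = 0"
  obtains y where "y \<in> V" "\<And>x. x \<in> V \<Longrightarrow> ip y x = l x"
proof -
  obtain B where B: "finite B" "B \<subseteq> V"
    "\<And>b b'. b \<in> B \<Longrightarrow> b' \<in> B \<Longrightarrow> ip b b' = (if b = b' then 1 else 0)"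
    "\<And>x. x \<in> V \<Longrightarrow> x - (\<Sum>b\<in>B. ip x b *\<^sub>R b) \<in> null"
    using orthonormal_basis[OF assms(1)] by metis
  define y where "y = (\<Sum>b\<in>B. l b *\<^sub>R b)"
  have yV: "y \<in> V" unfolding y_def using B(2)
    by (intro subspace_sum[OF sub] subspace_scale[OF sub]) auto
  have "ip y x = l x" if x: "x \<in> V" for x
  proof -
    define z where "z = (\<Sum>b\<in>B. ip x b *\<^sub>R b)"
    have zV: "z \<in> V" unfolding z_def using B(2)
      by (intro subspace_sum[OF sub] subspace_scale[OF sub]) auto
    have "l x - l z = 0" using l0[OF B(4)[OF x]] lin_on_diff[OF l sub x zV] by (simp add: z_def)
    moreover have "l z = (\<Sum>b\<in>B. ip x b * l b)"
      unfolding z_def using B(2) by (intro lin_on_sum[OF l sub B(1)]) auto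
    moreover have "ip y x = (\<Sum>b\<in>B. l b * ip b x)"
      unfolding y_def using B(2) by (intro lin_on_sum[OF lin[OF x] sub B(1)]) auto
    moreover have "ip b x = ip x b" if "b \<in> B" for b
      using sym x that B(2) by blast
    ultimately show ?thesis by (simp add: mult.commute)
  qed
  with yV show ?thesis using that by auto
qed

text \<open>The coordinates with respect to an orthonormal basis are Cauchy sequences of reals.\<close>

lemma complete:
  assumes "fin_gen V null" and u: "\<And>n::nat. u n \<in> V"
    and cauchy: "\<And>e. e > 0 \<Longrightarrow> \<exists>M. \<forall>m\<ge>M. \<forall>n\<ge>M. sn (u m - u n) < e"
  obtains x where "x \<in> V" "(\<lambda>n. sn (u n - x)) \<longlonglongrightarrow> 0"
proof -
  obtain B where B: "finite B" "B \<subseteq> V"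
    "\<And>b b'. b \<in> B \<Longrightarrow> b' \<in> B \<Longrightarrow> ip b b' = (if b = b' then 1 else 0)"
    "\<And>x. x \<in> V \<Longrightarrow> x - (\<Sum>b\<in>B. ip x b *\<^sub>R b) \<in> null"
    using orthonormal_basis[OF assms(1)] by metis
  have unit: "sn b = 1" if "b \<in> B" for b using B(3) that by (simp add: sn_def)
  have conv: "convergent (\<lambda>n. ip (u n) b)" if b: "b \<in> B" for b
  proof -
    have "Cauchy (\<lambda>n. ip (u n) b)"
      unfolding Cauchy_def
    proof (intro allI impI)
      fix e :: real assume "e > 0"
      then obtain M where M: "\<forall>m\<ge>M. \<forall>n\<ge>M. sn (u m - u n) < e" using cauchy by blast
      have "dist (ip (u m) b) (ip (u n) b) < e" if "m \<ge> M" "n \<ge> M" for m n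
      proof -
        have bV: "b \<in> V" using b B(2) by auto
        have "\<bar>ip (u m - u n) b\<bar> \<le> sn (u m - u n) * sn b"
          using u bV subspace_diff[OF sub] by (intro cauchy_schwarz) auto
        then show ?thesis using M that unit[OF b] u bV
          by (simp add: dist_real_def diff_left) (meson le_less_trans)
      qed
      then show "\<exists>M. \<forall>m\<ge>M. \<forall>n\<ge>M. dist (ip (u m) b) (ip (u n) b) < e" by blast
    qed
    then show ?thesis by (simp add: Cauchy_convergent_iff)
  qed
  define c where "c b = lim (\<lambda>n. ip (u n) b)" for b
  have c: "(\<lambda>n. ip (u n) b) \<longlonglongrightarrow> c b" if "b \<in> B" for b
    using conv[OF that] by (simp add: c_def convergent_LIMSEQ_iff)
  define x where "x = (\<Sum>b\<in>B. c b *\<^sub>R b)"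
  have xV: "x \<in> V" unfolding x_def using B(2)
    by (intro subspace_sum[OF sub] subspace_scale[OF sub]) auto
  have bound: "sn (u n - x) \<le> (\<Sum>b\<in>B. \<bar>ip (u n) b - c b\<bar>)" for n
  proof -
    define z where "z = (\<Sum>b\<in>B. ip (u n) b *\<^sub>R b)"
    have zV: "z \<in> V" unfolding z_def using B(2)
      by (intro subspace_sum[OF sub] subspace_scale[OF sub]) auto
    have zx: "z - x = (\<Sum>b\<in>B. (ip (u n) b - c b) *\<^sub>R b)"
      by (simp add: z_def x_def sum_subtractf scaleR_diff_left)
    have "sn (z - x) \<le> (\<Sum>b\<in>B. sn ((ip (u n) b - c b) *\<^sub>R b))"
      unfolding zx using B(1,2) by (intro sn_sum) (auto simp: subspace_scale[OF sub])
    also have "\<dots> = (\<Sum>b\<in>B. \<bar>ip (u n) b - c b\<bar>)"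
      using B(2) unit by (intro sum.cong) (auto simp: sn_scale subset_iff)
    finally have "sn (z - x) \<le> (\<Sum>b\<in>B. \<bar>ip (u n) b - c b\<bar>)" .
    moreover have "sn (u n - z) = 0" using B(4)[OF u[of n]] by (simp add: z_def null_iff)
    ultimately show ?thesis using sn_triangle_diff[of "u n" z x] u xV zV by fastforce
  qed
  have "(\<lambda>n. \<Sum>b\<in>B. \<bar>ip (u n) b - c b\<bar>) \<longlonglongrightarrow> (\<Sum>b\<in>B. \<bar>c b - c b\<bar>)"
    by (intro tendsto_sum tendsto_rabs tendsto_diff c tendsto_const)
  then have "(\<lambda>n. sn (u n - x)) \<longlonglongrightarrow> 0"
    using bound u xV subspace_diff[OF sub]
    by (intro tendsto_sandwich[of "\<lambda>_. 0" "\<lambda>n. sn (u n - x)" _ "\<lambda>n. \<Sum>b\<in>B. \<bar>ip (u n) b - c b\<bar>"])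
      (auto intro!: always_eventually)
  with xV show ?thesis using that by auto
qed

text \<open>Banach's theorem on a ball.  Only a seminorm is available, hence the fixed point is one up to a
  null vector.\<close>

lemma contraction_fixed_point:
  assumes fg: "fin_gen V null" and r: "0 \<le> r" and L: "0 \<le> L" "L < 1"
    and J: "\<And>w. w \<in> V \<Longrightarrow> sn w \<le> r \<Longrightarrow> J w \<in> V \<and> sn (J w) \<le> r"
    and contr: "\<And>w w'. w \<in> V \<Longrightarrow> w' \<in> V \<Longrightarrow> sn w \<le> r \<Longrightarrow> sn w' \<le> r \<Longrightarrow>
        sn (J w - J w') \<le> L * sn (w - w')"
  obtains x where "x \<in> V" "sn x \<le> r" "sn (J x - x) = 0"
proof -
  define u where "u n = (J ^^ n) 0" for n
  have u0: "u n \<in> V \<and> sn (u n) \<le> r" for n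
    by (induction n) (auto simp: u_def J r subspace_0[OF sub])
  have uV: "u n \<in> V" for n using u0 by auto
  have uS: "u (Suc n) = J (u n)" for n by (simp add: u_def)
  define D where "D = sn (u 1 - u 0)"
  have step: "sn (u (Suc n) - u n) \<le> L ^ n * D" for n
  proof (induction n)
    case (Suc n)
    have "sn (u (Suc (Suc n)) - u (Suc n)) \<le> L * sn (u (Suc n) - u n)"
      unfolding uS using u0 by (metis contr uS)
    also have "\<dots> \<le> L * (L ^ n * D)" using Suc L by (intro mult_left_mono)
    finally show ?case by simp
  qed (simp add: D_def)
  have far: "sn (u (n + k) - u n) \<le> (\<Sum>i<k. L ^ (n + i) * D)" for n k
  proof (induction k)
    case (Suc k)
    have "sn (u (n + Suc k) - u n) \<le> sn (u (Suc (n + k)) - u (n + k)) + sn (u (n + k) - u n)"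
      using sn_triangle_diff[OF uV uV uV] by simp
    then show ?case using Suc step[of "n + k"] by simp
  qed simp
  have D0: "0 \<le> D" unfolding D_def using uV subspace_diff[OF sub] by simp
  \<comment> \<open>A geometric tail, uniformly in \<open>k\<close>.\<close>
  have geo: "sn (u (n + k) - u n) \<le> L ^ n * (D / (1 - L))" for n k
  proof -
    have "(\<Sum>i<k. L ^ (n + i) * D) = L ^ n * D * (\<Sum>i<k. L ^ i)"
      by (simp add: power_add sum_distrib_left mult_ac)
    also have "(\<Sum>i<k. L ^ i) = (1 - L ^ k) / (1 - L)"
      using L sum_gp_strict[of L k] by simp
    also have "\<dots> \<le> 1 / (1 - L)" using L by (intro divide_right_mono) auto
    finally show ?thesis using far[of n k] L D0
      by (simp add: mult_left_mono)
  qed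
  have lim: "(\<lambda>n. L ^ n * (D / (1 - L))) \<longlonglongrightarrow> 0"
    using L by (intro tendsto_mult_left_zero LIMSEQ_power_zero) auto
  have "\<exists>M. \<forall>m\<ge>M. \<forall>n\<ge>M. sn (u m - u n) < e" if e: "e > 0" for e
  proof -
    obtain M where M: "\<And>n. n \<ge> M \<Longrightarrow> \<bar>L ^ n * (D / (1 - L))\<bar> < e"
      using LIMSEQ_D[OF lim e] by auto
    have "sn (u m - u n) < e" if "m \<ge> M" "n \<ge> M" for m n
    proof (cases "n \<le> m")
      case True
      then show ?thesis using geo[of n "m - n"] abs_less_iff[THEN iffD1, OF M[OF that(2)]] by simp
    next
      case False
      then show ?thesis using geo[of m "n - m"] abs_less_iff[THEN iffD1, OF M[OF that(1)]] sn_diff_commute[OF uV uV, of m n] by simp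
    qed
    then show ?thesis by blast
  qed
  then obtain x where x: "x \<in> V" "(\<lambda>n. sn (u n - x)) \<longlonglongrightarrow> 0"
    using complete[OF fg, of u] uV by blast
  have "sn x \<le> r + sn (u n - x)" for n
    using sn_triangle_diff[of x "u n" 0] x uV u0[of n] sn_diff_commute[of x "u n"] subspace_0[OF sub]
    by simp
  then have xr: "sn x \<le> r"
    using x(2) by (intro LIMSEQ_le_const[of "\<lambda>n. r + sn (u n - x)" r "sn x"])
      (auto intro!: tendsto_eq_intros)
  have "sn (J x - x) \<le> L * sn (u n - x) + sn (u (Suc n) - x)" for n
  proof -
    have "sn (J x - x) \<le> sn (J x - u (Suc n)) + sn (u (Suc n) - x)"
      using x(1) xr J uV by (intro sn_triangle_diff) auto
    moreover have "sn (J x - u (Suc n)) \<le> L * sn (x - u n)"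
      unfolding uS using x(1) xr u0 by (intro contr) auto
    ultimately show ?thesis using sn_diff_commute[OF x(1) uV] by simp
  qed
  moreover have "(\<lambda>n. L * sn (u n - x) + sn (u (Suc n) - x)) \<longlonglongrightarrow> L * 0 + 0"
    using x(2) LIMSEQ_Suc[OF x(2)] by (intro tendsto_intros)
  ultimately have "sn (J x - x) \<le> 0"
    by (intro LIMSEQ_le_const[of "\<lambda>n. L * sn (u n - x) + sn (u (Suc n) - x)"]) auto
  moreover have "0 \<le> sn (J x - x)" using x(1) xr J subspace_diff[OF sub] by simp
  ultimately show ?thesis using that x(1) xr by auto
qed

text \<open>Writing \<open>B\<close> as a matrix, this solves \<open>A u = l\<close> by \<open>u = A\<^sup>T y\<close> with \<open>A A\<^sup>T y = l\<close>: the form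
  \<open>(x, y) \<mapsto> \<Sum>\<^sub>b B b x * B b y\<close> over generators \<open>b\<close> is a semi-inner product, injectivity of the adjoint
  says that it has the same null vectors as \<open>ip\<close>, and the Riesz theorem for it yields \<open>y\<close>.\<close>

lemma solve_bilinear:
  assumes fg: "fin_gen V null"
    and B1: "\<And>y. y \<in> V \<Longrightarrow> lin_on V (\<lambda>x. B x y)"
    and B2: "\<And>x. x \<in> V \<Longrightarrow> lin_on V (B x)"
    and Bnull: "\<And>x y. x \<in> null \<Longrightarrow> y \<in> V \<Longrightarrow> B x y = 0 \<and> B y x = 0"
    and inj: "\<And>y. y \<in> V \<Longrightarrow> (\<And>x. x \<in> V \<Longrightarrow> B x y = 0) \<Longrightarrow> y \<in> null"
    and l: "lin_on V l" and l0: "\<And>x. x \<in> null \<Longrightarrow> l x = 0"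
  obtains u where "u \<in> V" "\<And>v. v \<in> V \<Longrightarrow> B u v = l v"
proof -
  obtain F where F: "finite F" "F \<subseteq> V" "\<And>x. x \<in> V \<Longrightarrow> \<exists>y\<in>span F. x - y \<in> null"
    using fg by (auto simp: fin_gen_def)
  have spV: "span F \<subseteq> V" using span_minimal[OF F(2) sub] .
  define ip' where "ip' x y = (\<Sum>b\<in>F. B b x * B b y)" for x y
  have linB: "b \<in> F \<Longrightarrow> x \<in> V \<Longrightarrow> y \<in> V \<Longrightarrow> B b (x + y) = B b x + B b y"
      "b \<in> F \<Longrightarrow> x \<in> V \<Longrightarrow> B b (c *\<^sub>R x) = c * B b x" for b x y c
    using lin_on_add[OF B2] lin_on_scale[OF B2] F(2) by auto
  interpret S: semi_inner V ip'
  proof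
    show "subspace V" by (rule sub)
    show "ip' x y = ip' y x" for x y by (simp add: ip'_def mult.commute)
    show "lin_on V (\<lambda>x. ip' x y)" if "y \<in> V" for y
    proof (rule lin_onI)
      show "ip' (x + z) y = ip' x y + ip' z y" if "x \<in> V" "z \<in> V" for x z
        using that unfolding ip'_def sum.distrib[symmetric]
        by (intro sum.cong) (simp_all add: linB distrib_right)
      show "ip' (c *\<^sub>R x) y = c * ip' x y" if "x \<in> V" for c x
        using that unfolding ip'_def sum_distrib_left
        by (intro sum.cong) (simp_all add: linB)
    qed
    show "0 \<le> ip' x x" for x by (simp add: ip'_def sum_nonneg)
  qed
  have S_null: "x \<in> S.null \<longleftrightarrow> x \<in> V \<and> (\<forall>b\<in>F. B b x = 0)" for x
    using F(1) by (auto simp: S.null_def ip'_def sum_nonneg_eq_0_iff)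
  have null_S: "null \<subseteq> S.null"
    using Bnull F(2) by (force simp: S_null null_def)
  have S_null': "S.null \<subseteq> null"
  proof
    fix y assume y: "y \<in> S.null"
    then have yV: "y \<in> V" by (simp add: S_null)
    have "B x y = 0" if x: "x \<in> V" for x
    proof -
      obtain z where z: "z \<in> span F" "x - z \<in> null" using F(3)[OF x] by blast
      have "B z y = 0"
        by (rule lin_on_zero_span[OF B1[OF yV] sub F(2) _ z(1)]) (use y in \<open>simp add: S_null\<close>)
      moreover have "B (x - z) y = B x y - B z y"
        using z spV x by (intro lin_on_diff[OF B1[OF yV] sub]) auto
      ultimately show ?thesis using Bnull[OF z(2) yV] by simp
    qed
    then show "y \<in> null" using inj yV by blast
  qed
  have "fin_gen V S.null"
    unfolding fin_gen_def
  proof (intro exI conjI ballI)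
    show "\<exists>y\<in>span F. x - y \<in> S.null" if "x \<in> V" for x
      using F(3)[OF that] null_S by blast
  qed (fact F)+
  then obtain y where y: "y \<in> V" "\<And>x. x \<in> V \<Longrightarrow> ip' y x = l x"
    using S.riesz[OF _ l] l0 S_null' by blast
  define u where "u = (\<Sum>b\<in>F. B b y *\<^sub>R b)"
  have "u \<in> V" unfolding u_def using F(2)
    by (intro subspace_sum[OF sub] subspace_scale[OF sub]) auto
  moreover have "B u v = l v" if v: "v \<in> V" for v
  proof -
    have "B u v = (\<Sum>b\<in>F. B b y * B b v)"
      unfolding u_def using F(2) by (intro lin_on_sum[OF B1[OF v] sub F(1)]) auto
    then show ?thesis using y(2)[OF v] by (simp add: ip'_def)
  qed
  ultimately show ?thesis using that by auto
qed

end

section \<open>Square-integrable fields\<close>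

lemma inner_le_sum_of_squares: "\<bar>a \<bullet> b\<bar> \<le> (norm a)\<^sup>2 + (norm b)\<^sup>2" for a b :: "'a::real_inner"
proof -
  have "\<bar>a \<bullet> b\<bar> \<le> norm a * norm b" by (rule Cauchy_Schwarz_ineq2)
  also have "\<dots> \<le> (norm a)\<^sup>2 + (norm b)\<^sup>2"
    using sum_squares_bound[of "norm a" "norm b"] mult_nonneg_nonneg[OF norm_ge_zero[of a] norm_ge_zero[of b]] by linarith
  finally show ?thesis .
qed

definition L2_ip :: "(real^2) set \<Rightarrow> (real^2 \<Rightarrow> 'a::euclidean_space) \<Rightarrow> (real^2 \<Rightarrow> 'a) \<Rightarrow> real" where
  "L2_ip \<Omega> f g = (LINT x|lebesgue_on \<Omega>. f x \<bullet> g x)"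

lemma L2_measurable: "f \<in> L2 \<Omega> \<Longrightarrow> f \<in> borel_measurable (lebesgue_on \<Omega>)"
  by (simp add: L2_def)

lemma L2_integrable_square: "f \<in> L2 \<Omega> \<Longrightarrow> integrable (lebesgue_on \<Omega>) (\<lambda>x. (norm (f x))\<^sup>2)"
  by (simp add: L2_def)

lemma L2_inner_integrable:
  assumes "f \<in> L2 \<Omega>" "g \<in> L2 \<Omega>"
  shows "integrable (lebesgue_on \<Omega>) (\<lambda>x. f x \<bullet> g x)"
proof (rule Bochner_Integration.integrable_bound)
  show "integrable (lebesgue_on \<Omega>) (\<lambda>x. (norm (f x))\<^sup>2 + (norm (g x))\<^sup>2)"
    using assms by (intro Bochner_Integration.integrable_add) (auto simp: L2_def)
  show "(\<lambda>x. f x \<bullet> g x) \<in> borel_measurable (lebesgue_on \<Omega>)"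
    using assms by (intro borel_measurable_inner) (auto simp: L2_def)
  show "AE x in lebesgue_on \<Omega>. norm (f x \<bullet> g x) \<le> norm ((norm (f x))\<^sup>2 + (norm (g x))\<^sup>2)"
    using inner_le_sum_of_squares by auto
qed

lemma L2_mult_integrable:
  fixes f g :: scalar_field
  shows "f \<in> L2 \<Omega> \<Longrightarrow> g \<in> L2 \<Omega> \<Longrightarrow> integrable (lebesgue_on \<Omega>) (\<lambda>x. f x * g x)"
  using L2_inner_integrable[of f \<Omega> g] by simp

lemma L2_dominated:
  fixes f :: "real^2 \<Rightarrow> 'a::euclidean_space" and g :: "real^2 \<Rightarrow> 'b::euclidean_space"
  assumes f: "f \<in> borel_measurable (lebesgue_on \<Omega>)" and g: "g \<in> L2 \<Omega>"
    and le: "AE x in lebesgue_on \<Omega>. norm (f x) \<le> C * norm (g x)"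
  shows "f \<in> L2 \<Omega>"
proof -
  have "integrable (lebesgue_on \<Omega>) (\<lambda>x. (norm (f x))\<^sup>2)"
  proof (rule Bochner_Integration.integrable_bound)
    show "integrable (lebesgue_on \<Omega>) (\<lambda>x. C\<^sup>2 * (norm (g x))\<^sup>2)"
      using g by (auto simp: L2_def)
    show "(\<lambda>x. (norm (f x))\<^sup>2) \<in> borel_measurable (lebesgue_on \<Omega>)"
      using f by measurable
    show "AE x in lebesgue_on \<Omega>. norm ((norm (f x))\<^sup>2) \<le> norm (C\<^sup>2 * (norm (g x))\<^sup>2)"
      using le
    proof eventually_elim
      case (elim x)
      then have "(norm (f x))\<^sup>2 \<le> (C * norm (g x))\<^sup>2" by (intro power_mono) auto
      then show ?case by (simp add: power_mult_distrib)
    qed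
  qed
  then show ?thesis using f by (simp add: L2_def)
qed

lemma L2_scaleR: "f \<in> L2 \<Omega> \<Longrightarrow> c *\<^sub>R f \<in> L2 \<Omega>"
  by (rule L2_dominated[of _ _ f "\<bar>c\<bar>"]) (auto simp: L2_def scaleR_fun_def)

lemma L2_add:
  assumes "f \<in> L2 \<Omega>" "g \<in> L2 \<Omega>"
  shows "f + g \<in> L2 \<Omega>"
proof -
  have meas: "(\<lambda>x. f x + g x) \<in> borel_measurable (lebesgue_on \<Omega>)"
    using assms by (auto simp: L2_def)
  have "integrable (lebesgue_on \<Omega>) (\<lambda>x. (norm (f x + g x))\<^sup>2)"
  proof (rule Bochner_Integration.integrable_bound)
    show "integrable (lebesgue_on \<Omega>) (\<lambda>x. 2 * (norm (f x))\<^sup>2 + 2 * (norm (g x))\<^sup>2)"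
      using assms by (auto simp: L2_def)
    show "(\<lambda>x. (norm (f x + g x))\<^sup>2) \<in> borel_measurable (lebesgue_on \<Omega>)"
      using meas by measurable
    have "(norm (f x + g x))\<^sup>2 \<le> 2 * (norm (f x))\<^sup>2 + 2 * (norm (g x))\<^sup>2" for x
    proof -
      have "(norm (f x + g x))\<^sup>2 \<le> (norm (f x) + norm (g x))\<^sup>2"
        by (intro power_mono norm_triangle_ineq) auto
      also have "\<dots> \<le> 2 * (norm (f x))\<^sup>2 + 2 * (norm (g x))\<^sup>2"
        using sum_squares_bound[of "norm (f x)" "norm (g x)"] by (simp add: power2_sum)
      finally show ?thesis .
    qed
    then show "AE x in lebesgue_on \<Omega>. norm ((norm (f x + g x))\<^sup>2) \<le>
        norm (2 * (norm (f x))\<^sup>2 + 2 * (norm (g x))\<^sup>2)"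
      by auto
  qed
  then show ?thesis using meas by (simp add: L2_def plus_fun_def)
qed

lemma subspace_L2: "subspace (L2 \<Omega>)"
  by (rule subspaceI) (auto simp: L2_add L2_scaleR, simp add: L2_def zero_fun_def)

lemma L2_norm_eq: "L2_norm \<Omega> f = sqrt (L2_ip \<Omega> f f)"
  by (simp add: L2_norm_def L2_ip_def dot_square_norm)

lemma semi_inner_L2: "semi_inner (L2 \<Omega>) (L2_ip \<Omega>)"
proof
  show "subspace (L2 \<Omega>)" by (rule subspace_L2)
  show "L2_ip \<Omega> f g = L2_ip \<Omega> g f" for f g :: "real^2 \<Rightarrow> 'a"
    by (simp add: L2_ip_def inner_commute)
  show "lin_on (L2 \<Omega>) (\<lambda>f. L2_ip \<Omega> f g)" if "g \<in> L2 \<Omega>" for g :: "real^2 \<Rightarrow> 'a"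
    using that by (intro lin_onI) (simp_all add: L2_ip_def L2_inner_integrable inner_add_left)
  show "0 \<le> L2_ip \<Omega> f f" for f :: "real^2 \<Rightarrow> 'a"
    by (simp add: L2_ip_def)
qed

lemma sn_L2_ip: "semi_inner.sn (L2_ip \<Omega>) = L2_norm \<Omega>"
  by (simp add: fun_eq_iff semi_inner.sn_def[OF semi_inner_L2] L2_norm_eq)

interpretation L2: semi_inner "L2 \<Omega> :: (real^2 \<Rightarrow> 'a::euclidean_space) set" "L2_ip \<Omega>"
  rewrites "semi_inner.sn (L2_ip \<Omega>) = L2_norm \<Omega>"
  for \<Omega>
  by (rule semi_inner_L2, rule sn_L2_ip)

lemma L2_norm_nonneg [simp]: "0 \<le> L2_norm \<Omega> f"
  by (simp add: L2_norm_def)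

lemma L2_norm_square: "(L2_norm \<Omega> f)\<^sup>2 = (LINT x|lebesgue_on \<Omega>. (norm (f x))\<^sup>2)"
  by (simp add: L2_norm_def)

lemma L2_norm_eq_0_iff:
  assumes "f \<in> L2 \<Omega>"
  shows "L2_norm \<Omega> f = 0 \<longleftrightarrow> ae_eq \<Omega> f 0"
  using integral_nonneg_eq_0_iff_AE[OF L2_integrable_square[OF assms]]
  by (simp add: L2_norm_def ae_eq_def)

lemma ae_eq_refl [simp]: "ae_eq \<Omega> f f"
  by (simp add: ae_eq_def)

lemma ae_eq_sym: "ae_eq \<Omega> f g \<Longrightarrow> ae_eq \<Omega> g f"
  unfolding ae_eq_def by (erule AE_mp) auto

lemma ae_eq_trans: "ae_eq \<Omega> f g \<Longrightarrow> ae_eq \<Omega> g h \<Longrightarrow> ae_eq \<Omega> f h"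
  unfolding ae_eq_def by (erule (1) eventually_elim2) simp

lemma ae_eq_add: "ae_eq \<Omega> f f' \<Longrightarrow> ae_eq \<Omega> g g' \<Longrightarrow> ae_eq \<Omega> (f + g) (f' + g')"
  for f g :: "real^2 \<Rightarrow> 'a::real_vector"
  unfolding ae_eq_def by (erule (1) eventually_elim2) simp

lemma ae_eq_scaleR: "ae_eq \<Omega> f f' \<Longrightarrow> ae_eq \<Omega> (c *\<^sub>R f) (c *\<^sub>R f')"
  for f :: "real^2 \<Rightarrow> 'a::real_vector"
  unfolding ae_eq_def by (erule eventually_mono) simp

lemma ae_eq_diff_0_iff: "ae_eq \<Omega> (f - g) 0 \<longleftrightarrow> ae_eq \<Omega> f g"
  for f :: "real^2 \<Rightarrow> 'a::real_vector"
  by (simp add: ae_eq_def)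

lemma L2_norm_le_of_ae:
  assumes "f \<in> L2 \<Omega>" "g \<in> L2 \<Omega>" "0 \<le> C" "AE x in lebesgue_on \<Omega>. norm (f x) \<le> C * norm (g x)"
  shows "L2_norm \<Omega> f \<le> C * L2_norm \<Omega> g"
proof (rule power2_le_imp_le)
  have "(LINT x|lebesgue_on \<Omega>. (norm (f x))\<^sup>2) \<le> (LINT x|lebesgue_on \<Omega>. C\<^sup>2 * (norm (g x))\<^sup>2)"
  proof (intro integral_mono_AE)
    show "AE x in lebesgue_on \<Omega>. (norm (f x))\<^sup>2 \<le> C\<^sup>2 * (norm (g x))\<^sup>2"
      using assms(4)
    proof eventually_elim
      case (elim x)
      then have "(norm (f x))\<^sup>2 \<le> (C * norm (g x))\<^sup>2" by (intro power_mono) auto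
      then show ?case by (simp add: power_mult_distrib)
    qed
  qed (use assms in \<open>auto simp: L2_def\<close>)
  then show "(L2_norm \<Omega> f)\<^sup>2 \<le> (C * L2_norm \<Omega> g)\<^sup>2"
    by (simp add: L2_norm_square power_mult_distrib)
qed (use assms(3) in auto)

lemma L2_comp:
  fixes f :: "real^2 \<Rightarrow> ('a::euclidean_space)^'n"
  assumes "f \<in> L2 \<Omega>"
  shows "(\<lambda>x. f x $ i) \<in> L2 \<Omega>"
proof (rule L2_dominated[OF _ assms, of _ 1])
  have "continuous_on UNIV (\<lambda>v::'a^'n. v $ i)" by (intro continuous_intros)
  then show "(\<lambda>x. f x $ i) \<in> borel_measurable (lebesgue_on \<Omega>)"
    using L2_measurable[OF assms] by (rule borel_measurable_continuous_on)
qed (simp add: Finite_Cartesian_Product.norm_nth_le)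

lemma L2_norm_comp:
  fixes f :: "real^2 \<Rightarrow> ('a::euclidean_space)^'n"
  assumes "f \<in> L2 \<Omega>"
  shows "(L2_norm \<Omega> f)\<^sup>2 = (\<Sum>i\<in>UNIV. (L2_norm \<Omega> (\<lambda>x. f x $ i))\<^sup>2)"
proof -
  have "(norm v)\<^sup>2 = (\<Sum>i\<in>UNIV. (norm (v $ i))\<^sup>2)" for v :: "'a^'n"
    by (simp add: norm_vec_def L2_set_def sum_nonneg)
  then show ?thesis
    using L2_comp[OF assms]
    by (simp add: L2_norm_square L2_integrable_square)
qed

lemma L2_vec_lambda:
  fixes f :: "2 \<Rightarrow> scalar_field"
  assumes "\<And>i. f i \<in> L2 \<Omega>"
  shows "(\<lambda>x. \<chi> i. f i x) \<in> L2 \<Omega>"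
proof -
  have "(\<lambda>x. (\<chi> i. f i x) \<bullet> b) \<in> borel_measurable (lebesgue_on \<Omega>)" if "b \<in> Basis" for b :: "real^2"
  proof -
    obtain i where "b = axis i 1" using axis_inverse[OF \<open>b \<in> Basis\<close>] by blast
    then show ?thesis using L2_measurable[OF assms] by (simp add: inner_axis)
  qed
  then have "(\<lambda>x. \<chi> i. f i x) \<in> borel_measurable (lebesgue_on \<Omega>)"
    by (subst borel_measurable_euclidean_space) blast
  moreover have "(norm (\<chi> i. f i x))\<^sup>2 = (\<Sum>i\<in>UNIV. (norm (f i x))\<^sup>2)" for x
    by (simp add: norm_vec_def L2_set_def sum_nonneg)
  ultimately show ?thesis
    using L2_integrable_square[OF assms] by (simp add: L2_def)
qed

lemma finite_lebesgue_on:
  assumes "bounded \<Omega>" "\<Omega> \<in> sets lebesgue"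
  shows "finite_measure (lebesgue_on \<Omega>)"
proof
  have "\<Omega> \<in> lmeasurable" using bounded_set_imp_lmeasurable[OF assms] .
  then show "emeasure (lebesgue_on \<Omega>) (space (lebesgue_on \<Omega>)) \<noteq> \<infinity>"
    using assms(2) by (simp add: emeasure_restrict_space fmeasurable_def)
qed

lemma L2_bounded:
  fixes f :: "real^2 \<Rightarrow> 'a::euclidean_space"
  assumes "bounded \<Omega>" "\<Omega> \<in> sets lebesgue"
    and f: "f \<in> borel_measurable (lebesgue_on \<Omega>)" and C: "AE x in lebesgue_on \<Omega>. norm (f x) \<le> C"
  shows "f \<in> L2 \<Omega>"
proof -
  interpret finite_measure "lebesgue_on \<Omega>" using finite_lebesgue_on[OF assms(1,2)] .
  have "(\<lambda>x. 1::real) \<in> L2 \<Omega>" by (simp add: L2_def)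
  then show ?thesis using C by (intro L2_dominated[OF f, of "\<lambda>x. 1::real" C]) auto
qed

lemma L2_integrable:
  fixes f :: scalar_field
  assumes "bounded \<Omega>" "\<Omega> \<in> sets lebesgue" "f \<in> L2 \<Omega>"
  shows "integrable (lebesgue_on \<Omega>) f"
  using L2_mult_integrable[OF assms(3) L2_bounded[OF assms(1,2), of "\<lambda>x. 1" 1]] by simp

lemma borel_measurable_continuous_lebesgue_on:
  fixes f :: "real^2 \<Rightarrow> 'a::euclidean_space"
  assumes "continuous_on UNIV f"
  shows "f \<in> borel_measurable (lebesgue_on \<Omega>)"
proof -
  have "f \<in> borel_measurable lebesgue"
    using borel_measurable_continuous_onI[OF assms] by (simp add: measurable_completion)
  then show ?thesis by (rule measurable_restrict_space1)
qed

lemma borel_measurable_lebesgue_on: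
  "f \<in> borel_measurable borel \<Longrightarrow> f \<in> borel_measurable (lebesgue_on \<Omega>)"
  by (intro measurable_restrict_space1 measurable_completion) simp

lemma norm_matrix_vector_mult_le:
  fixes A :: "real^'n^'m"
  shows "norm (A *v v) \<le> norm A * norm v"
proof (rule power2_le_imp_le)
  have "(norm (A *v v))\<^sup>2 = (\<Sum>i\<in>UNIV. (A $ i \<bullet> v)\<^sup>2)"
    by (simp add: norm_vec_def L2_set_def sum_nonneg matrix_vector_mul_component)
  also have "\<dots> \<le> (\<Sum>i\<in>UNIV. (norm (A $ i))\<^sup>2 * (norm v)\<^sup>2)"
    using Cauchy_Schwarz_ineq by (intro sum_mono) (auto simp: dot_square_norm)
  also have "\<dots> = (norm A)\<^sup>2 * (norm v)\<^sup>2"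
    by (simp add: norm_vec_def[of A] L2_set_def sum_nonneg flip: sum_distrib_right)
  finally show "(norm (A *v v))\<^sup>2 \<le> (norm A * norm v)\<^sup>2" by (simp add: power_mult_distrib)
qed auto

lemma trace_eq_inner: "trace A = A \<bullet> mat 1" for A :: "real^2^2"
  by (simp add: trace_def inner_vec_def mat_def sum_2)

lemma norm_mat_1: "norm (mat 1 :: real^2^2) = sqrt 2"
  by (simp add: norm_eq_sqrt_inner inner_vec_def mat_def sum_2)

lemma trace_square_le: "(trace A)\<^sup>2 \<le> 2 * (norm A)\<^sup>2" for A :: "real^2^2"
proof -
  have "(A \<bullet> mat 1)\<^sup>2 \<le> (A \<bullet> A) * (mat 1 \<bullet> (mat 1 :: real^2^2))" by (rule Cauchy_Schwarz_ineq)
  also have "(mat 1 \<bullet> (mat 1 :: real^2^2)) = 2" by (simp add: inner_vec_def mat_def sum_2)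
  finally show ?thesis by (simp add: trace_eq_inner dot_square_norm)
qed

lemma abs_trace_le: "\<bar>trace A\<bar> \<le> sqrt 2 * norm A" for A :: "real^2^2"
  using real_sqrt_le_mono[OF trace_square_le[of A]] by (simp add: real_sqrt_mult)

lemma L2_trace:
  fixes e :: tensor_field
  assumes "e \<in> L2 \<Omega>"
  shows "(\<lambda>x. trace (e x)) \<in> L2 \<Omega>"
  using L2_measurable[OF assms]
  by (intro L2_dominated[OF _ assms, of _ "sqrt 2"]) (simp_all add: abs_trace_le, simp add: trace_eq_inner)

lemma L2_norm_trace:
  fixes e :: tensor_field
  assumes "e \<in> L2 \<Omega>"
  shows "L2_norm \<Omega> (\<lambda>x. trace (e x)) \<le> sqrt 2 * L2_norm \<Omega> e"
  using assms by (intro L2_norm_le_of_ae L2_trace) (auto simp: abs_trace_le)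

lemma trace_add': "trace (A + B) = trace A + trace B" for A B :: "real^2^2"
  by (simp add: trace_eq_inner inner_add_left)

lemma trace_scaleR': "trace (c *\<^sub>R A) = c * trace A" for A :: "real^2^2"
  by (simp add: trace_eq_inner)

lemma elast_add: "elast lam mu (A + B) = elast lam mu A + elast lam mu B"
  by (simp add: elast_def trace_add' algebra_simps)

lemma elast_scaleR: "elast lam mu (c *\<^sub>R A) = c *\<^sub>R elast lam mu A"
  by (simp add: elast_def trace_scaleR' algebra_simps)

lemma elast_inner: "elast lam mu A \<bullet> B = lam * trace A * trace B + 2 * mu * (A \<bullet> B)"
  by (simp add: elast_def inner_add_left trace_eq_inner inner_commute[of "mat 1" B])

lemma norm_elast_le:
  assumes "0 \<le> lam" "0 \<le> mu"
  shows "norm (elast lam mu A) \<le> (2 * mu + 2 * lam) * norm A"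
proof -
  have "norm (elast lam mu A) \<le> lam * \<bar>trace A\<bar> * sqrt 2 + 2 * mu * norm A"
    unfolding elast_def using assms by (intro norm_triangle_le) (simp add: norm_mat_1 abs_mult)
  also have "lam * \<bar>trace A\<bar> * sqrt 2 \<le> lam * (sqrt 2 * norm A) * sqrt 2"
    using assms abs_trace_le by (intro mult_right_mono mult_left_mono) auto
  finally show ?thesis by (simp add: algebra_simps)
qed

lemma L2_elast:
  fixes e :: tensor_field
  assumes "e \<in> L2 \<Omega>"
  shows "(\<lambda>x. elast lam mu (e x)) \<in> L2 \<Omega>"
proof -
  have m: "(\<lambda>x. trace (e x)) \<in> borel_measurable (lebesgue_on \<Omega>)"
    using L2_measurable[OF L2_trace[OF assms]] .
  have "(\<lambda>x. trace (e x) *\<^sub>R (mat 1 :: real^2^2)) \<in> L2 \<Omega>"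
    using m by (intro L2_dominated[OF _ L2_trace[OF assms], of _ "sqrt 2"]) (auto simp: norm_mat_1)
  from L2_add[OF L2_scaleR[OF this, of lam] L2_scaleR[OF assms, of "2 * mu"]] show ?thesis
    by (simp add: elast_def plus_fun_def scaleR_fun_def)
qed

text \<open>The infimum that defines the essential supremum is attained, because countably many null sets form
  a null set.\<close>

lemma Linf_norm_AE:
  assumes "f \<in> Linf \<Omega>"
  shows "AE x in lebesgue_on \<Omega>. norm (f x) \<le> Linf_norm \<Omega> f"
proof -
  let ?S = "{C. 0 \<le> C \<and> (AE x in lebesgue_on \<Omega>. norm (f x) \<le> C)}"
  obtain C where C: "AE x in lebesgue_on \<Omega>. norm (f x) \<le> C" using assms by (auto simp: Linf_def)
  then have "AE x in lebesgue_on \<Omega>. norm (f x) \<le> max C 0" by eventually_elim auto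
  then have ne: "?S \<noteq> {}" by (auto intro!: exI[of _ "max C 0"])
  have "AE x in lebesgue_on \<Omega>. norm (f x) \<le> Linf_norm \<Omega> f + 1 / real (Suc n)" for n
  proof -
    have "Inf ?S < Inf ?S + 1 / real (Suc n)" by simp
    then obtain C' where C': "C' \<in> ?S" "C' < Inf ?S + 1 / real (Suc n)"
      using cInf_lessD[OF ne] by blast
    then show ?thesis by (auto simp: Linf_norm_def elim!: eventually_mono)
  qed
  then have "AE x in lebesgue_on \<Omega>. \<forall>n. norm (f x) \<le> Linf_norm \<Omega> f + 1 / real (Suc n)"
    by (simp add: AE_all_countable)
  then show ?thesis
  proof eventually_elim
    case (elim x)
    have "(\<lambda>n. Linf_norm \<Omega> f + 1 / real (Suc n)) \<longlonglongrightarrow> Linf_norm \<Omega> f + 0"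
      by (intro tendsto_intros LIMSEQ_Suc[OF lim_1_over_n])
    then show ?case using elim by (intro LIMSEQ_le_const[where a = "norm (f x)"]) auto
  qed
qed

lemma Linf_diff:
  assumes "f \<in> Linf \<Omega>" "g \<in> Linf \<Omega>"
  shows "(\<lambda>x. f x - g x) \<in> Linf \<Omega>"
proof -
  obtain C D where "AE x in lebesgue_on \<Omega>. norm (f x) \<le> C" "AE x in lebesgue_on \<Omega>. norm (g x) \<le> D"
    using assms by (auto simp: Linf_def)
  then have "AE x in lebesgue_on \<Omega>. norm (f x - g x) \<le> C + D"
    by eventually_elim (metis add_mono norm_triangle_le_diff)
  then show ?thesis using assms by (auto simp: Linf_def)
qed

lemma measurable_matrix_vector_mult:
  fixes A :: tensor_field and v :: vector_field
  assumes "A \<in> borel_measurable M" "v \<in> borel_measurable M"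
  shows "(\<lambda>x. A x *v v x) \<in> borel_measurable M"
proof -
  have "continuous_on UNIV (\<lambda>p::(real^2^2) \<times> (real^2). fst p *v snd p)"
    by (simp add: matrix_vector_mult_def) (intro continuous_intros)
  then show ?thesis
    using borel_measurable_continuous_on[OF _ borel_measurable_Pair[OF assms], of "\<lambda>p. fst p *v snd p"] by simp
qed

lemma L2_Linf_mult:
  fixes A :: tensor_field and v :: vector_field
  assumes "A \<in> Linf \<Omega>" "v \<in> L2 \<Omega>"
  shows "(\<lambda>x. A x *v v x) \<in> L2 \<Omega>"
proof -
  obtain C where C: "AE x in lebesgue_on \<Omega>. norm (A x) \<le> C" using assms(1) by (auto simp: Linf_def)
  have "AE x in lebesgue_on \<Omega>. norm (A x *v v x) \<le> C * norm (v x)"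
    using C by eventually_elim (meson mult_right_mono norm_ge_zero norm_matrix_vector_mult_le order_trans)
  then show ?thesis
    using assms measurable_matrix_vector_mult
    by (intro L2_dominated[OF _ assms(2)]) (auto simp: Linf_def L2_def)
qed

lemma Linf_mult_inner_bound:
  fixes A :: tensor_field and u v :: vector_field
  assumes "A \<in> Linf \<Omega>" "u \<in> L2 \<Omega>" "v \<in> L2 \<Omega>" "Linf_norm \<Omega> A \<le> K" "0 \<le> K"
  shows "\<bar>LINT x|lebesgue_on \<Omega>. (A x *v u x) \<bullet> v x\<bar> \<le> K * L2_norm \<Omega> u * L2_norm \<Omega> v"
proof -
  have Au: "(\<lambda>x. A x *v u x) \<in> L2 \<Omega>" using L2_Linf_mult assms by auto
  have "AE x in lebesgue_on \<Omega>. norm (A x *v u x) \<le> K * norm (u x)"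
    using Linf_norm_AE[OF assms(1)]
  proof eventually_elim
    case (elim x)
    then show ?case using norm_matrix_vector_mult_le[of "A x" "u x"] assms(4)
      by (smt (verit) mult_right_mono norm_ge_zero)
  qed
  then have "L2_norm \<Omega> (\<lambda>x. A x *v u x) \<le> K * L2_norm \<Omega> u"
    using L2_norm_le_of_ae[OF Au assms(2,5)] by auto
  then show ?thesis
    using L2.cauchy_schwarz[OF Au assms(3)] mult_right_mono[of "L2_norm \<Omega> (\<lambda>x. A x *v u x)" "K * L2_norm \<Omega> u" "L2_norm \<Omega> v"]
    by (simp add: L2_ip_def)
qed

section \<open>Smooth bumps and the fundamental lemma\<close>

text \<open>Smoothness as membership in some class that is closed under differentiation.  Such classes are
  easily exhibited, and no iterated derivative has to be named.\<close>

definition smooth1 :: "(real \<Rightarrow> real) \<Rightarrow> bool" where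
  "smooth1 u \<longleftrightarrow> (\<exists>C. u \<in> C \<and> (\<forall>f\<in>C. \<exists>f'\<in>C. \<forall>x. (f has_real_derivative f' x) (at x)))"

lemma smooth1_deriv:
  assumes "smooth1 u"
  obtains u' where "smooth1 u'" "\<And>x. (u has_real_derivative u' x) (at x)"
proof -
  obtain C where C: "u \<in> C" "\<forall>f\<in>C. \<exists>f'\<in>C. \<forall>x. (f has_real_derivative f' x) (at x)"
    using assms by (auto simp: smooth1_def)
  then obtain u' where u': "u' \<in> C" "\<forall>x. (u has_real_derivative u' x) (at x)" by blast
  then have "smooth1 u'" using C(2) by (auto simp: smooth1_def)
  then show ?thesis using that u' by blast
qed

text \<open>The sums of products of smooth functions: the class that is closed under differentiation by the
  Leibniz rule.\<close>

inductive_set prod_span :: "(real \<Rightarrow> real) set" where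
  mult: "smooth1 f \<Longrightarrow> smooth1 g \<Longrightarrow> (\<lambda>x. f x * g x) \<in> prod_span"
| add: "f \<in> prod_span \<Longrightarrow> g \<in> prod_span \<Longrightarrow> (\<lambda>x. f x + g x) \<in> prod_span"

lemma smooth1_mult:
  assumes "smooth1 f" "smooth1 g"
  shows "smooth1 (\<lambda>x. f x * g x)"
proof -
  have "\<exists>h'\<in>prod_span. \<forall>x. (h has_real_derivative h' x) (at x)" if "h \<in> prod_span" for h
    using that
  proof induction
    case (mult f g)
    obtain f' where f': "smooth1 f'" "\<And>x. (f has_real_derivative f' x) (at x)"
      using smooth1_deriv[OF mult(1)] by blast
    obtain g' where g': "smooth1 g'" "\<And>x. (g has_real_derivative g' x) (at x)"
      using smooth1_deriv[OF mult(2)] by blast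
    have "((\<lambda>x. f x * g x) has_real_derivative f' x * g x + f x * g' x) (at x)" for x
      using DERIV_mult'[OF f'(2) g'(2), of x] by (simp add: add.commute)
    moreover have "(\<lambda>x. f' x * g x + f x * g' x) \<in> prod_span"
      using mult f'(1) g'(1) by (intro prod_span.intros)
    ultimately show ?case by (intro bexI[of _ "\<lambda>x. f' x * g x + f x * g' x"]) auto
  next
    case (add f g)
    then obtain f' g' where "f' \<in> prod_span" "g' \<in> prod_span"
        "\<forall>x. (f has_real_derivative f' x) (at x)" "\<forall>x. (g has_real_derivative g' x) (at x)"
      by blast
    then show ?case
      by (intro bexI[of _ "\<lambda>x. f' x + g' x"]) (auto intro: prod_span.add DERIV_add)
  qed
  then show ?thesis
    using prod_span.mult[OF assms] unfolding smooth1_def by blast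
qed

lemma smooth1_affine:
  assumes "smooth1 u"
  shows "smooth1 (\<lambda>x. u (a * x + b))"
proof -
  obtain C where C: "u \<in> C" "\<forall>f\<in>C. \<exists>f'\<in>C. \<forall>x. (f has_real_derivative f' x) (at x)"
    using assms by (auto simp: smooth1_def)
  define D where "D = {\<lambda>x. c * f (a * x + b) |c f. f \<in> C}"
  have "(\<lambda>x. u (a * x + b)) \<in> D"
    using C(1) by (auto simp: D_def intro!: exI[of _ 1] exI[of _ u])
  moreover have "\<exists>h'\<in>D. \<forall>x. (h has_real_derivative h' x) (at x)" if "h \<in> D" for h
  proof -
    obtain c f where h: "h = (\<lambda>x. c * f (a * x + b))" "f \<in> C" using \<open>h \<in> D\<close> by (auto simp: D_def)
    then obtain f' where f': "f' \<in> C" "\<And>x. (f has_real_derivative f' x) (at x)" using C(2) by blast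
    have "(h has_real_derivative (c * a) * f' (a * x + b)) (at x)" for x
    proof -
      have "((\<lambda>x. f (a * x + b)) has_real_derivative f' (a * x + b) * a) (at x)"
        by (rule DERIV_chain2[OF f'(2)]) (auto intro!: derivative_eq_intros)
      from DERIV_cmult[OF this, of c] show ?thesis by (simp add: h(1) mult_ac)
    qed
    moreover have "(\<lambda>x. (c * a) * f' (a * x + b)) \<in> D" using f'(1) by (auto simp: D_def)
    ultimately show ?thesis by (intro bexI[of _ "\<lambda>x. (c * a) * f' (a * x + b)"]) auto
  qed
  ultimately show ?thesis unfolding smooth1_def by blast
qed

text \<open>The functions \<open>p(1/t) exp(-\<epsilon>/t)\<close>, extended by zero to \<open>t \<le> 0\<close>; differentiation acts on the
  polynomial \<open>p\<close> only.\<close>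

definition flat_exp :: "real \<Rightarrow> real poly \<Rightarrow> real \<Rightarrow> real" where
  "flat_exp \<epsilon> p t = (if t > 0 then poly p (1 / t) * exp (- (\<epsilon> / t)) else 0)"

lemma poly_times_exp_tendsto_0:
  fixes p :: "real poly"
  assumes "\<epsilon> > 0"
  shows "((\<lambda>s. poly p s * exp (- (\<epsilon> * s))) \<longlongrightarrow> 0) at_top"
proof -
  have mono: "((\<lambda>s. s ^ k * exp (- (\<epsilon> * s))) \<longlongrightarrow> 0) at_top" for k
  proof -
    have "((\<lambda>s. (1 / \<epsilon> ^ k) * ((\<epsilon> * s) ^ k / exp (\<epsilon> * s))) \<longlongrightarrow> (1 / \<epsilon> ^ k) * 0) at_top"
      using assms
      by (intro tendsto_mult tendsto_const
          filterlim_compose[OF tendsto_power_div_exp_0 filterlim_tendsto_pos_mult_at_top[OF tendsto_const _ filterlim_ident]])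
    then show ?thesis
      using assms by (simp add: exp_minus field_simps)
  qed
  have "((\<lambda>s. \<Sum>i\<le>degree p. coeff p i * (s ^ i * exp (- (\<epsilon> * s)))) \<longlongrightarrow> (\<Sum>i\<le>degree p. coeff p i * 0)) at_top"
    by (intro tendsto_sum tendsto_mult tendsto_const mono)
  then show ?thesis by (simp add: poly_altdef sum_distrib_right mult.assoc)
qed

lemma flat_exp_deriv:
  assumes "\<epsilon> > 0"
  shows "(flat_exp \<epsilon> p has_real_derivative flat_exp \<epsilon> (monom 1 2 * (smult \<epsilon> p - pderiv p)) t) (at t)"
proof -
  consider "t > 0" | "t < 0" | "t = 0" by linarith
  then show ?thesis
  proof cases
    case 1
    have "((\<lambda>t. poly p (1 / t) * exp (- (\<epsilon> / t))) has_real_derivative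
        flat_exp \<epsilon> (monom 1 2 * (smult \<epsilon> p - pderiv p)) t) (at t)"
      using 1
      by (auto intro!: derivative_eq_intros DERIV_chain2[OF poly_DERIV]
          simp: flat_exp_def poly_monom power2_eq_square field_simps)
    moreover have "\<forall>\<^sub>F s in nhds t. flat_exp \<epsilon> p s = poly p (1 / s) * exp (- (\<epsilon> / s))"
      using eventually_nhds_in_open[of "{0<..}" t] 1
      by (auto simp: flat_exp_def elim!: eventually_mono)
    ultimately show ?thesis by (simp add: DERIV_cong_ev)
  next
    case 2
    have "\<forall>\<^sub>F s in nhds t. flat_exp \<epsilon> p s = 0"
      using eventually_nhds_in_open[of "{..<0}" t] 2
      by (auto simp: flat_exp_def elim!: eventually_mono)
    then have "(flat_exp \<epsilon> p has_real_derivative 0) (at t)"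
      by (subst DERIV_cong_ev[where g = "\<lambda>_. 0" and v = 0]) auto
    then show ?thesis using 2 by (simp add: flat_exp_def)
  next
    case 3
    have "((\<lambda>h. flat_exp \<epsilon> p h / h) \<longlongrightarrow> 0) (at 0)"
    proof (rule filterlim_split_at)
      have "((\<lambda>h. 0::real) \<longlongrightarrow> 0) (at_left 0)" by simp
      then show "((\<lambda>h. flat_exp \<epsilon> p h / h) \<longlongrightarrow> 0) (at_left 0)"
        by (rule tendsto_cong[THEN iffD1, rotated])
          (auto simp: flat_exp_def eventually_at_filter)
      have "((\<lambda>s. poly (monom 1 1 * p) s * exp (- (\<epsilon> * s))) \<longlongrightarrow> 0) at_top"
        by (rule poly_times_exp_tendsto_0[OF assms])
      then have "((\<lambda>h. poly (monom 1 1 * p) (inverse h) * exp (- (\<epsilon> * inverse h))) \<longlongrightarrow> 0) (at_right 0)"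
        by (rule filterlim_compose[OF _ filterlim_inverse_at_top_right])
      then show "((\<lambda>h. flat_exp \<epsilon> p h / h) \<longlongrightarrow> 0) (at_right 0)"
        by (rule tendsto_cong[THEN iffD1, rotated])
          (auto simp: flat_exp_def eventually_at_filter poly_monom field_simps)
    qed
    then show ?thesis using 3 by (simp add: DERIV_def flat_exp_def)
  qed
qed

lemma smooth1_flat_exp: "\<epsilon> > 0 \<Longrightarrow> smooth1 (flat_exp \<epsilon> p)"
  unfolding smooth1_def using flat_exp_deriv by (intro exI[of _ "range (flat_exp \<epsilon>)"]) blast

text \<open>For \<open>a < t < b\<close> this is \<open>exp(-\<epsilon>/(t-a) - \<epsilon>/(b-t))\<close>, which increases to \<open>1\<close> as \<open>\<epsilon>\<close> decreases to
  \<open>0\<close>.  The bumps thus approximate the indicator of the interval without any convolution.\<close>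

definition bump1 :: "real \<Rightarrow> real \<Rightarrow> real \<Rightarrow> real \<Rightarrow> real" where
  "bump1 \<epsilon> a b t = flat_exp \<epsilon> 1 (t - a) * flat_exp \<epsilon> 1 (b - t)"

lemma smooth1_bump1: "\<epsilon> > 0 \<Longrightarrow> smooth1 (bump1 \<epsilon> a b)"
  unfolding bump1_def
  using smooth1_mult[OF smooth1_affine[OF smooth1_flat_exp, of \<epsilon> 1 1 "-a"]
      smooth1_affine[OF smooth1_flat_exp, of \<epsilon> 1 "-1" b]]
  by simp

lemma bump1_nonzero: "bump1 \<epsilon> a b t \<noteq> 0 \<longleftrightarrow> a < t \<and> t < b"
  by (auto simp: bump1_def flat_exp_def)

lemma bump1_bounds: "\<epsilon> \<ge> 0 \<Longrightarrow> 0 \<le> bump1 \<epsilon> a b t \<and> bump1 \<epsilon> a b t \<le> 1"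
  by (auto simp: bump1_def flat_exp_def intro!: mult_le_one)

lemma bump1_tendsto: "(\<lambda>n. bump1 (1 / real (Suc n)) a b t) \<longlonglongrightarrow> indicator {a<..<b} t"
proof (cases "a < t \<and> t < b")
  case True
  have "(\<lambda>n. exp (- (1 / real (Suc n) / c))) \<longlonglongrightarrow> exp (- (0 / c))" if "c > 0" for c :: real
    using that by (intro tendsto_intros LIMSEQ_Suc[OF lim_1_over_n]) auto
  from tendsto_mult[OF this[of "t - a"] this[of "b - t"]] show ?thesis
    using True by (simp add: bump1_def flat_exp_def)
next
  case False
  then have "bump1 \<epsilon> a b t = 0" for \<epsilon> using bump1_nonzero by blast
  then show ?thesis using False by auto
qed

lemma partial_deriv_eq:
  "(\<phi> has_derivative D) (at x) \<Longrightarrow> partial_deriv i \<phi> x = D (axis i 1)"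
  by (simp add: partial_deriv_def flip: frechet_derivative_at)

lemma tensor_has_derivative:
  assumes "\<And>t. (u has_real_derivative u' t) (at t)" "\<And>t. (v has_real_derivative v' t) (at t)"
  shows "((\<lambda>x::real^2. u (x $ 1) * v (x $ 2)) has_derivative
    (\<lambda>h. u' (x $ 1) * h $ 1 * v (x $ 2) + u (x $ 1) * (v' (x $ 2) * h $ 2))) (at x)"
proof -
  have p: "((\<lambda>x::real^2. x $ i) has_derivative (\<lambda>h. h $ i)) (at x)" for i :: 2
    by (intro bounded_linear_imp_has_derivative bounded_linear_vec_nth)
  have "((\<lambda>x::real^2. u (x $ 1)) has_derivative (\<lambda>h. u' (x $ 1) * h $ 1)) (at x)"
    using has_derivative_compose[OF p assms(1)[unfolded has_field_derivative_def]] by simp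
  moreover have "((\<lambda>x::real^2. v (x $ 2)) has_derivative (\<lambda>h. v' (x $ 2) * h $ 2)) (at x)"
    using has_derivative_compose[OF p assms(2)[unfolded has_field_derivative_def]] by simp
  ultimately show ?thesis
    by (auto intro!: derivative_eq_intros simp: add.commute)
qed

text \<open>A partial derivative of a product \<open>u(x\<^sub>1) v(x\<^sub>2)\<close> is again such a product.\<close>

lemma smooth_tensor:
  assumes "smooth1 u" "smooth1 v"
  shows "smooth (\<lambda>x. u (x $ 1) * v (x $ 2))"
proof -
  have "\<exists>u v. smooth1 u \<and> smooth1 v \<and> fold partial_deriv js \<phi> = (\<lambda>x. u (x $ 1) * v (x $ 2))"
    if "\<exists>u v. smooth1 u \<and> smooth1 v \<and> \<phi> = (\<lambda>x. u (x $ 1) * v (x $ 2))" for js \<phi>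
    using that
  proof (induction js arbitrary: \<phi>)
    case (Cons j js)
    then obtain u v where uv: "smooth1 u" "smooth1 v" "\<phi> = (\<lambda>x. u (x $ 1) * v (x $ 2))" by blast
    obtain u' where u': "smooth1 u'" "\<And>x. (u has_real_derivative u' x) (at x)"
      using smooth1_deriv[OF uv(1)] by blast
    obtain v' where v': "smooth1 v'" "\<And>x. (v has_real_derivative v' x) (at x)"
      using smooth1_deriv[OF uv(2)] by blast
    have D: "partial_deriv j \<phi> x = u' (x $ 1) * axis j 1 $ 1 * v (x $ 2) + u (x $ 1) * (v' (x $ 2) * axis j 1 $ 2)" for x
      unfolding uv(3) by (rule partial_deriv_eq[OF tensor_has_derivative[OF u'(2) v'(2)]])
    have "j = 1 \<or> j = 2" by (rule exhaust_2)
    then have "partial_deriv j \<phi> = (\<lambda>x. u' (x $ 1) * v (x $ 2)) \<or> partial_deriv j \<phi> = (\<lambda>x. u (x $ 1) * v' (x $ 2))"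
      using D by (auto simp: fun_eq_iff axis_def)
    then have "\<exists>u v. smooth1 u \<and> smooth1 v \<and> partial_deriv j \<phi> = (\<lambda>x. u (x $ 1) * v (x $ 2))"
      using uv u'(1) v'(1) by blast
    then show ?case using Cons.IH by simp
  qed auto
  then have fold: "\<exists>u v. smooth1 u \<and> smooth1 v \<and>
      fold partial_deriv js (\<lambda>x. u0 (x $ 1) * v0 (x $ 2)) = (\<lambda>x. u (x $ 1) * v (x $ 2))"
    if "smooth1 u0" "smooth1 v0" for js u0 v0
    using that by blast
  show ?thesis
    unfolding smooth_def
  proof (intro allI)
    fix js x
    obtain a b where ab: "smooth1 a" "smooth1 b"
        "fold partial_deriv js (\<lambda>x. u (x $ 1) * v (x $ 2)) = (\<lambda>x. a (x $ 1) * b (x $ 2))"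
      using fold[OF assms] by blast
    obtain a' where a': "\<And>x. (a has_real_derivative a' x) (at x)" using smooth1_deriv[OF ab(1)] by blast
    obtain b' where b': "\<And>x. (b has_real_derivative b' x) (at x)" using smooth1_deriv[OF ab(2)] by blast
    show "fold partial_deriv js (\<lambda>x. u (x $ 1) * v (x $ 2)) differentiable at x"
      unfolding ab(3) using tensor_has_derivative[OF a' b'] by (auto simp: differentiable_def)
  qed
qed

definition bump2 :: "real \<Rightarrow> real^2 \<Rightarrow> real^2 \<Rightarrow> scalar_field" where
  "bump2 \<epsilon> a b x = bump1 \<epsilon> (a $ 1) (b $ 1) (x $ 1) * bump1 \<epsilon> (a $ 2) (b $ 2) (x $ 2)"

lemma mem_box_2: "x \<in> box a b \<longleftrightarrow> a $ 1 < x $ 1 \<and> x $ 1 < b $ 1 \<and> a $ 2 < x $ 2 \<and> x $ 2 < b $ 2"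
  for x :: "real^2"
  by (auto simp: mem_box_cart forall_2)

lemma bump2_test_function:
  assumes "\<epsilon> > 0" "cbox a b \<subseteq> S"
  shows "bump2 \<epsilon> a b \<in> test_functions S"
proof -
  have "{x. bump2 \<epsilon> a b x \<noteq> 0} \<subseteq> cbox a b"
    using box_subset_cbox[of a b] bump1_nonzero by (auto simp: bump2_def mem_box_2 subset_iff)
  then have *: "closure {x. bump2 \<epsilon> a b x \<noteq> 0} \<subseteq> cbox a b"
    by (intro closure_minimal) auto
  have "smooth (bump2 \<epsilon> a b)"
    unfolding bump2_def using assms by (intro smooth_tensor smooth1_bump1)
  moreover have "compact (closure {x. bump2 \<epsilon> a b x \<noteq> 0})"
    using * by (metis bounded_cbox bounded_subset closed_closure compact_eq_bounded_closed)
  ultimately show ?thesis using * assms(2) by (auto simp: test_functions_def)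
qed

lemma bump2_tendsto: "(\<lambda>n. bump2 (1 / real (Suc n)) a b x) \<longlonglongrightarrow> indicator (box a b) x"
proof -
  have "indicator (box a b) x = indicator {a $ 1<..<b $ 1} (x $ 1) * (indicator {a $ 2<..<b $ 2} (x $ 2) :: real)"
    by (auto simp: mem_box_2 indicator_def)
  then show ?thesis unfolding bump2_def by (simp only:) (intro tendsto_mult bump1_tendsto)
qed

lemma test_function_continuous:
  assumes "\<phi> \<in> test_functions S"
  shows "continuous_on A \<phi>"
proof -
  have "\<phi> differentiable (at x)" for x
    using assms spec[of "\<lambda>js. \<forall>x. fold partial_deriv js \<phi> differentiable (at x)" "[]"]
    by (auto simp: test_functions_def smooth_def)
  then show ?thesis
    by (metis continuous_at_imp_continuous_on differentiable_imp_continuous_within)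
qed

text \<open>The products of one-dimensional bumps converge boundedly to the indicator of the box.\<close>

lemma fundamental_lemma_box:
  fixes G :: scalar_field
  assumes \<Omega>: "\<Omega> \<in> sets lebesgue" and G: "integrable (lebesgue_on \<Omega>) G"
    and z: "\<And>\<phi>. \<phi> \<in> test_functions \<Omega> \<Longrightarrow> (LINT x|lebesgue_on \<Omega>. G x * \<phi> x) = 0"
    and ab: "cbox a b \<subseteq> \<Omega>"
  shows "(LINT x|lebesgue_on \<Omega>. G x * indicator (box a b) x) = 0"
proof -
  have "(\<lambda>n. LINT x|lebesgue_on \<Omega>. G x * bump2 (1 / real (Suc n)) a b x)
      \<longlonglongrightarrow> (LINT x|lebesgue_on \<Omega>. G x * indicator (box a b) x)"
  proof (rule integral_dominated_convergence[where w = "\<lambda>x. \<bar>G x\<bar>"])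
    have [measurable]: "G \<in> borel_measurable (lebesgue_on \<Omega>)" using G by auto
    have [measurable]: "bump2 (1 / real (Suc n)) a b \<in> borel_measurable (lebesgue_on \<Omega>)" for n
      by (intro borel_measurable_continuous_lebesgue_on
          test_function_continuous[OF bump2_test_function[OF _ ab]]) auto
    have [measurable]: "(indicator (box a b) :: _ \<Rightarrow> real) \<in> borel_measurable (lebesgue_on \<Omega>)"
      by (intro borel_measurable_lebesgue_on) auto
    show "(\<lambda>x. G x * indicator (box a b) x) \<in> borel_measurable (lebesgue_on \<Omega>)" by measurable
    show "(\<lambda>x. G x * bump2 (1 / real (Suc n)) a b x) \<in> borel_measurable (lebesgue_on \<Omega>)" for n
      by measurable
    show "AE x in lebesgue_on \<Omega>. (\<lambda>n. G x * bump2 (1 / real (Suc n)) a b x) \<longlonglongrightarrow> G x * indicator (box a b) x"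
      by (intro AE_I2 tendsto_mult tendsto_const bump2_tendsto)
    have "0 \<le> bump2 (1 / real (Suc n)) a b x \<and> bump2 (1 / real (Suc n)) a b x \<le> 1" for n x
      using bump1_bounds[of "1 / real (Suc n)"] by (auto simp: bump2_def intro!: mult_le_one)
    then show "AE x in lebesgue_on \<Omega>. norm (G x * bump2 (1 / real (Suc n)) a b x) \<le> \<bar>G x\<bar>" for n
      by (intro AE_I2) (simp add: abs_mult mult_left_le)
    show "integrable (lebesgue_on \<Omega>) (\<lambda>x. \<bar>G x\<bar>)" using G by auto
  qed
  moreover have "(LINT x|lebesgue_on \<Omega>. G x * bump2 (1 / real (Suc n)) a b x) = 0" for n
    by (intro z bump2_test_function[OF _ ab]) auto
  ultimately show ?thesis by (simp add: LIMSEQ_const_iff)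
qed

text \<open>Almost every point is the limit of the averages over small cubes with that point as lower corner.
  For points of the open set these cubes eventually lie inside it, and there the averages vanish.\<close>

lemma fundamental_lemma:
  fixes G :: scalar_field
  assumes \<Omega>: "open \<Omega>" and G: "integrable (lebesgue_on \<Omega>) G"
    and z: "\<And>\<phi>. \<phi> \<in> test_functions \<Omega> \<Longrightarrow> (LINT x|lebesgue_on \<Omega>. G x * \<phi> x) = 0"
  shows "ae_eq \<Omega> G 0"
proof -
  have \<Omega>_sets: "\<Omega> \<in> sets lebesgue" using \<Omega> by auto
  define f where "f x = indicator \<Omega> x *\<^sub>R G x" for x
  have f_int: "integrable lebesgue f"
    unfolding f_def using G \<Omega>_sets by (subst (asm) integrable_restrict_space) auto
  have ii: "f integrable_on cbox a b" for a b
    using integrable_on_lebesgue[OF f_int] by (meson integrable_on_subcbox subset_UNIV)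
  obtain N where N: "negligible N" "\<And>x e. x \<notin> N \<Longrightarrow> 0 < e \<Longrightarrow> \<exists>d>0. \<forall>h. 0 < h \<and> h < d \<longrightarrow>
      norm (integral (cbox x (x + h *\<^sub>R One)) f /\<^sub>R h ^ DIM(real^2) - f x) < e"
    using integrable_ccontinuous_explicit[OF ii] by blast
  have zero: "integral (cbox a b) f = 0" if ab: "cbox a b \<subseteq> \<Omega>" for a b
  proof -
    have "integral (cbox a b) f = integral (box a b) f"
      using integral_open_interval[of a b f] by simp
    also have "\<dots> = (LINT x|lebesgue_on (box a b). f x)"
    proof (rule lebesgue_integral_eq_integral[symmetric])
      have "integrable lebesgue (\<lambda>x. indicator (box a b) x *\<^sub>R f x)"
        by (intro integrable_mult_indicator f_int) auto
      then show "integrable (lebesgue_on (box a b)) f"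
        by (subst integrable_restrict_space) auto
    qed auto
    also have "\<dots> = (LINT x|lebesgue. indicator (box a b) x *\<^sub>R f x)"
      by (subst integral_restrict_space) auto
    also have "\<dots> = (LINT x|lebesgue. indicator \<Omega> x *\<^sub>R (G x * indicator (box a b) x))"
      by (intro Bochner_Integration.integral_cong) (auto simp: f_def)
    also have "\<dots> = (LINT x|lebesgue_on \<Omega>. G x * indicator (box a b) x)"
      using \<Omega>_sets by (subst integral_restrict_space) auto
    also have "\<dots> = 0" by (rule fundamental_lemma_box[OF \<Omega>_sets G z ab])
    finally show ?thesis .
  qed
  have "G x = 0" if x: "x \<in> \<Omega>" "x \<notin> N" for x
  proof (rule ccontr)
    assume ne: "G x \<noteq> 0"
    have fx: "f x = G x" using x by (simp add: f_def)
    obtain d where d: "d > 0" "\<And>h. 0 < h \<Longrightarrow> h < d \<Longrightarrow>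
        norm (integral (cbox x (x + h *\<^sub>R One)) f /\<^sub>R h ^ DIM(real^2) - f x) < norm (G x)"
      using N(2)[OF x(2), of "norm (G x)"] ne by auto
    obtain e where e: "e > 0" "ball x e \<subseteq> \<Omega>" using \<Omega> x(1) by (meson open_contains_ball)
    \<comment> \<open>A cube of side \<open>h\<close> has diameter at most \<open>2 h\<close> in the plane.\<close>
    define h where "h = min (d / 2) (e / 4)"
    have h: "0 < h" "h < d" "h \<le> e / 4" using d(1) e(1) by (auto simp: h_def)
    have "cbox x (x + h *\<^sub>R One) \<subseteq> ball x e"
    proof
      fix y assume y: "y \<in> cbox x (x + h *\<^sub>R One)"
      have "\<bar>(y - x) $ i\<bar> \<le> h" for i
      proof -
        have "(One::real^2) $ i = 1"
          using inner_sum_Basis[of "axis i 1 :: real^2"] by (simp add: inner_axis)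
        moreover have "x $ i \<le> y $ i" "y $ i \<le> (x + h *\<^sub>R One) $ i" using y by (auto simp: mem_box_cart)
        ultimately show ?thesis by (simp only: vector_add_component vector_scaleR_component vector_minus_component) simp
      qed
      then have "norm (y - x) \<le> (\<Sum>i\<in>(UNIV::2 set). h)"
        using norm_le_l1_cart[of "y - x"] by (meson order_trans sum_mono)
      also have "\<dots> < e" using h by (simp add: sum_2)
      finally show "y \<in> ball x e" by (simp add: dist_norm norm_minus_commute)
    qed
    then show False using d(2)[OF h(1,2)] zero e(2) fx by auto
  qed
  then have sub: "{x \<in> \<Omega>. G x \<noteq> 0} \<subseteq> N" by auto
  have "N \<in> null_sets lebesgue" using N(1) negligible_iff_null_sets by blast
  then have "AE x in lebesgue. x \<in> \<Omega> \<longrightarrow> G x = 0"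
    using sub by (intro AE_I'[of N]) auto
  then show ?thesis using \<Omega>_sets by (simp add: ae_eq_def AE_restrict_space_iff)
qed

section \<open>Weak derivatives\<close>

lemma semi_inner_add:
  assumes "semi_inner V ip" "semi_inner V ip'"
  shows "semi_inner V (\<lambda>x y. ip x y + ip' x y)"
proof -
  interpret A: semi_inner V ip by fact
  interpret B: semi_inner V ip' by fact
  show ?thesis
  proof
    show "subspace V" by (rule A.sub)
    show "ip x y + ip' x y = ip y x + ip' y x" if "x \<in> V" "y \<in> V" for x y
      using that A.sym B.sym by simp
    show "lin_on V (\<lambda>x. ip x y + ip' x y)" if "y \<in> V" for y
      using that by (intro lin_onI) (simp_all add: A.add_left B.add_left A.scale_left B.scale_left algebra_simps)
    show "0 \<le> ip x x + ip' x x" if "x \<in> V" for x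
      using that A.nonneg B.nonneg by (simp add: add_nonneg_nonneg)
  qed
qed

text \<open>An \<open>L\<^sup>2\<close>-valued map that is linear up to null sets.  The operators \<open>weak_grad\<close> and \<open>weak_div\<close> select
  representatives and are linear only in this sense; integrals against the values are truly linear.\<close>

definition ae_lin :: "(real^2) set \<Rightarrow> 'v::real_vector set \<Rightarrow> ('v \<Rightarrow> real^2 \<Rightarrow> 'a::euclidean_space) \<Rightarrow> bool" where
  "ae_lin \<Omega> V A \<longleftrightarrow> (\<forall>x\<in>V. A x \<in> L2 \<Omega>) \<and>
     (\<forall>x\<in>V. \<forall>y\<in>V. ae_eq \<Omega> (A (x + y)) (A x + A y)) \<and>
     (\<forall>c. \<forall>x\<in>V. ae_eq \<Omega> (A (c *\<^sub>R x)) (c *\<^sub>R A x))"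

lemma ae_linI:
  assumes "\<And>x. x \<in> V \<Longrightarrow> A x \<in> L2 \<Omega>"
    "\<And>x y. x \<in> V \<Longrightarrow> y \<in> V \<Longrightarrow> ae_eq \<Omega> (A (x + y)) (A x + A y)"
    "\<And>c x. x \<in> V \<Longrightarrow> ae_eq \<Omega> (A (c *\<^sub>R x)) (c *\<^sub>R A x)"
  shows "ae_lin \<Omega> V A"
  using assms by (auto simp: ae_lin_def)

lemma ae_linD:
  assumes "ae_lin \<Omega> V A"
  shows "x \<in> V \<Longrightarrow> A x \<in> L2 \<Omega>"
    "x \<in> V \<Longrightarrow> y \<in> V \<Longrightarrow> ae_eq \<Omega> (A (x + y)) (A x + A y)"
    "x \<in> V \<Longrightarrow> ae_eq \<Omega> (A (c *\<^sub>R x)) (c *\<^sub>R A x)"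
  using assms by (auto simp: ae_lin_def)

lemma ae_lin_zero: "ae_lin \<Omega> V A \<Longrightarrow> subspace V \<Longrightarrow> ae_eq \<Omega> (A 0) 0"
  using ae_linD(3)[of \<Omega> V A 0 0] by (simp add: subspace_0)

lemma ae_lin_id: "ae_lin \<Omega> (L2 \<Omega>) (\<lambda>f. f)"
  by (rule ae_linI) auto

lemma ae_lin_compose:
  assumes "ae_lin \<Omega> V A" "\<And>u. u \<in> U \<Longrightarrow> f u \<in> V"
    "\<And>u v. f (u + v) = f u + f v" "\<And>c u. f (c *\<^sub>R u) = c *\<^sub>R f u"
  shows "ae_lin \<Omega> U (\<lambda>u. A (f u))"
  using assms by (auto simp: ae_lin_def)

lemma ae_lin_pointwise:
  assumes A: "ae_lin \<Omega> V A" and L: "\<And>v. v \<in> V \<Longrightarrow> (\<lambda>x. T x (A v x)) \<in> L2 \<Omega>"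
    and T: "\<And>x. linear (T x)"
  shows "ae_lin \<Omega> V (\<lambda>v x. T x (A v x))"
proof (rule ae_linI)
  show "ae_eq \<Omega> (\<lambda>x. T x (A (v + w) x)) ((\<lambda>x. T x (A v x)) + (\<lambda>x. T x (A w x)))"
    if "v \<in> V" "w \<in> V" for v w
    using ae_linD(2)[OF A that] linear_add[OF T] unfolding ae_eq_def
    by (elim eventually_mono) simp
  show "ae_eq \<Omega> (\<lambda>x. T x (A (c *\<^sub>R v) x)) (c *\<^sub>R (\<lambda>x. T x (A v x)))" if "v \<in> V" for c v
    using ae_linD(3)[OF A that, of c] linear_scale[OF T] unfolding ae_eq_def
    by (elim eventually_mono) simp
qed (rule L)

lemma L2_ip_ae_cong:
  assumes "f \<in> L2 \<Omega>" "f' \<in> L2 \<Omega>" "g \<in> L2 \<Omega>" "ae_eq \<Omega> f f'"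
  shows "L2_ip \<Omega> f g = L2_ip \<Omega> f' g"
proof -
  have "f - f' \<in> L2.null \<Omega>"
    using assms L2_norm_eq_0_iff[of "f - f'" \<Omega>] subspace_diff[OF subspace_L2 assms(1,2)]
    by (auto simp: L2.null_iff ae_eq_diff_0_iff)
  then show ?thesis
    using L2.null_left[of "f - f'" \<Omega> g] L2.diff_left[OF assms(1,2,3)] assms(3) by simp
qed

lemma lin_on_L2_ip:
  assumes "ae_lin \<Omega> V A" "subspace V" "g \<in> L2 \<Omega>"
  shows "lin_on V (\<lambda>x. L2_ip \<Omega> (A x) g)" "lin_on V (\<lambda>x. L2_ip \<Omega> g (A x))"
proof -
  show 1: "lin_on V (\<lambda>x. L2_ip \<Omega> (A x) g)"
  proof (rule lin_onI)
    show "L2_ip \<Omega> (A (x + y)) g = L2_ip \<Omega> (A x) g + L2_ip \<Omega> (A y) g" if "x \<in> V" "y \<in> V" for x y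
      using L2_ip_ae_cong[OF _ _ assms(3) ae_linD(2)[OF assms(1) that]] that
        ae_linD(1)[OF assms(1)] assms
      by (simp add: L2_add L2.add_left subspace_add)
    show "L2_ip \<Omega> (A (c *\<^sub>R x)) g = c * L2_ip \<Omega> (A x) g" if "x \<in> V" for c x
      using L2_ip_ae_cong[OF _ _ assms(3) ae_linD(3)[OF assms(1) that]] that
        ae_linD(1)[OF assms(1)] assms
      by (simp add: L2_scaleR L2.scale_left subspace_scale)
  qed
  have "L2_ip \<Omega> g (A x) = L2_ip \<Omega> (A x) g" for x by (simp add: L2_ip_def inner_commute)
  then show "lin_on V (\<lambda>x. L2_ip \<Omega> g (A x))" using 1 by simp
qed

lemma semi_inner_ae_lin:
  assumes "ae_lin \<Omega> V A" "subspace V"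
  shows "semi_inner V (\<lambda>x y. L2_ip \<Omega> (A x) (A y))"
proof
  show "lin_on V (\<lambda>x. L2_ip \<Omega> (A x) (A y))" if "y \<in> V" for y
    using lin_on_L2_ip(1)[OF assms ae_linD(1)[OF assms(1) that]] .
qed (use assms in \<open>auto simp: L2_ip_def inner_commute\<close>)

lemma L2_ip_square: "L2_ip \<Omega> f f = (L2_norm \<Omega> f)\<^sup>2"
  by (simp add: L2_ip_def L2_norm_square dot_square_norm)

lemma test_function_smooth: "\<phi> \<in> test_functions S \<Longrightarrow> smooth \<phi>"
  by (simp add: test_functions_def)

lemma test_functions_mono: "S \<subseteq> S' \<Longrightarrow> test_functions S \<subseteq> test_functions S'"
  by (auto simp: test_functions_def)

lemma test_function_has_derivative:
  assumes "\<phi> \<in> test_functions S"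
  shows "(\<phi> has_derivative (\<lambda>h. (\<chi> i. partial_deriv i \<phi> x) \<bullet> h)) (at x)"
proof -
  have "\<phi> differentiable (at x)"
    using test_function_smooth[OF assms] spec[of "\<lambda>js. \<forall>x. fold partial_deriv js \<phi> differentiable (at x)" "[]"]
    by (auto simp: smooth_def)
  then have D: "(\<phi> has_derivative frechet_derivative \<phi> (at x)) (at x)"
    by (simp add: frechet_derivative_works)
  then have lin: "linear (frechet_derivative \<phi> (at x))" by (rule has_derivative_linear)
  have "frechet_derivative \<phi> (at x) h = (\<chi> i. partial_deriv i \<phi> x) \<bullet> h" for h
  proof -
    have "h = (\<Sum>i\<in>UNIV. h $ i *\<^sub>R axis i 1)"
      by (metis (no_types, lifting) basis_expansion scalar_mult_eq_scaleR sum.cong)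
    then have "frechet_derivative \<phi> (at x) h = (\<Sum>i\<in>UNIV. h $ i * frechet_derivative \<phi> (at x) (axis i 1))"
      using lin linear_sum[OF lin, of "\<lambda>i. h $ i *\<^sub>R axis i 1" UNIV] by (simp add: linear_scale)
    then show ?thesis by (simp add: partial_deriv_def inner_vec_def mult.commute)
  qed
  then have "frechet_derivative \<phi> (at x) = (\<lambda>h. (\<chi> i. partial_deriv i \<phi> x) \<bullet> h)" by blast
  then show ?thesis using D by metis
qed

lemma partial_deriv_test_continuous:
  assumes "\<phi> \<in> test_functions S"
  shows "continuous_on A (partial_deriv i \<phi>)"
proof -
  have "partial_deriv i \<phi> differentiable (at x)" for x
    using test_function_smooth[OF assms] spec[of "\<lambda>js. \<forall>x. fold partial_deriv js \<phi> differentiable (at x)" "[i]"]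
    by (auto simp: smooth_def)
  then show ?thesis
    by (metis continuous_at_imp_continuous_on differentiable_imp_continuous_within)
qed

lemma test_function_outside:
  assumes "\<phi> \<in> test_functions S" "x \<notin> closure {x. \<phi> x \<noteq> 0}"
  shows "\<phi> x = 0" "partial_deriv i \<phi> x = 0"
proof -
  show "\<phi> x = 0" using assms(2) closure_subset[of "{x. \<phi> x \<noteq> 0}"] by blast
  have op: "open (- closure {x. \<phi> x \<noteq> 0})" by auto
  have z: "0 = \<phi> y" if "y \<in> - closure {x. \<phi> x \<noteq> 0}" for y
    using that closure_subset[of "{x. \<phi> x \<noteq> 0}"] by force
  have "(\<phi> has_derivative (\<lambda>_. 0)) (at x)"
    by (rule has_derivative_transform_within_open[OF has_derivative_const op _ z]) (use assms(2) in simp)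
  then show "partial_deriv i \<phi> x = 0" by (rule partial_deriv_eq)
qed

lemma test_function_support:
  assumes "\<phi> \<in> test_functions S"
  shows "\<exists>C. compact C \<and> C \<subseteq> S \<and> (\<forall>x. x \<notin> C \<longrightarrow> \<phi> x = 0) \<and>
    (\<forall>x i. x \<notin> C \<longrightarrow> partial_deriv i \<phi> x = 0)"
proof (intro exI conjI allI impI)
  show "compact (closure {x. \<phi> x \<noteq> 0})" "closure {x. \<phi> x \<noteq> 0} \<subseteq> S"
    using assms by (simp_all add: test_functions_def)
qed (erule test_function_outside[OF assms])+

lemma compact_support_bounded:
  fixes f :: scalar_field
  assumes "continuous_on UNIV f" "compact C" "\<And>x. x \<notin> C \<Longrightarrow> f x = 0"
  obtains B where "B > 0" "\<And>x. \<bar>f x\<bar> \<le> B"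
proof -
  have "bounded (f ` C)"
    using assms(1,2) by (intro compact_imp_bounded compact_continuous_image) (auto intro: continuous_on_subset)
  then obtain B where "B > 0" "\<And>x. x \<in> C \<Longrightarrow> \<bar>f x\<bar> \<le> B" by (auto simp: bounded_pos)
  then have "\<bar>f x\<bar> \<le> B" for x using assms(3)[of x] by (cases "x \<in> C") auto
  then show ?thesis using that \<open>B > 0\<close> by blast
qed

lemma L2_compact_support:
  fixes f :: scalar_field
  assumes "bounded \<Omega>" "\<Omega> \<in> sets lebesgue" "continuous_on UNIV f" "compact C" "\<And>x. x \<notin> C \<Longrightarrow> f x = 0"
  shows "f \<in> L2 \<Omega>"
proof -
  obtain B where "B > 0" "\<And>x. \<bar>f x\<bar> \<le> B" using compact_support_bounded[OF assms(3-5)] by blast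
  then show ?thesis
    using assms by (intro L2_bounded[where C = B] borel_measurable_continuous_lebesgue_on) auto
qed

lemma LINT_eq_of_support:
  fixes f g :: scalar_field
  assumes "S \<in> sets lebesgue" "T \<in> sets lebesgue"
    "\<And>x. x \<in> S \<inter> T \<Longrightarrow> f x = g x" "\<And>x. x \<in> S - T \<Longrightarrow> f x = 0" "\<And>x. x \<in> T - S \<Longrightarrow> g x = 0"
  shows "(LINT x|lebesgue_on S. f x) = (LINT x|lebesgue_on T. g x)"
proof -
  have "(\<lambda>x. indicator S x *\<^sub>R f x) = (\<lambda>x. indicator T x *\<^sub>R g x)"
    using assms(3-5) by (fastforce simp: indicator_def)
  then show ?thesis using assms(1,2) by (simp add: integral_restrict_space)
qed

lemma LINT_test_subset:
  assumes "S \<subseteq> T" "S \<in> sets lebesgue" "T \<in> sets lebesgue" "\<phi> \<in> test_functions S"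
  shows "(LINT x|lebesgue_on S. q x * \<phi> x) = (LINT x|lebesgue_on T. q x * \<phi> x)"
    "(LINT x|lebesgue_on S. q x * partial_deriv i \<phi> x) = (LINT x|lebesgue_on T. q x * partial_deriv i \<phi> x)"
    "(LINT x|lebesgue_on S. v x \<bullet> (\<chi> j. partial_deriv j \<phi> x)) = (LINT x|lebesgue_on T. v x \<bullet> (\<chi> j. partial_deriv j \<phi> x))"
proof -
  obtain C where "C \<subseteq> S" "\<And>x. x \<notin> C \<Longrightarrow> \<phi> x = 0" "\<And>x i. x \<notin> C \<Longrightarrow> partial_deriv i \<phi> x = 0"
    using test_function_support[OF assms(4)] by blast
  then have z: "\<And>x. x \<in> T - S \<Longrightarrow> \<phi> x = 0 \<and> (\<forall>i. partial_deriv i \<phi> x = 0)" by blast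
  show "(LINT x|lebesgue_on S. q x * \<phi> x) = (LINT x|lebesgue_on T. q x * \<phi> x)"
    "(LINT x|lebesgue_on S. q x * partial_deriv i \<phi> x) = (LINT x|lebesgue_on T. q x * partial_deriv i \<phi> x)"
    "(LINT x|lebesgue_on S. v x \<bullet> (\<chi> j. partial_deriv j \<phi> x)) = (LINT x|lebesgue_on T. v x \<bullet> (\<chi> j. partial_deriv j \<phi> x))"
    by (rule LINT_eq_of_support; use assms z in \<open>force simp: inner_vec_def\<close>)+
qed

text \<open>Openness yields uniqueness of weak derivatives; boundedness makes test functions and their
  derivatives square-integrable.\<close>

locale plane_domain =
  fixes \<Omega> :: "(real^2) set"
  assumes open_domain: "open \<Omega>" and bounded_domain: "bounded \<Omega>"
begin

lemma domain_sets: "\<Omega> \<in> sets lebesgue"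
  using open_domain by auto

lemma L2_test:
  assumes "\<phi> \<in> test_functions S"
  shows "\<phi> \<in> L2 \<Omega>"
proof -
  obtain C where "compact C" and z: "\<And>x. x \<notin> C \<Longrightarrow> \<phi> x = 0"
      "\<And>x i. x \<notin> C \<Longrightarrow> partial_deriv i \<phi> x = 0"
    using test_function_support[OF assms] by blast
  from \<open>compact C\<close> z(1) show ?thesis
    by (rule L2_compact_support[OF bounded_domain domain_sets test_function_continuous[OF assms]])
qed

lemma L2_test_deriv:
  assumes "\<phi> \<in> test_functions S"
  shows "partial_deriv i \<phi> \<in> L2 \<Omega>"
proof -
  obtain C where "compact C" and z: "\<And>x. x \<notin> C \<Longrightarrow> \<phi> x = 0"
      "\<And>x i. x \<notin> C \<Longrightarrow> partial_deriv i \<phi> x = 0"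
    using test_function_support[OF assms] by blast
  from \<open>compact C\<close> z(2) show ?thesis
    by (rule L2_compact_support[OF bounded_domain domain_sets partial_deriv_test_continuous[OF assms]])
qed

lemma L2_test_grad: "\<phi> \<in> test_functions S \<Longrightarrow> (\<lambda>x. \<chi> i. partial_deriv i \<phi> x) \<in> L2 \<Omega>"
  by (intro L2_vec_lambda L2_test_deriv)

lemma ae_eq_of_weak:
  fixes G G' :: vector_field
  assumes "G \<in> L2 \<Omega>" "G' \<in> L2 \<Omega>"
    and eq: "\<And>\<phi> i. \<phi> \<in> test_functions \<Omega> \<Longrightarrow>
      (LINT x|lebesgue_on \<Omega>. G x $ i * \<phi> x) = (LINT x|lebesgue_on \<Omega>. G' x $ i * \<phi> x)"
  shows "ae_eq \<Omega> G G'"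
proof -
  have "ae_eq \<Omega> (\<lambda>x. G x $ i - G' x $ i) 0" for i
  proof (rule fundamental_lemma[OF open_domain])
    have L: "(\<lambda>x. G x $ i) \<in> L2 \<Omega>" "(\<lambda>x. G' x $ i) \<in> L2 \<Omega>" using assms(1,2) by (auto intro: L2_comp)
    then show "integrable (lebesgue_on \<Omega>) (\<lambda>x. G x $ i - G' x $ i)"
      using L2_integrable[OF bounded_domain domain_sets] by auto
    show "(LINT x|lebesgue_on \<Omega>. (G x $ i - G' x $ i) * \<phi> x) = 0" if "\<phi> \<in> test_functions \<Omega>" for \<phi>
      using eq[OF that, of i] L2_mult_integrable[OF L(1) L2_test[OF that]]
        L2_mult_integrable[OF L(2) L2_test[OF that]]
      by (simp add: left_diff_distrib)
  qed
  then have "AE x in lebesgue_on \<Omega>. \<forall>i\<in>UNIV. G x $ i = G' x $ i"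
    by (intro AE_finite_allI) (auto simp: ae_eq_def)
  then show ?thesis by (simp add: ae_eq_def vec_eq_iff)
qed

lemma has_weak_grad_unique:
  assumes "G \<in> L2 \<Omega>" "G' \<in> L2 \<Omega>" "has_weak_grad \<Omega> q G" "has_weak_grad \<Omega> q' G'" "ae_eq \<Omega> q q'"
    "q \<in> L2 \<Omega>" "q' \<in> L2 \<Omega>"
  shows "ae_eq \<Omega> G G'"
proof (rule ae_eq_of_weak[OF assms(1,2)])
  fix \<phi> i assume \<phi>: "\<phi> \<in> test_functions \<Omega>"
  have "L2_ip \<Omega> q (partial_deriv i \<phi>) = L2_ip \<Omega> q' (partial_deriv i \<phi>)"
    by (rule L2_ip_ae_cong[OF assms(6,7) L2_test_deriv[OF \<phi>] assms(5)])
  then show "(LINT x|lebesgue_on \<Omega>. G x $ i * \<phi> x) = (LINT x|lebesgue_on \<Omega>. G' x $ i * \<phi> x)"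
    using assms(3,4) \<phi> by (simp add: has_weak_grad_def L2_ip_def)
qed

lemma H1_L2: "q \<in> H1 \<Omega> \<Longrightarrow> q \<in> L2 \<Omega>"
  by (simp add: H1_def)

lemma weak_grad:
  assumes "q \<in> H1 \<Omega>"
  shows "weak_grad \<Omega> q \<in> L2 \<Omega>" "has_weak_grad \<Omega> q (weak_grad \<Omega> q)"
proof -
  have "\<exists>G. G \<in> L2 \<Omega> \<and> has_weak_grad \<Omega> q G" using assms by (auto simp: H1_def)
  from someI_ex[OF this] show "weak_grad \<Omega> q \<in> L2 \<Omega>" "has_weak_grad \<Omega> q (weak_grad \<Omega> q)"
    by (auto simp: weak_grad_def)
qed

lemma H1I: "q \<in> L2 \<Omega> \<Longrightarrow> G \<in> L2 \<Omega> \<Longrightarrow> has_weak_grad \<Omega> q G \<Longrightarrow> q \<in> H1 \<Omega>"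
  by (auto simp: H1_def)

lemma weak_grad_eqI:
  assumes "q \<in> L2 \<Omega>" "G \<in> L2 \<Omega>" "has_weak_grad \<Omega> q G"
  shows "ae_eq \<Omega> (weak_grad \<Omega> q) G"
  using weak_grad[OF H1I[OF assms]] assms by (intro has_weak_grad_unique[of _ _ q q]) auto

lemma weak_grad_ae_cong:
  "p \<in> H1 \<Omega> \<Longrightarrow> q \<in> H1 \<Omega> \<Longrightarrow> ae_eq \<Omega> p q \<Longrightarrow> ae_eq \<Omega> (weak_grad \<Omega> p) (weak_grad \<Omega> q)"
  by (intro has_weak_grad_unique[of _ _ p q] weak_grad H1_L2)

lemma has_weak_grad_add:
  assumes "p \<in> L2 \<Omega>" "q \<in> L2 \<Omega>" "G \<in> L2 \<Omega>" "G' \<in> L2 \<Omega>" "has_weak_grad \<Omega> p G" "has_weak_grad \<Omega> q G'"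
  shows "has_weak_grad \<Omega> (p + q) (G + G')"
  unfolding has_weak_grad_def
proof (intro ballI allI)
  fix \<phi> i assume \<phi>: "\<phi> \<in> test_functions \<Omega>"
  note [simp] = L2_mult_integrable[OF assms(1) L2_test_deriv[OF \<phi>]] L2_mult_integrable[OF assms(2) L2_test_deriv[OF \<phi>]]
    L2_mult_integrable[OF L2_comp[OF assms(3)] L2_test[OF \<phi>]] L2_mult_integrable[OF L2_comp[OF assms(4)] L2_test[OF \<phi>]]
  show "(LINT x|lebesgue_on \<Omega>. (p + q) x * partial_deriv i \<phi> x) = - (LINT x|lebesgue_on \<Omega>. (G + G') x $ i * \<phi> x)"
    using assms(5)[unfolded has_weak_grad_def, rule_format, OF \<phi>, of i]
      assms(6)[unfolded has_weak_grad_def, rule_format, OF \<phi>, of i]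
    by (simp add: distrib_right)
qed

lemma has_weak_grad_scaleR:
  assumes "has_weak_grad \<Omega> p G"
  shows "has_weak_grad \<Omega> (c *\<^sub>R p) (c *\<^sub>R G)"
  using assms by (simp add: has_weak_grad_def mult.assoc)

lemma H1_zero: "0 \<in> H1 \<Omega>"
  by (rule H1I[of _ 0]) (auto simp: has_weak_grad_def subspace_0[OF subspace_L2])

lemma subspace_H1: "subspace (H1 \<Omega>)"
proof (rule subspaceI)
  fix p q assume p: "p \<in> H1 \<Omega>" and q: "q \<in> H1 \<Omega>"
  show "p + q \<in> H1 \<Omega>"
    using H1I[OF L2_add[OF H1_L2[OF p] H1_L2[OF q]] L2_add[OF weak_grad(1)[OF p] weak_grad(1)[OF q]]
        has_weak_grad_add[OF H1_L2[OF p] H1_L2[OF q] weak_grad(1)[OF p] weak_grad(1)[OF q]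
          weak_grad(2)[OF p] weak_grad(2)[OF q]]] .
next
  fix c p assume p: "p \<in> H1 \<Omega>"
  show "c *\<^sub>R p \<in> H1 \<Omega>"
    using H1I[OF L2_scaleR[OF H1_L2[OF p]] L2_scaleR[OF weak_grad(1)[OF p]]
        has_weak_grad_scaleR[OF weak_grad(2)[OF p]]] .
qed (rule H1_zero)

lemma ae_lin_weak_grad: "ae_lin \<Omega> (H1 \<Omega>) (weak_grad \<Omega>)"
proof (rule ae_linI)
  fix p q assume p: "p \<in> H1 \<Omega>" and q: "q \<in> H1 \<Omega>"
  show "ae_eq \<Omega> (weak_grad \<Omega> (p + q)) (weak_grad \<Omega> p + weak_grad \<Omega> q)"
    using weak_grad_eqI[OF L2_add[OF H1_L2[OF p] H1_L2[OF q]] L2_add[OF weak_grad(1)[OF p] weak_grad(1)[OF q]]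
        has_weak_grad_add[OF H1_L2[OF p] H1_L2[OF q] weak_grad(1)[OF p] weak_grad(1)[OF q]
          weak_grad(2)[OF p] weak_grad(2)[OF q]]] .
next
  fix c p assume p: "p \<in> H1 \<Omega>"
  show "ae_eq \<Omega> (weak_grad \<Omega> (c *\<^sub>R p)) (c *\<^sub>R weak_grad \<Omega> p)"
    using weak_grad_eqI[OF L2_scaleR[OF H1_L2[OF p]] L2_scaleR[OF weak_grad(1)[OF p]]
        has_weak_grad_scaleR[OF weak_grad(2)[OF p]]] .
qed (rule weak_grad(1))

definition H1_ip :: "scalar_field \<Rightarrow> scalar_field \<Rightarrow> real" where
  "H1_ip p q = L2_ip \<Omega> p q + L2_ip \<Omega> (weak_grad \<Omega> p) (weak_grad \<Omega> q)"

lemma ae_lin_incl: "V \<subseteq> L2 \<Omega> \<Longrightarrow> ae_lin \<Omega> V (\<lambda>f. f)"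
  by (rule ae_linI) auto

lemma semi_inner_H1: "semi_inner (H1 \<Omega>) H1_ip"
  unfolding H1_ip_def[abs_def]
  by (intro semi_inner_add semi_inner_ae_lin[OF ae_lin_weak_grad subspace_H1]
      semi_inner_ae_lin[OF ae_lin_incl subspace_H1]) (auto simp: H1_L2)

lemma sn_H1_ip: "semi_inner.sn H1_ip = H1_norm \<Omega>"
  by (simp add: fun_eq_iff semi_inner.sn_def[OF semi_inner_H1] H1_norm_def H1_ip_def L2_ip_square)

sublocale H1: semi_inner "H1 \<Omega>" H1_ip
  rewrites "semi_inner.sn H1_ip = H1_norm \<Omega>"
  by (rule semi_inner_H1, rule sn_H1_ip)

lemma H1_norm_nonneg [simp]: "0 \<le> H1_norm \<Omega> q"
  by (simp add: H1_norm_def)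

lemma L2_norm_le_H1_norm: "L2_norm \<Omega> q \<le> H1_norm \<Omega> q" "L2_norm \<Omega> (weak_grad \<Omega> q) \<le> H1_norm \<Omega> q"
  by (auto simp: H1_norm_def intro!: real_le_rsqrt)

text \<open>\<open>H(div)\<close> without the symmetry constraint.\<close>

definition div_domain :: "tensor_field set" where
  "div_domain = {\<tau> \<in> L2 \<Omega>. \<exists>D\<in>L2 \<Omega>. has_weak_div \<Omega> \<tau> D}"

lemma div_domain_L2: "\<tau> \<in> div_domain \<Longrightarrow> \<tau> \<in> L2 \<Omega>"
  by (simp add: div_domain_def)

lemma weak_div:
  assumes "\<tau> \<in> div_domain"
  shows "weak_div \<Omega> \<tau> \<in> L2 \<Omega>" "has_weak_div \<Omega> \<tau> (weak_div \<Omega> \<tau>)"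
proof -
  have "\<exists>D. D \<in> L2 \<Omega> \<and> has_weak_div \<Omega> \<tau> D" using assms unfolding div_domain_def by blast
  from someI_ex[OF this, folded weak_div_def]
  show "weak_div \<Omega> \<tau> \<in> L2 \<Omega>" "has_weak_div \<Omega> \<tau> (weak_div \<Omega> \<tau>)" by blast+
qed

lemma div_domainI: "\<tau> \<in> L2 \<Omega> \<Longrightarrow> D \<in> L2 \<Omega> \<Longrightarrow> has_weak_div \<Omega> \<tau> D \<Longrightarrow> \<tau> \<in> div_domain"
  by (auto simp: div_domain_def)

lemma weak_div_eqI:
  assumes "\<tau> \<in> L2 \<Omega>" "D \<in> L2 \<Omega>" "has_weak_div \<Omega> \<tau> D"
  shows "ae_eq \<Omega> (weak_div \<Omega> \<tau>) D"
  using weak_div[OF div_domainI[OF assms]] assms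
  by (intro ae_eq_of_weak) (auto simp: has_weak_div_def)

lemma has_weak_div_add:
  assumes "\<tau> \<in> L2 \<Omega>" "\<tau>' \<in> L2 \<Omega>" "D \<in> L2 \<Omega>" "D' \<in> L2 \<Omega>" "has_weak_div \<Omega> \<tau> D" "has_weak_div \<Omega> \<tau>' D'"
  shows "has_weak_div \<Omega> (\<tau> + \<tau>') (D + D')"
  unfolding has_weak_div_def
proof (intro ballI allI)
  fix \<phi> i assume \<phi>: "\<phi> \<in> test_functions \<Omega>"
  let ?g = "\<lambda>x. \<chi> j. partial_deriv j \<phi> x"
  have "(LINT x|lebesgue_on \<Omega>. (\<tau> + \<tau>') x $ i \<bullet> ?g x) =
      (LINT x|lebesgue_on \<Omega>. \<tau> x $ i \<bullet> ?g x + \<tau>' x $ i \<bullet> ?g x)"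
    by (simp only: plus_fun_apply vector_add_component inner_add_left)
  also have "\<dots> = (LINT x|lebesgue_on \<Omega>. \<tau> x $ i \<bullet> ?g x) + (LINT x|lebesgue_on \<Omega>. \<tau>' x $ i \<bullet> ?g x)"
    by (rule Bochner_Integration.integral_add[OF
        L2_inner_integrable[OF L2_comp[OF assms(1)] L2_test_grad[OF \<phi>]]
        L2_inner_integrable[OF L2_comp[OF assms(2)] L2_test_grad[OF \<phi>]]])
  also have "\<dots> = - ((LINT x|lebesgue_on \<Omega>. D x $ i * \<phi> x) + (LINT x|lebesgue_on \<Omega>. D' x $ i * \<phi> x))"
    using assms(5)[unfolded has_weak_div_def, rule_format, OF \<phi>, of i]
      assms(6)[unfolded has_weak_div_def, rule_format, OF \<phi>, of i] by linarith
  also have "(LINT x|lebesgue_on \<Omega>. D x $ i * \<phi> x) + (LINT x|lebesgue_on \<Omega>. D' x $ i * \<phi> x) =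
      (LINT x|lebesgue_on \<Omega>. D x $ i * \<phi> x + D' x $ i * \<phi> x)"
    by (rule Bochner_Integration.integral_add[symmetric, OF
        L2_mult_integrable[OF L2_comp[OF assms(3)] L2_test[OF \<phi>]]
        L2_mult_integrable[OF L2_comp[OF assms(4)] L2_test[OF \<phi>]]])
  also have "\<dots> = (LINT x|lebesgue_on \<Omega>. (D + D') x $ i * \<phi> x)"
    by (simp only: plus_fun_apply vector_add_component distrib_right)
  finally show "(LINT x|lebesgue_on \<Omega>. (\<tau> + \<tau>') x $ i \<bullet> ?g x) =
      - (LINT x|lebesgue_on \<Omega>. (D + D') x $ i * \<phi> x)" .
qed

lemma has_weak_div_scaleR:
  assumes "has_weak_div \<Omega> \<tau> D"
  shows "has_weak_div \<Omega> (c *\<^sub>R \<tau>) (c *\<^sub>R D)"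
  using assms by (simp add: has_weak_div_def mult.assoc)

lemma has_weak_div_zero: "has_weak_div S 0 0"
  by (simp add: has_weak_div_def)

lemma subspace_div_domain: "subspace div_domain"
proof (rule subspaceI)
  fix p q assume p: "p \<in> div_domain" and q: "q \<in> div_domain"
  show "p + q \<in> div_domain"
    using div_domainI[OF L2_add[OF div_domain_L2[OF p] div_domain_L2[OF q]] L2_add[OF weak_div(1)[OF p] weak_div(1)[OF q]]
        has_weak_div_add[OF div_domain_L2[OF p] div_domain_L2[OF q] weak_div(1)[OF p] weak_div(1)[OF q]
          weak_div(2)[OF p] weak_div(2)[OF q]]] .
next
  fix c p assume p: "p \<in> div_domain"
  show "c *\<^sub>R p \<in> div_domain"
    using div_domainI[OF L2_scaleR[OF div_domain_L2[OF p]] L2_scaleR[OF weak_div(1)[OF p]]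
        has_weak_div_scaleR[OF weak_div(2)[OF p]]] .
next
  show "0 \<in> div_domain"
    using div_domainI[OF subspace_0[OF subspace_L2] subspace_0[OF subspace_L2] has_weak_div_zero] .
qed

lemma ae_lin_weak_div: "ae_lin \<Omega> div_domain (weak_div \<Omega>)"
proof (rule ae_linI)
  fix p q assume p: "p \<in> div_domain" and q: "q \<in> div_domain"
  show "ae_eq \<Omega> (weak_div \<Omega> (p + q)) (weak_div \<Omega> p + weak_div \<Omega> q)"
    using weak_div_eqI[OF L2_add[OF div_domain_L2[OF p] div_domain_L2[OF q]] L2_add[OF weak_div(1)[OF p] weak_div(1)[OF q]]
        has_weak_div_add[OF div_domain_L2[OF p] div_domain_L2[OF q] weak_div(1)[OF p] weak_div(1)[OF q]
          weak_div(2)[OF p] weak_div(2)[OF q]]] .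
next
  fix c p assume p: "p \<in> div_domain"
  show "ae_eq \<Omega> (weak_div \<Omega> (c *\<^sub>R p)) (c *\<^sub>R weak_div \<Omega> p)"
    using weak_div_eqI[OF L2_scaleR[OF div_domain_L2[OF p]] L2_scaleR[OF weak_div(1)[OF p]]
        has_weak_div_scaleR[OF weak_div(2)[OF p]]] .
qed (rule weak_div(1))

end

section \<open>Integration by parts for piecewise smooth functions\<close>

lemma lborel_integral_shift:
  fixes F :: "'a::euclidean_space \<Rightarrow> real"
  assumes "F \<in> borel_measurable borel"
  shows "integrable lborel (\<lambda>x. F (x + c)) \<longleftrightarrow> integrable lborel F"
    "(LINT x|lborel. F (x + c)) = (LINT x|lborel. F x)"
proof -
  have eq: "lborel = distr lborel borel ((+) c)" by (rule lborel_distr_plus[symmetric])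
  show "(LINT x|lborel. F (x + c)) = (LINT x|lborel. F x)"
    using assms by (subst (2) eq) (simp add: integral_distr add.commute)
  show "integrable lborel (\<lambda>x. F (x + c)) \<longleftrightarrow> integrable lborel F"
    using assms by (subst (2) eq) (simp add: integrable_distr_eq add.commute)
qed

text \<open>Translation invariance makes the integrals of all difference quotients vanish; they are dominated
  by the Lipschitz constant on a bounded set and converge almost everywhere to \<open>F'\<close>.  In contrast to
  Fubini and the fundamental theorem of calculus, nothing has to be known on individual lines.\<close>

lemma integral_directional_derivative:
  fixes F F' :: scalar_field
  assumes cont: "continuous_on UNIV F"
    and supp: "bounded S" "\<And>x. x \<notin> S \<Longrightarrow> F x = 0"
    and lip: "\<And>x h. \<bar>F (x + h *\<^sub>R e) - F x\<bar> \<le> L * \<bar>h\<bar>"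
    and deriv: "AE x in lebesgue. ((\<lambda>h. F (x + h *\<^sub>R e)) has_real_derivative F' x) (at 0)"
    and meas: "F' \<in> borel_measurable lebesgue"
  shows "(LINT x|lebesgue. F' x) = 0"
proof -
  define \<delta> where "\<delta> n = 1 / real (Suc n)" for n
  have \<delta>: "0 < \<delta> n" "\<delta> n \<le> 1" for n by (auto simp: \<delta>_def)
  \<comment> \<open>The difference quotients with increment \<open>\<delta> n \<le> 1\<close> vanish off a common disc \<open>B\<close>.\<close>
  define D where "D n x = (F (x + \<delta> n *\<^sub>R e) - F x) / \<delta> n" for n x
  have Fm: "F \<in> borel_measurable borel" using cont by (rule borel_measurable_continuous_onI)
  obtain R where R: "R > 0" "S \<subseteq> ball 0 R" using bounded_subset_ballD[OF supp(1), of 0] by auto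
  define B where "B = cball (0::real^2) (R + norm e)"
  have D_out: "D n x = 0" if "x \<notin> B" for n x
  proof -
    have nx: "norm x > R + norm e" using that by (simp add: B_def)
    have "norm (\<delta> n *\<^sub>R e) \<le> norm e" using \<delta>[of n] by (simp add: mult_left_le_one_le)
    then have "norm (x + \<delta> n *\<^sub>R e) > R" using nx norm_diff_ineq[of x "\<delta> n *\<^sub>R e"] by linarith
    moreover have "norm x > R" using nx norm_ge_zero[of e] by linarith
    ultimately have "x + \<delta> n *\<^sub>R e \<notin> S" "x \<notin> S" using R(2) by (auto simp: subset_iff)
    then show ?thesis by (simp add: D_def supp(2))
  qed
  have D_le: "\<bar>D n x\<bar> \<le> L * indicator B x" for n x
    using lip[of x "\<delta> n"] \<delta>[of n] D_out[of x n]
    by (cases "x \<in> B") (auto simp: D_def divide_le_eq)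
  have Dm: "D n \<in> borel_measurable borel" for n
    unfolding D_def using cont
    by (intro borel_measurable_continuous_onI continuous_intros continuous_on_compose2[OF cont]) (use \<delta>(1)[of n] in auto)
  have F_int: "integrable lborel F"
  proof -
    have "integrable lborel (\<lambda>x. indicator (cball 0 R) x *\<^sub>R F x)"
      using continuous_on_subset[OF cont] borel_integrable_compact[of "cball 0 R" F] by auto
    moreover have "(\<lambda>x. indicator (cball 0 R) x *\<^sub>R F x) = F"
    proof
      fix x
      have "x \<notin> S" if "x \<notin> cball 0 R" using R(2) that by auto
      then show "indicator (cball 0 R) x *\<^sub>R F x = F x"
        using supp(2)[of x] by (cases "x \<in> cball 0 R") auto
    qed
    ultimately show ?thesis by simp
  qed
  have D_int: "(LINT x|lebesgue. D n x) = 0" for n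
  proof -
    have "(LINT x|lebesgue. D n x) = (LINT x|lborel. D n x)"
      using Dm[of n] by (intro integral_completion) simp
    also have "\<dots> = ((LINT x|lborel. F (x + \<delta> n *\<^sub>R e)) - (LINT x|lborel. F x)) / \<delta> n"
      unfolding D_def using F_int lborel_integral_shift[OF Fm] by simp
    also have "\<dots> = 0" using lborel_integral_shift(2)[OF Fm] by simp
    finally show ?thesis .
  qed
  have "(\<lambda>n. LINT x|lebesgue. D n x) \<longlonglongrightarrow> (LINT x|lebesgue. F' x)"
  proof (rule integral_dominated_convergence[where w = "\<lambda>x. L * indicator B x"])
    show "D n \<in> borel_measurable lebesgue" for n
      using Dm[of n] by (simp add: measurable_completion)
    have "B \<in> lmeasurable" unfolding B_def by (rule lmeasurable_cball)
    then show "integrable lebesgue (\<lambda>x. L * indicator B x)"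
      by (auto simp: fmeasurable_def intro!: integrable_real_indicator)
    show "AE x in lebesgue. (\<lambda>n. D n x) \<longlonglongrightarrow> F' x"
      using deriv
    proof eventually_elim
      case (elim x)
      then have "((\<lambda>h. (F (x + h *\<^sub>R e) - F x) / h) \<longlongrightarrow> F' x) (at 0)"
        by (simp add: DERIV_def)
      moreover have "filterlim \<delta> (at 0) sequentially"
        unfolding \<delta>_def using LIMSEQ_Suc[OF lim_1_over_n] by (intro filterlim_atI) auto
      ultimately show ?case unfolding D_def by (rule filterlim_compose)
    qed
  qed (use D_le meas in auto)
  then show ?thesis by (simp add: D_int LIMSEQ_const_iff)
qed

text \<open>\<open>P\<close> is continuously differentiable with gradient \<open>g\<close>.\<close>

definition c1_grad :: "scalar_field \<Rightarrow> vector_field \<Rightarrow> bool" where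
  "c1_grad P g \<longleftrightarrow> continuous_on UNIV g \<and> (\<forall>x. (P has_derivative (\<lambda>h. g x \<bullet> h)) (at x))"

lemma c1_grad_continuous: "c1_grad P g \<Longrightarrow> continuous_on A P"
  unfolding c1_grad_def by (meson continuous_at_imp_continuous_on has_derivative_continuous)

lemma c1_grad_const: "c1_grad (\<lambda>x. c) (\<lambda>x. 0)"
  by (simp add: c1_grad_def)

lemma c1_grad_coord: "c1_grad (\<lambda>x. x $ i) (\<lambda>x. axis i 1)"
  by (auto simp: c1_grad_def inner_axis' intro: bounded_linear_imp_has_derivative bounded_linear_vec_nth)

lemma c1_grad_add: "c1_grad P g \<Longrightarrow> c1_grad Q h \<Longrightarrow> c1_grad (\<lambda>x. P x + Q x) (\<lambda>x. g x + h x)"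
  by (auto simp: c1_grad_def inner_add_left intro: continuous_on_add has_derivative_add)

lemma c1_grad_mult:
  assumes "c1_grad P g" "c1_grad Q h"
  shows "c1_grad (\<lambda>x. P x * Q x) (\<lambda>x. P x *\<^sub>R h x + Q x *\<^sub>R g x)"
  using assms c1_grad_continuous[OF assms(1), of UNIV] c1_grad_continuous[OF assms(2), of UNIV]
  unfolding c1_grad_def
  by (auto intro!: continuous_intros derivative_eq_intros simp: inner_add_left algebra_simps)

lemma c1_grad_power: "c1_grad P g \<Longrightarrow> \<exists>h. c1_grad (\<lambda>x. P x ^ n) h"
proof (induction n)
  case 0
  then show ?case using c1_grad_const by auto
next
  case (Suc n)
  then obtain h where "c1_grad (\<lambda>x. P x ^ n) h" by blast
  from c1_grad_mult[OF Suc.prems this] show ?case by auto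
qed

lemma c1_grad_sum:
  assumes "finite I" "\<And>i. i \<in> I \<Longrightarrow> \<exists>g. c1_grad (P i) g"
  shows "\<exists>g. c1_grad (\<lambda>x. \<Sum>i\<in>I. P i x) g"
  using assms
proof (induction I rule: finite_induct)
  case empty
  then show ?case using c1_grad_const by auto
next
  case (insert a I)
  then obtain h where h: "c1_grad (\<lambda>x. \<Sum>i\<in>I. P i x) h" by blast
  obtain g where "c1_grad (P a) g" using insert.prems by blast
  from c1_grad_add[OF this h] insert.hyps show ?case by auto
qed

lemma polys_c1:
  fixes p :: scalar_field
  assumes "p \<in> polys l"
  shows "\<exists>g. c1_grad p g"
proof -
  obtain c where p: "p = (\<lambda>x. \<Sum>i\<le>l. \<Sum>j\<le>l - i. ((x $ 1) ^ i * (x $ 2) ^ j) * c i j)"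
    using assms by (auto simp: polys_def fun_eq_iff)
  have "\<exists>g. c1_grad (\<lambda>x. ((x $ 1) ^ i * (x $ 2) ^ j) * c i j) g" for i j
  proof -
    obtain g h where "c1_grad (\<lambda>x. (x $ 1) ^ i) g" "c1_grad (\<lambda>x. (x $ 2) ^ j) h"
      using c1_grad_power[OF c1_grad_coord] by metis
    from c1_grad_mult[OF c1_grad_mult[OF this] c1_grad_const] show ?thesis by blast
  qed
  then show ?thesis unfolding p by (intro c1_grad_sum) auto
qed

lemma c1_grad_line:
  assumes "c1_grad P g"
  shows "((\<lambda>t. P (x + t *\<^sub>R axis i 1)) has_real_derivative g (x + t *\<^sub>R axis i 1) $ i) (at t)"
proof -
  have "(P has_derivative (\<lambda>h. g (x + t *\<^sub>R axis i 1) \<bullet> h)) (at (x + t *\<^sub>R axis i 1))"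
    using assms by (auto simp: c1_grad_def)
  moreover have "((\<lambda>t. x + t *\<^sub>R axis i 1) has_derivative (\<lambda>s. s *\<^sub>R axis i 1)) (at t)"
    by (auto intro!: derivative_eq_intros)
  ultimately have "((\<lambda>t. P (x + t *\<^sub>R axis i 1)) has_derivative
      (\<lambda>s. g (x + t *\<^sub>R axis i 1) \<bullet> (s *\<^sub>R axis i 1))) (at t)"
    using has_derivative_compose[of "\<lambda>t. x + t *\<^sub>R axis i 1" "\<lambda>s. s *\<^sub>R axis i 1" t UNIV P
        "\<lambda>h. g (x + t *\<^sub>R axis i 1) \<bullet> h"] by simp
  then show ?thesis
    by (simp add: has_field_derivative_def inner_axis mult.commute[of _ "g _ $ i"])
qed

lemma c1_grad_test: "\<phi> \<in> test_functions S \<Longrightarrow> c1_grad \<phi> (\<lambda>x. \<chi> i. partial_deriv i \<phi> x)"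
  unfolding c1_grad_def using test_function_has_derivative partial_deriv_test_continuous
  by (auto intro!: continuous_on_vec_lambda)

text \<open>Pieces may overlap; a measurable choice follows by letting the later piece win.\<close>

lemma piecewise_selection:
  fixes g :: "'k \<Rightarrow> real^2 \<Rightarrow> 'a::euclidean_space" and K :: "'k \<Rightarrow> (real^2) set"
  assumes "finite T" "\<And>k. k \<in> T \<Longrightarrow> K k \<in> sets borel" "\<And>k. k \<in> T \<Longrightarrow> g k \<in> borel_measurable borel"
  shows "\<exists>G\<in>borel_measurable borel. \<forall>x. (\<exists>k\<in>T. x \<in> K k) \<longrightarrow> (\<exists>k\<in>T. x \<in> K k \<and> G x = g k x)"
  using assms
proof (induction T rule: finite_induct)
  case empty
  then show ?case by (intro bexI[of _ "\<lambda>_. 0"]) auto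
next
  case (insert a T)
  then obtain G where G: "G \<in> borel_measurable borel"
      "\<forall>x. (\<exists>k\<in>T. x \<in> K k) \<longrightarrow> (\<exists>k\<in>T. x \<in> K k \<and> G x = g k x)" by auto
  have [measurable]: "K a \<in> sets borel" "g a \<in> borel_measurable borel" "G \<in> borel_measurable borel"
    using insert.prems G(1) by auto
  have "(\<lambda>x. if x \<in> K a then g a x else G x) \<in> borel_measurable borel" by measurable
  with G(2) show ?case by (intro bexI[of _ "\<lambda>x. if x \<in> K a then g a x else G x"]) auto
qed

context plane_domain
begin

text \<open>For a test function \<open>\<phi>\<close>, the product \<open>q \<phi>\<close> extended by zero is smooth on each of finitely many closed
  convex pieces and zero outside the domain.  A line meets each piece in a closed convex set, so the product is
  Lipschitz along lines, with the largest of the constants of the pieces.  Off the frontiers of the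
  pieces, which are negligible, it is differentiable with the expected derivative.\<close>

lemma has_weak_grad_piecewise:
  assumes T: "finite T" "\<And>K. K \<in> T \<Longrightarrow> compact K \<and> convex K" "\<Omega> \<subseteq> \<Union>T"
    and P: "\<And>K. K \<in> T \<Longrightarrow> c1_grad (P K) (g K)"
    and q: "\<And>K x. K \<in> T \<Longrightarrow> x \<in> K \<Longrightarrow> x \<in> \<Omega> \<Longrightarrow> q x = P K x" and qL: "q \<in> L2 \<Omega>"
    and G: "\<And>x. x \<in> \<Omega> \<Longrightarrow> \<exists>K\<in>T. x \<in> K \<and> G x = g K x" and GL: "G \<in> L2 \<Omega>"
  shows "has_weak_grad \<Omega> q G"
  unfolding has_weak_grad_def
proof (intro ballI allI)
  fix \<phi> i assume \<phi>: "\<phi> \<in> test_functions \<Omega>"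
  let ?e = "axis i 1 :: real^2"
  define g\<phi> where "g\<phi> = (\<lambda>x. \<chi> i. partial_deriv i \<phi> x)"
  have c\<phi>: "c1_grad \<phi> g\<phi>" unfolding g\<phi>_def using \<phi> by (rule c1_grad_test)
  obtain C where C: "compact C" "C \<subseteq> \<Omega>" "\<And>x. x \<notin> C \<Longrightarrow> \<phi> x = 0"
      "\<And>x i. x \<notin> C \<Longrightarrow> partial_deriv i \<phi> x = 0"
    using test_function_support[OF \<phi>] by blast
  define F where "F x = (if x \<in> \<Omega> then q x * \<phi> x else 0)" for x
  define F' where "F' x = indicator \<Omega> x *\<^sub>R (G x $ i * \<phi> x + q x * partial_deriv i \<phi> x)" for x
  define f where "f K x = P K x * \<phi> x" for K x
  define h where "h K x = P K x *\<^sub>R g\<phi> x + \<phi> x *\<^sub>R g K x" for K x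
  have cf: "c1_grad (f K) (h K)" if "K \<in> T" for K
    unfolding f_def h_def by (rule c1_grad_mult[OF P[OF that] c\<phi>])
  have FK: "F x = f K x" if "K \<in> T" "x \<in> K" for K x
    using q[OF that] C(2,3) by (auto simp: F_def f_def)
  have F0: "F x = 0" if "x \<notin> C" for x
    using C(3)[OF that] by (simp add: F_def)
  have "\<exists>M\<ge>0. \<forall>K\<in>T. \<forall>x\<in>K. \<bar>h K x $ i\<bar> \<le> M"
  proof -
    have "\<exists>M\<ge>0. \<forall>x\<in>K. \<bar>h K x $ i\<bar> \<le> M" if "K \<in> T" for K
    proof -
      have "continuous_on K (\<lambda>x. h K x $ i)"
        using cf[OF that] by (auto simp: c1_grad_def intro: continuous_on_subset continuous_intros)
      then have "bounded ((\<lambda>x. h K x $ i) ` K)"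
        using T(2)[OF that] by (intro compact_imp_bounded compact_continuous_image) auto
      then show ?thesis by (auto simp: bounded_pos intro: less_imp_le)
    qed
    then obtain M where M: "\<And>K. K \<in> T \<Longrightarrow> M K \<ge> 0 \<and> (\<forall>x\<in>K. \<bar>h K x $ i\<bar> \<le> M K)" by metis
    have "M K \<le> (\<Sum>K\<in>T. M K)" if "K \<in> T" for K
      using M T(1) that by (intro member_le_sum) auto
    then show ?thesis using M
      by (intro exI[of _ "\<Sum>K\<in>T. M K"]) (auto intro!: sum_nonneg intro: order_trans)
  qed
  then obtain M where M: "M \<ge> 0" "\<And>K x. K \<in> T \<Longrightarrow> x \<in> K \<Longrightarrow> \<bar>h K x $ i\<bar> \<le> M" by blast
  \<comment> \<open>The index \<open>None\<close> stands for the closed set outside the domain, where \<open>F\<close> vanishes.\<close>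
  have cont: "continuous_on UNIV F"
  proof -
    have "continuous_on (\<Union>k\<in>insert None (Some ` T). case k of None \<Rightarrow> - \<Omega> | Some K \<Rightarrow> K) F"
    proof (rule continuous_on_closed_Union)
      fix k assume k: "k \<in> insert None (Some ` T)"
      show "closed (case k of None \<Rightarrow> - \<Omega> | Some K \<Rightarrow> K)"
        using k T(2) open_domain by (auto intro: compact_imp_closed)
      show "continuous_on (case k of None \<Rightarrow> - \<Omega> | Some K \<Rightarrow> K) F"
      proof (cases k)
        case None
        have "continuous_on (- \<Omega>) F \<longleftrightarrow> continuous_on (- \<Omega>) (\<lambda>_. 0 :: real)"
          by (rule continuous_on_cong) (auto simp: F_def)
        then show ?thesis using None by simp
      next
        case (Some K)
        then have K: "K \<in> T" using k by auto
        have "continuous_on K (f K)" using cf[OF K] by (rule c1_grad_continuous)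
        then show ?thesis using FK[OF K] Some by (auto cong: continuous_on_cong)
      qed
    qed (use T(1) in auto)
    moreover have "(\<Union>k\<in>insert None (Some ` T). case k of None \<Rightarrow> - \<Omega> | Some K \<Rightarrow> K) = UNIV"
      using T(3) by auto
    ultimately show ?thesis by simp
  qed
  have lip: "\<bar>F (x + t *\<^sub>R ?e) - F x\<bar> \<le> M * \<bar>t\<bar>" for x t
  proof -
    define U where "U k = {t. x + t *\<^sub>R ?e \<in> (case k of None \<Rightarrow> - \<Omega> | Some K \<Rightarrow> K)}" for k
    have "M-lipschitz_on {min 0 t..max 0 t} (\<lambda>t. F (x + t *\<^sub>R ?e))"
    proof (rule lipschitz_on_closed_Union)
      fix k assume k: "k \<in> insert None (Some ` T)"
      have "closed ((\<lambda>t. x + t *\<^sub>R ?e) -` (case k of None \<Rightarrow> - \<Omega> | Some K \<Rightarrow> K))"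
        using k T(2) open_domain
        by (intro continuous_closed_vimage) (auto intro: compact_imp_closed continuous_intros)
      then show "closed (U k)" by (simp add: U_def vimage_def)
      show "M-lipschitz_on (U k) (\<lambda>t. F (x + t *\<^sub>R ?e))"
      proof (cases k)
        case None
        then show ?thesis using M(1) by (intro lipschitz_onI) (auto simp: U_def F_def)
      next
        case (Some K)
        then have K: "K \<in> T" using k by auto
        have U: "U k = {t. x + t *\<^sub>R ?e \<in> K}" by (simp add: U_def Some)
        have "convex (U k)"
          unfolding convex_alt U
        proof (intro ballI allI impI, simp)
          fix s t u :: real assume *: "x + s *\<^sub>R ?e \<in> K" "x + t *\<^sub>R ?e \<in> K" "0 \<le> u \<and> u \<le> 1"
          have "(1 - u) *\<^sub>R (x + s *\<^sub>R ?e) + u *\<^sub>R (x + t *\<^sub>R ?e) \<in> K"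
            using T(2)[OF K] * by (auto simp: convex_alt)
          then show "x + ((1 - u) * s + u * t) *\<^sub>R ?e \<in> K" by (simp add: algebra_simps)
        qed
        then have "M-lipschitz_on (U k) (\<lambda>t. f K (x + t *\<^sub>R ?e))"
          using M(1) M(2)[OF K] U
          by (intro bounded_derivative_imp_lipschitz[where f' = "\<lambda>t s. h K (x + t *\<^sub>R ?e) $ i * s"])
            (auto intro!: has_field_derivative_imp_has_derivative[THEN has_derivative_at_withinI] c1_grad_line[OF cf[OF K]] onorm_le
              simp: abs_mult intro!: mult_right_mono)
        then show ?thesis using FK[OF K] U by (auto simp: lipschitz_on_def)
      qed
    next
      have "\<exists>k\<in>insert None (Some ` T). s \<in> U k" for s
      proof (cases "x + s *\<^sub>R ?e \<in> \<Omega>")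
        case True
        then obtain K where "K \<in> T" "x + s *\<^sub>R ?e \<in> K" using T(3) by blast
        then show ?thesis by (intro bexI[of _ "Some K"]) (auto simp: U_def)
      qed (auto simp: U_def)
      then show "{min 0 t..max 0 t} \<subseteq> (\<Union>k\<in>insert None (Some ` T). U k)" by blast
    qed (use T(1) M(1) in auto)
    then have "dist (F (x + t *\<^sub>R ?e)) (F (x + 0 *\<^sub>R ?e)) \<le> M * dist t 0"
      by (rule lipschitz_onD) auto
    then show ?thesis by (simp add: dist_real_def)
  qed
  have deriv: "AE x in lebesgue. ((\<lambda>t. F (x + t *\<^sub>R ?e)) has_real_derivative F' x) (at 0)"
  proof -
    have "negligible (\<Union>K\<in>T. frontier K)"
      using T(1,2) by (intro negligible_Union) (auto intro: negligible_convex_frontier)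
    then have N: "(\<Union>K\<in>T. frontier K) \<in> null_sets lebesgue" using negligible_iff_null_sets by blast
    have line: "((\<lambda>t. F (x + t *\<^sub>R ?e)) has_real_derivative v) (at 0)"
      if "((\<lambda>t. f' (x + t *\<^sub>R ?e)) has_real_derivative v) (at 0)" "open W" "x \<in> W" "\<And>y. y \<in> W \<Longrightarrow> F y = f' y"
      for f' v W x
    proof -
      have "open ((\<lambda>t. x + t *\<^sub>R ?e) -` W)"
        by (intro open_vimage that(2) continuous_intros)
      then have "\<forall>\<^sub>F t in nhds 0. t \<in> (\<lambda>t. x + t *\<^sub>R ?e) -` W"
        using that(3) by (intro eventually_nhds_in_open) auto
      then have "\<forall>\<^sub>F t in nhds 0. F (x + t *\<^sub>R ?e) = f' (x + t *\<^sub>R ?e)"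
        by eventually_elim (auto intro: that(4))
      then show ?thesis using that(1) by (subst DERIV_cong_ev[OF refl _ refl])
    qed
    have main: "((\<lambda>t. F (x + t *\<^sub>R ?e)) has_real_derivative F' x) (at 0)"
      if x: "x \<notin> (\<Union>K\<in>T. frontier K)" for x
    proof (cases "x \<in> \<Omega>")
      case True
      then obtain K where K: "K \<in> T" "x \<in> K" "G x = g K x" using G by blast
      then have xi: "x \<in> interior K"
        using x T(2)[OF K(1)] closure_closed[OF compact_imp_closed] by (auto simp: frontier_def)
      have "((\<lambda>t. f K (x + t *\<^sub>R ?e)) has_real_derivative h K x $ i) (at 0)"
        using c1_grad_line[OF cf[OF K(1)], of x i 0] by simp
      then have "((\<lambda>t. F (x + t *\<^sub>R ?e)) has_real_derivative h K x $ i) (at 0)"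
        by (rule line[OF _ open_interior xi]) (use FK[OF K(1)] interior_subset in blast)
      moreover have "h K x $ i = F' x"
        using True K q[OF K(1,2) True] by (simp add: h_def F'_def g\<phi>_def mult.commute)
      ultimately show ?thesis by simp
    next
      case False
      have "open (- C)" using C(1) by (simp add: compact_imp_closed open_Compl)
      then have "((\<lambda>t. F (x + t *\<^sub>R ?e)) has_real_derivative 0) (at 0)"
        by (rule line[of "\<lambda>_. 0", rotated]) (use False C(2) F0 in auto)
      then show ?thesis using False by (simp add: F'_def)
    qed
    show ?thesis by (rule AE_I'[OF N]) (use main in blast)
  qed
  note int = L2_mult_integrable[OF L2_comp[OF GL, of i] L2_test[OF \<phi>]]
    L2_mult_integrable[OF qL L2_test_deriv[OF \<phi>, of i]]
  have "integrable (lebesgue_on \<Omega>) (\<lambda>x. G x $ i * \<phi> x + q x * partial_deriv i \<phi> x)"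
    using int by (rule Bochner_Integration.integrable_add)
  then have "integrable lebesgue F'"
    unfolding F'_def using domain_sets by (subst (asm) integrable_restrict_space) auto
  then have meas: "F' \<in> borel_measurable lebesgue" by (rule borel_measurable_integrable)
  have "(LINT x|lebesgue. F' x) = 0"
    by (rule integral_directional_derivative[OF cont compact_imp_bounded[OF C(1)] F0 lip deriv meas])
  moreover have "(LINT x|lebesgue. F' x) = (LINT x|lebesgue_on \<Omega>. G x $ i * \<phi> x + q x * partial_deriv i \<phi> x)"
    unfolding F'_def using domain_sets by (subst integral_restrict_space) auto
  ultimately show "(LINT x|lebesgue_on \<Omega>. q x * partial_deriv i \<phi> x) = - (LINT x|lebesgue_on \<Omega>. G x $ i * \<phi> x)"
    using Bochner_Integration.integral_add[OF int] by linarith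
qed

text \<open>A single disc as the only piece.\<close>

lemma has_weak_grad_test:
  assumes "\<phi> \<in> test_functions S"
  shows "has_weak_grad \<Omega> \<phi> (\<lambda>x. \<chi> i. partial_deriv i \<phi> x)"
proof -
  obtain R where "\<Omega> \<subseteq> ball 0 R" using bounded_subset_ballD[OF bounded_domain, of 0] by blast
  then have R: "\<Omega> \<subseteq> cball 0 R" using ball_subset_cball by blast
  show ?thesis
    by (rule has_weak_grad_piecewise[where T = "{cball 0 R}" and P = "\<lambda>_. \<phi>"
          and g = "\<lambda>_ x. \<chi> i. partial_deriv i \<phi> x"])
      (use R assms c1_grad_test L2_test L2_test_grad in auto)
qed

lemma test_in_H1: "\<phi> \<in> test_functions S \<Longrightarrow> \<phi> \<in> H1 \<Omega>"
  by (rule H1I[OF L2_test L2_test_grad has_weak_grad_test])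

lemma weak_grad_test:
  "\<phi> \<in> test_functions S \<Longrightarrow> ae_eq \<Omega> (weak_grad \<Omega> \<phi>) (\<lambda>x. \<chi> i. partial_deriv i \<phi> x)"
  by (rule weak_grad_eqI[OF L2_test L2_test_grad has_weak_grad_test])

lemma H1_piecewise:
  assumes T: "finite T" "\<And>K. K \<in> T \<Longrightarrow> compact K \<and> convex K" "\<Omega> \<subseteq> \<Union>T"
    and q: "continuous_on (closure \<Omega>) q"
    and P: "\<And>K. K \<in> T \<Longrightarrow> \<exists>p g. c1_grad p g \<and> (\<forall>x\<in>K. x \<in> \<Omega> \<longrightarrow> q x = p x)"
  shows "q \<in> H1 \<Omega>"
proof -
  obtain P g where Pg: "\<And>K. K \<in> T \<Longrightarrow> c1_grad (P K) (g K)"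
      "\<And>K x. K \<in> T \<Longrightarrow> x \<in> K \<Longrightarrow> x \<in> \<Omega> \<Longrightarrow> q x = P K x"
    using P by metis
  have qL: "q \<in> L2 \<Omega>"
  proof -
    have "compact (closure \<Omega>)" using bounded_domain by simp
    then have "bounded (q ` closure \<Omega>)" using q by (intro compact_imp_bounded compact_continuous_image)
    then obtain B where "\<And>x. x \<in> closure \<Omega> \<Longrightarrow> norm (q x) \<le> B" by (auto simp: bounded_iff)
    then have B: "\<And>x. x \<in> \<Omega> \<Longrightarrow> norm (q x) \<le> B" using closure_subset by blast
    have "continuous_on \<Omega> q" using q closure_subset by (rule continuous_on_subset)
    then have "q \<in> borel_measurable (lebesgue_on \<Omega>)"
      using domain_sets by (rule continuous_imp_measurable_on_sets_lebesgue)
    then show ?thesis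
      using B by (intro L2_bounded[OF bounded_domain domain_sets, where C = B]) auto
  qed
  have gcont: "continuous_on UNIV (g K)" if "K \<in> T" for K using Pg(1)[OF that] by (simp add: c1_grad_def)
  obtain G where G: "G \<in> borel_measurable borel"
      "\<And>x. (\<exists>K\<in>T. x \<in> K) \<Longrightarrow> \<exists>K\<in>T. x \<in> K \<and> G x = g K x"
    using piecewise_selection[of T "\<lambda>K. K" g, OF T(1) borel_compact borel_measurable_continuous_onI[OF gcont]] T(2)
    by blast
  have GL: "G \<in> L2 \<Omega>"
  proof -
    have "bounded (\<Union>K\<in>T. g K ` K)"
      using T gcont by (intro bounded_UN) (auto intro!: compact_imp_bounded compact_continuous_image continuous_on_subset[OF gcont])
    then obtain B where B: "\<And>K x. K \<in> T \<Longrightarrow> x \<in> K \<Longrightarrow> norm (g K x) \<le> B" by (auto simp: bounded_iff)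
    have "norm (G x) \<le> B" if "x \<in> \<Omega>" for x
      using G(2)[of x] B that T(3) by (metis UnionE subsetD)
    then show ?thesis
      using G(1) by (intro L2_bounded[OF bounded_domain domain_sets, where C = B] borel_measurable_lebesgue_on) auto
  qed
  have "has_weak_grad \<Omega> q G"
    by (rule has_weak_grad_piecewise[OF T Pg qL _ GL]) (use G(2) T(3) in blast)+
  then show ?thesis by (rule H1I[OF qL GL])
qed

end

section \<open>Boundary functionals\<close>

lemma zero_test_function: "(0::scalar_field) \<in> test_functions S"
proof -
  have pd: "partial_deriv i (0::scalar_field) = 0" for i
  proof
    fix x :: "real^2"
    have "((0::scalar_field) has_derivative (\<lambda>_. 0)) (at x)" by (simp add: zero_fun_def)
    then show "partial_deriv i (0::scalar_field) x = 0 x" by (simp add: partial_deriv_eq)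
  qed
  have "fold partial_deriv js 0 = (0::scalar_field)" for js
    by (induction js) (simp_all only: fold_simps pd)
  then have "smooth 0" by (simp add: smooth_def) (simp add: zero_fun_def)
  then show ?thesis by (simp add: test_functions_def)
qed

lemma two_products_le:
  fixes a b c d :: real
  shows "a * c + b * d \<le> sqrt (a\<^sup>2 + b\<^sup>2) * sqrt (c\<^sup>2 + d\<^sup>2)"
proof -
  have "(a * c + b * d)\<^sup>2 \<le> (a\<^sup>2 + b\<^sup>2) * (c\<^sup>2 + d\<^sup>2)"
    using zero_le_power2[of "a * d - b * c"] by (simp add: power2_eq_square algebra_simps)
  then have "sqrt ((a * c + b * d)\<^sup>2) \<le> sqrt ((a\<^sup>2 + b\<^sup>2) * (c\<^sup>2 + d\<^sup>2))" by (rule real_sqrt_le_mono)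
  then show ?thesis by (simp add: real_sqrt_mult)
qed

context plane_domain
begin

lemma H10_iff:
  "q \<in> H10 \<Omega> \<longleftrightarrow> q \<in> H1 \<Omega> \<and> (\<forall>\<epsilon>>0. \<exists>\<phi>\<in>test_functions \<Omega>. H1_norm \<Omega> (q - \<phi>) < \<epsilon>)"
  by (simp add: H10_def fun_diff_def)

lemma bdry_trace_iff: "v \<in> bdry_trace \<Omega> q \<longleftrightarrow> v \<in> H1 \<Omega> \<and> v - q \<in> H10 \<Omega>"
  by (simp add: bdry_trace_def fun_diff_def)

lemma bdry_trace_self: "q \<in> H1 \<Omega> \<Longrightarrow> q \<in> bdry_trace \<Omega> q"
  using zero_test_function[of \<Omega>] H1_zero
  by (auto simp: bdry_trace_iff H10_iff intro!: bexI[of _ 0])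

lemma H_half_norm_le: "v \<in> u \<Longrightarrow> H_half_norm \<Omega> u \<le> H1_norm \<Omega> v"
  unfolding H_half_norm_def by (rule cInf_lower) (auto intro!: bdd_belowI[of _ 0])

lemma H_half_norm_trace_le: "q \<in> H1 \<Omega> \<Longrightarrow> H_half_norm \<Omega> (bdry_trace \<Omega> q) \<le> H1_norm \<Omega> q"
  by (intro H_half_norm_le bdry_trace_self)

lemma H_half_norm_nonneg: "u \<noteq> {} \<Longrightarrow> 0 \<le> H_half_norm \<Omega> u"
  unfolding H_half_norm_def by (rule cInf_greatest) auto

lemma H_half_nonempty: "u \<in> H_half \<Omega> \<Longrightarrow> u \<noteq> {}"
  using bdry_trace_self by (auto simp: H_half_def)

lemma H_mhalf_lin:
  assumes "r \<in> H_mhalf \<Omega>"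
  shows "lin_on (H1 \<Omega>) (\<lambda>q. r (bdry_trace \<Omega> q))"
proof -
  have *: "r (bdry_trace \<Omega> (\<lambda>x. a * p x + b * q x)) = a * r (bdry_trace \<Omega> p) + b * r (bdry_trace \<Omega> q)"
    if "p \<in> H1 \<Omega>" "q \<in> H1 \<Omega>" for a b p q
    using assms that unfolding H_mhalf_def by blast
  show ?thesis
  proof (rule lin_onI)
    show "r (bdry_trace \<Omega> (p + q)) = r (bdry_trace \<Omega> p) + r (bdry_trace \<Omega> q)"
      if "p \<in> H1 \<Omega>" "q \<in> H1 \<Omega>" for p q
      using *[OF that, of 1 1] by (simp add: plus_fun_def)
    show "r (bdry_trace \<Omega> (c *\<^sub>R p)) = c * r (bdry_trace \<Omega> p)" if "p \<in> H1 \<Omega>" for c p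
      using *[OF that that, of c 0] by (simp add: scaleR_fun_def)
  qed
qed

lemma H_mhalf_bdd:
  assumes "r \<in> H_mhalf \<Omega>"
  shows "bdd_above {\<bar>r u\<bar> |u. u \<in> H_half \<Omega> \<and> H_half_norm \<Omega> u \<le> 1}"
proof -
  obtain C where C: "\<forall>u\<in>H_half \<Omega>. \<bar>r u\<bar> \<le> C * H_half_norm \<Omega> u"
    using assms unfolding H_mhalf_def by blast
  show ?thesis
  proof (rule bdd_aboveI[of _ "\<bar>C\<bar>"])
    fix y assume "y \<in> {\<bar>r u\<bar> |u. u \<in> H_half \<Omega> \<and> H_half_norm \<Omega> u \<le> 1}"
    then obtain u where u: "y = \<bar>r u\<bar>" "u \<in> H_half \<Omega>" "H_half_norm \<Omega> u \<le> 1" by blast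
    have "C * H_half_norm \<Omega> u \<le> \<bar>C\<bar> * 1"
      using u(3) H_half_norm_nonneg[OF H_half_nonempty[OF u(2)]] by (intro mult_mono) auto
    then show "y \<le> \<bar>C\<bar>" using C u(1,2) by fastforce
  qed
qed

text \<open>Homogeneity reduces to a lifting of norm one, whose trace has norm at most one and takes part in the
  supremum.  If the norm vanishes there is nothing to scale; then continuity of \<open>r\<close> with any constant
  gives zero.\<close>

lemma H_mhalf_bound:
  assumes r: "r \<in> H_mhalf \<Omega>" and q: "q \<in> H1 \<Omega>"
  shows "\<bar>r (bdry_trace \<Omega> q)\<bar> \<le> H_mhalf_norm \<Omega> r * H1_norm \<Omega> q"
proof -
  obtain C where C: "\<forall>u\<in>H_half \<Omega>. \<bar>r u\<bar> \<le> C * H_half_norm \<Omega> u"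
    using r unfolding H_mhalf_def by blast
  have tr: "bdry_trace \<Omega> p \<in> H_half \<Omega>" if "p \<in> H1 \<Omega>" for p using that by (auto simp: H_half_def)
  show ?thesis
  proof (cases "H1_norm \<Omega> q = 0")
    case True
    then have "H_half_norm \<Omega> (bdry_trace \<Omega> q) = 0"
      using H_half_norm_trace_le[OF q] H_half_norm_nonneg[OF H_half_nonempty[OF tr[OF q]]] by simp
    then show ?thesis using bspec[OF C tr[OF q]] True by simp
  next
    case False
    then have pos: "H1_norm \<Omega> q > 0" using H1_norm_nonneg[of q] by linarith
    define p where "p = (1 / H1_norm \<Omega> q) *\<^sub>R q"
    have pH: "p \<in> H1 \<Omega>" using q subspace_scale[OF subspace_H1] by (simp add: p_def)
    have "H1_norm \<Omega> p = 1" using pos by (simp add: p_def H1.sn_scale[OF q])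
    then have p1: "H_half_norm \<Omega> (bdry_trace \<Omega> p) \<le> 1" using H_half_norm_trace_le[OF pH] by simp
    have "\<bar>r (bdry_trace \<Omega> p)\<bar> \<le> H_mhalf_norm \<Omega> r"
      unfolding H_mhalf_norm_def using tr[OF pH] p1 by (intro cSup_upper H_mhalf_bdd[OF r]) auto
    moreover have "r (bdry_trace \<Omega> p) = (1 / H1_norm \<Omega> q) * r (bdry_trace \<Omega> q)"
      unfolding p_def by (rule lin_on_scale[OF H_mhalf_lin[OF r] q])
    ultimately show ?thesis using pos by (simp add: abs_mult field_simps)
  qed
qed

lemma H_mhalf_norm_nonneg:
  assumes "r \<in> H_mhalf \<Omega>"
  shows "0 \<le> H_mhalf_norm \<Omega> r"
proof -
  have "H1_norm \<Omega> 0 = 0" by (rule H1.sn_zero)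
  then have "\<bar>r (bdry_trace \<Omega> 0)\<bar> \<in> {\<bar>r u\<bar> |u. u \<in> H_half \<Omega> \<and> H_half_norm \<Omega> u \<le> 1}"
    using H_half_norm_trace_le[OF H1_zero] H1_zero by (auto simp: H_half_def)
  then have "\<bar>r (bdry_trace \<Omega> 0)\<bar> \<le> H_mhalf_norm \<Omega> r"
    unfolding H_mhalf_norm_def by (rule cSup_upper[OF _ H_mhalf_bdd[OF assms]])
  then show ?thesis by linarith
qed

text \<open>The contribution of the \<open>i\<close>-th row of \<open>\<tau>\<close> to the boundary term, computed with the lifting \<open>v\<close>; \<open>row_norm\<close>
  is the \<open>H(div)\<close> norm of that row.\<close>

definition green :: "2 \<Rightarrow> tensor_field \<Rightarrow> scalar_field \<Rightarrow> real" where
  "green i \<tau> v = L2_ip \<Omega> (\<lambda>x. \<tau> x $ i) (weak_grad \<Omega> v) + L2_ip \<Omega> (\<lambda>x. weak_div \<Omega> \<tau> x $ i) v"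

definition row_norm :: "2 \<Rightarrow> tensor_field \<Rightarrow> real" where
  "row_norm i \<tau> = sqrt ((L2_norm \<Omega> (\<lambda>x. \<tau> x $ i))\<^sup>2 + (L2_norm \<Omega> (\<lambda>x. weak_div \<Omega> \<tau> x $ i))\<^sup>2)"

lemma row_norm_nonneg: "0 \<le> row_norm i \<tau>"
  by (simp add: row_norm_def)

lemma sum_row_norm:
  assumes "\<tau> \<in> div_domain"
  shows "(\<Sum>i\<in>UNIV. (row_norm i \<tau>)\<^sup>2) = (Y_norm \<Omega> \<tau>)\<^sup>2"
  using L2_norm_comp[OF div_domain_L2[OF assms]] L2_norm_comp[OF weak_div(1)[OF assms]]
  by (simp add: row_norm_def Y_norm_def sum.distrib sum_nonneg)

lemma green_lin_right:
  assumes "\<tau> \<in> div_domain"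
  shows "lin_on (H1 \<Omega>) (green i \<tau>)"
proof -
  note [simp] = L2_comp[OF div_domain_L2[OF assms], of i] L2_comp[OF weak_div(1)[OF assms], of i]
  have "lin_on (H1 \<Omega>) (\<lambda>v. L2_ip \<Omega> (\<lambda>x. \<tau> x $ i) (weak_grad \<Omega> v))"
    by (rule lin_on_L2_ip(2)[OF ae_lin_weak_grad subspace_H1]) simp
  moreover have "lin_on (H1 \<Omega>) (\<lambda>v. L2_ip \<Omega> (\<lambda>x. weak_div \<Omega> \<tau> x $ i) v)"
    by (rule lin_on_L2_ip(2)[OF ae_lin_incl subspace_H1]) (auto simp: H1_L2)
  ultimately show ?thesis
    unfolding green_def[abs_def] by (simp add: lin_on_def algebra_simps)
qed

lemma ae_lin_comp:
  fixes A :: "'v::real_vector \<Rightarrow> real^2 \<Rightarrow> ('b::euclidean_space)^'n"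
  assumes "ae_lin \<Omega> V A"
  shows "ae_lin \<Omega> V (\<lambda>v x. A v x $ i)"
  using assms ae_linD(1)[OF assms]
  by (intro ae_lin_pointwise[where T = "\<lambda>x y. y $ i"] L2_comp) (auto intro: linearI)

lemma green_lin_left:
  assumes "v \<in> H1 \<Omega>"
  shows "lin_on div_domain (\<lambda>\<tau>. green i \<tau> v)"
proof -
  have "lin_on div_domain (\<lambda>\<tau>. L2_ip \<Omega> (\<lambda>x. \<tau> x $ i) (weak_grad \<Omega> v))"
    by (rule lin_on_L2_ip(1)[OF ae_lin_comp[OF ae_lin_incl] subspace_div_domain weak_grad(1)[OF assms]])
      (auto simp: div_domain_L2)
  moreover have "lin_on div_domain (\<lambda>\<tau>. L2_ip \<Omega> (\<lambda>x. weak_div \<Omega> \<tau> x $ i) v)"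
    by (rule lin_on_L2_ip(1)[OF ae_lin_comp[OF ae_lin_weak_div] subspace_div_domain H1_L2[OF assms]])
  ultimately show ?thesis
    unfolding green_def by (simp add: lin_on_def algebra_simps)
qed

lemma green_bound:
  assumes "\<tau> \<in> div_domain" "v \<in> H1 \<Omega>"
  shows "\<bar>green i \<tau> v\<bar> \<le> row_norm i \<tau> * H1_norm \<Omega> v"
proof -
  note L = L2_comp[OF div_domain_L2[OF assms(1)], of i] L2_comp[OF weak_div(1)[OF assms(1)], of i]
  have "\<bar>green i \<tau> v\<bar> \<le> L2_norm \<Omega> (\<lambda>x. \<tau> x $ i) * L2_norm \<Omega> (weak_grad \<Omega> v) +
      L2_norm \<Omega> (\<lambda>x. weak_div \<Omega> \<tau> x $ i) * L2_norm \<Omega> v"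
    unfolding green_def
    using L2.cauchy_schwarz[OF L(1) weak_grad(1)[OF assms(2)]] L2.cauchy_schwarz[OF L(2) H1_L2[OF assms(2)]]
    by linarith
  also have "\<dots> \<le> row_norm i \<tau> * H1_norm \<Omega> v"
    using two_products_le unfolding row_norm_def H1_norm_def by (metis add.commute)
  finally show ?thesis .
qed

lemma green_test:
  assumes "\<tau> \<in> div_domain" "\<phi> \<in> test_functions \<Omega>"
  shows "green i \<tau> \<phi> = 0"
proof -
  have "L2_ip \<Omega> (weak_grad \<Omega> \<phi>) (\<lambda>x. \<tau> x $ i) = L2_ip \<Omega> (\<lambda>x. \<chi> j. partial_deriv j \<phi> x) (\<lambda>x. \<tau> x $ i)"
    using assms
    by (intro L2_ip_ae_cong weak_grad_test weak_grad(1) test_in_H1 L2_test_grad L2_comp div_domain_L2)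
  then have "L2_ip \<Omega> (\<lambda>x. \<tau> x $ i) (weak_grad \<Omega> \<phi>) = L2_ip \<Omega> (\<lambda>x. \<tau> x $ i) (\<lambda>x. \<chi> j. partial_deriv j \<phi> x)"
    by (simp add: L2_ip_def inner_commute)
  then show ?thesis
    using weak_div(2)[OF assms(1)] assms(2) by (simp add: green_def has_weak_div_def L2_ip_def)
qed

text \<open>By definition of the weak divergence the term vanishes for test functions, which are dense in
  \<open>H\<^sup>1\<^sub>0\<close>.  Hence the choice of the lifting is immaterial.\<close>

lemma green_H10:
  assumes "\<tau> \<in> div_domain" "z \<in> H10 \<Omega>"
  shows "green i \<tau> z = 0"
proof (rule ccontr)
  assume ne: "green i \<tau> z \<noteq> 0"
  have zH: "z \<in> H1 \<Omega>" using assms(2) by (simp add: H10_iff)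
  \<comment> \<open>Adding one keeps the denominator positive.\<close>
  define \<epsilon> where "\<epsilon> = \<bar>green i \<tau> z\<bar> / (row_norm i \<tau> + 1)"
  have pos: "row_norm i \<tau> + 1 > 0" using row_norm_nonneg[of i \<tau>] by linarith
  then have "\<epsilon> > 0" using ne by (simp add: \<epsilon>_def)
  then obtain \<phi> where \<phi>: "\<phi> \<in> test_functions \<Omega>" "H1_norm \<Omega> (z - \<phi>) < \<epsilon>"
    using assms(2) by (auto simp: H10_iff)
  have \<phi>H: "\<phi> \<in> H1 \<Omega>" using \<phi>(1) by (rule test_in_H1)
  have "green i \<tau> (z - \<phi>) = green i \<tau> z"
    using lin_on_diff[OF green_lin_right[OF assms(1)] subspace_H1 zH \<phi>H] green_test[OF assms(1) \<phi>(1)] by simp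
  then have "\<bar>green i \<tau> z\<bar> \<le> row_norm i \<tau> * H1_norm \<Omega> (z - \<phi>)"
    using green_bound[OF assms(1) subspace_diff[OF subspace_H1 zH \<phi>H], of i] by simp
  also have "\<dots> \<le> row_norm i \<tau> * \<epsilon>"
    using \<phi>(2) row_norm_nonneg by (intro mult_left_mono) auto
  also have "\<dots> < (row_norm i \<tau> + 1) * \<epsilon>" using \<open>\<epsilon> > 0\<close> by simp
  also have "\<dots> = \<bar>green i \<tau> z\<bar>" using pos by (simp add: \<epsilon>_def)
  finally show False by simp
qed

lemma green_lift:
  assumes "\<tau> \<in> div_domain" "u \<in> H_half \<Omega>" "v \<in> u" "w \<in> u"
  shows "green i \<tau> v = green i \<tau> w"
proof -
  obtain q where q: "q \<in> H1 \<Omega>" "u = bdry_trace \<Omega> q" using assms(2) by (auto simp: H_half_def)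
  have "green i \<tau> v = green i \<tau> q" if "v \<in> u" for v
  proof -
    have v: "v \<in> H1 \<Omega>" "v - q \<in> H10 \<Omega>" using that by (auto simp: q(2) bdry_trace_iff)
    then show ?thesis
      using lin_on_diff[OF green_lin_right[OF assms(1)] subspace_H1 v(1) q(1)] green_H10[OF assms(1) v(2)] by simp
  qed
  then show ?thesis using assms(3,4) by simp
qed

lemma H_half_sub: "u \<in> H_half \<Omega> \<Longrightarrow> v \<in> u \<Longrightarrow> v \<in> H1 \<Omega>"
  by (auto simp: H_half_def bdry_trace_iff)

lemma green_half_bound:
  assumes "\<tau> \<in> div_domain" "u \<in> H_half \<Omega>" "v \<in> u"
  shows "\<bar>green i \<tau> v\<bar> \<le> row_norm i \<tau> * H_half_norm \<Omega> u"
proof (cases "row_norm i \<tau> = 0")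
  case True
  then show ?thesis using green_bound[OF assms(1) H_half_sub[OF assms(2,3)], of i] by simp
next
  case False
  then have pos: "row_norm i \<tau> > 0" using row_norm_nonneg[of i \<tau>] by linarith
  have "\<bar>green i \<tau> v\<bar> / row_norm i \<tau> \<le> H1_norm \<Omega> w" if "w \<in> u" for w
    using green_lift[OF assms(1,2,3) that, of i] green_bound[OF assms(1) H_half_sub[OF assms(2) that], of i] pos
    by (simp add: divide_le_eq mult.commute)
  then have "\<bar>green i \<tau> v\<bar> / row_norm i \<tau> \<le> H_half_norm \<Omega> u"
    unfolding H_half_norm_def using assms(3) by (intro cInf_greatest) auto
  then show ?thesis using pos by (simp add: divide_le_eq mult.commute)
qed

lemma H_fun_green:
  "H_fun \<Omega> u \<tau> = - (\<Sum>i\<in>UNIV. green i \<tau> (SOME v. v \<in> u $ i))"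
  by (simp add: H_fun_def normal_trace_pairing_def green_def L2_ip_def Let_def)

lemma H_half_some: "u \<in> H_half \<Omega> \<Longrightarrow> (SOME v. v \<in> u) \<in> u"
  using H_half_nonempty[of u] some_in_eq[of u] by blast

lemma H_fun_lin:
  assumes "u \<in> H_half_vec \<Omega>"
  shows "lin_on div_domain (H_fun \<Omega> u)"
proof -
  have "lin_on div_domain (\<lambda>\<tau>. green i \<tau> (SOME v. v \<in> u $ i))" for i
    using assms H_half_sub H_half_some by (intro green_lin_left) (auto simp: H_half_vec_def)
  then show ?thesis
    unfolding H_fun_green[abs_def] by (simp add: lin_on_def sum.distrib sum_distrib_left)
qed

text \<open>Each row is bounded with the best lifting, which turns the norm of the lifting into the quotient
  norm; the rows are combined by the Cauchy-Schwarz inequality in \<open>\<real>\<^sup>2\<close>.\<close>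

lemma H_fun_bound:
  assumes u: "u \<in> H_half_vec \<Omega>" and \<tau>: "\<tau> \<in> div_domain"
  shows "\<bar>H_fun \<Omega> u \<tau>\<bar> \<le> H_half_vec_norm \<Omega> u * Y_norm \<Omega> \<tau>"
proof -
  have ui: "u $ i \<in> H_half \<Omega>" for i using u by (auto simp: H_half_vec_def)
  have nn: "0 \<le> H_half_norm \<Omega> (u $ i)" for i by (rule H_half_norm_nonneg[OF H_half_nonempty[OF ui]])
  have "\<bar>H_fun \<Omega> u \<tau>\<bar> \<le> (\<Sum>i\<in>UNIV. \<bar>green i \<tau> (SOME v. v \<in> u $ i)\<bar>)"
    unfolding H_fun_green by (simp add: sum_abs)
  also have "\<dots> \<le> (\<Sum>i\<in>UNIV. \<bar>row_norm i \<tau>\<bar> * \<bar>H_half_norm \<Omega> (u $ i)\<bar>)"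
    using green_half_bound[OF \<tau> ui H_half_some[OF ui]] nn row_norm_nonneg by (intro sum_mono) auto
  also have "\<dots> \<le> L2_set (\<lambda>i. row_norm i \<tau>) UNIV * L2_set (\<lambda>i. H_half_norm \<Omega> (u $ i)) UNIV"
    by (rule L2_set_mult_ineq)
  also have "L2_set (\<lambda>i. row_norm i \<tau>) UNIV = Y_norm \<Omega> \<tau>"
    unfolding L2_set_def sum_row_norm[OF \<tau>] by (simp add: Y_norm_def)
  also have "L2_set (\<lambda>i. H_half_norm \<Omega> (u $ i)) UNIV = H_half_vec_norm \<Omega> u"
    by (simp add: L2_set_def H_half_vec_norm_def)
  finally show ?thesis by (simp add: mult.commute)
qed

lemma H_half_vec_norm_nonneg: "0 \<le> H_half_vec_norm \<Omega> u"
  by (simp add: H_half_vec_norm_def sum_nonneg)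

end

section \<open>The mesh and the discrete spaces\<close>

text \<open>Below a boundary point of a strict epigraph there are points outside the closure, arbitrarily
  near.  So no boundary point is interior to the closure.\<close>

lemma lipschitz_interior_closure:
  assumes "open \<Omega>" "lipschitz_boundary \<Omega>"
  shows "interior (closure \<Omega>) = \<Omega>"
proof
  show "\<Omega> \<subseteq> interior (closure \<Omega>)" using assms(1) by (simp add: closure_subset interior_maximal)
  show "interior (closure \<Omega>) \<subseteq> \<Omega>"
  proof (rule ccontr)
    assume "\<not> interior (closure \<Omega>) \<subseteq> \<Omega>"
    then obtain x where x: "x \<in> interior (closure \<Omega>)" "x \<notin> \<Omega>" by blast
    then have xf: "x \<in> frontier \<Omega>"
      using assms(1) interior_subset by (auto simp: frontier_def interior_open)
    obtain a b \<phi> \<delta> \<eta> where *: "\<delta> > 0" "\<eta> > 0"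
        "\<And>s t. \<bar>s\<bar> < \<delta> \<Longrightarrow> \<bar>t\<bar> < \<eta> \<Longrightarrow>
           (x + s *\<^sub>R a + t *\<^sub>R b \<in> \<Omega> \<longleftrightarrow> \<phi> s < t) \<and>
           (x + s *\<^sub>R a + t *\<^sub>R b \<in> frontier \<Omega> \<longleftrightarrow> t = (\<phi> s :: real))" and nb: "norm b = 1"
      using assms(2)[unfolded lipschitz_boundary_def, rule_format, OF xf] by metis
    have "\<phi> 0 = 0" using *(3)[of 0 0] *(1,2) xf by simp
    obtain e where e: "e > 0" "ball x e \<subseteq> closure \<Omega>" using x(1) by (auto simp: mem_interior)
    define t where "t = - min (e / 2) (\<eta> / 2)"
    have t: "t < 0" "\<bar>t\<bar> < \<eta>" "\<bar>t\<bar> < e" using e(1) *(2) by (auto simp: t_def)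
    have "x + t *\<^sub>R b \<in> ball x e" using t nb by (simp add: dist_norm)
    then have "x + t *\<^sub>R b \<in> \<Omega> \<union> frontier \<Omega>"
      using e(2) assms(1) by (auto simp: frontier_def interior_open)
    moreover have "x + t *\<^sub>R b \<notin> \<Omega> \<union> frontier \<Omega>"
      using *(3)[of 0 t] *(1) t \<open>\<phi> 0 = 0\<close> by auto
    ultimately show False by simp
  qed
qed

lemma polys_continuous:
  fixes p :: "real^2 \<Rightarrow> 'a::euclidean_space"
  assumes "p \<in> polys l"
  shows "continuous_on A p"
proof -
  obtain c where "p = (\<lambda>x. \<Sum>i\<le>l. \<Sum>j\<le>l - i. ((x $ 1) ^ i * (x $ 2) ^ j) *\<^sub>R c i j)"
    using assms by (auto simp: polys_def fun_eq_iff)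
  then show ?thesis by (auto intro!: continuous_intros)
qed

lemma subspace_polys: "subspace (polys l)"
proof (rule subspaceI)
  show "0 \<in> polys l" by (auto simp: polys_def intro!: exI[of _ "\<lambda>_ _. 0"])
  show "p + q \<in> polys l" if pq: "p \<in> polys l" "q \<in> polys l" for p q :: "real^2 \<Rightarrow> 'a"
  proof -
    obtain c where c: "\<forall>x. p x = (\<Sum>i\<le>l. \<Sum>j\<le>l - i. ((x $ 1) ^ i * (x $ 2) ^ j) *\<^sub>R c i j)"
      using pq(1) unfolding polys_def by blast
    obtain d where "\<forall>x. q x = (\<Sum>i\<le>l. \<Sum>j\<le>l - i. ((x $ 1) ^ i * (x $ 2) ^ j) *\<^sub>R d i j)"
      using pq(2) unfolding polys_def by blast
    with c have "\<forall>x. (p + q) x = (\<Sum>i\<le>l. \<Sum>j\<le>l - i. ((x $ 1) ^ i * (x $ 2) ^ j) *\<^sub>R (c i j + d i j))"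
      by (simp add: sum.distrib scaleR_add_right)
    then show ?thesis unfolding polys_def by (intro CollectI exI[of _ "\<lambda>i j. c i j + d i j"])
  qed
  show "a *\<^sub>R p \<in> polys l" if p: "p \<in> polys l" for a and p :: "real^2 \<Rightarrow> 'a"
  proof -
    obtain c where "\<forall>x. p x = (\<Sum>i\<le>l. \<Sum>j\<le>l - i. ((x $ 1) ^ i * (x $ 2) ^ j) *\<^sub>R c i j)"
      using p unfolding polys_def by blast
    then have "\<forall>x. (a *\<^sub>R p) x = (\<Sum>i\<le>l. \<Sum>j\<le>l - i. ((x $ 1) ^ i * (x $ 2) ^ j) *\<^sub>R (a *\<^sub>R c i j))"
      by (simp add: scaleR_sum_right mult.commute)
    then show ?thesis unfolding polys_def by (intro CollectI exI[of _ "\<lambda>i j. a *\<^sub>R c i j"])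
  qed
qed

lemma polys_const: "(\<lambda>x. a) \<in> polys l"
proof -
  have "a = (\<Sum>i\<le>l. \<Sum>j\<le>l - i. ((x $ 1) ^ i * (x $ 2) ^ j) *\<^sub>R (if i = 0 \<and> j = 0 then a else 0))"
    for x :: "real^2"
  proof -
    have "(\<Sum>j\<le>l - i. ((x $ 1) ^ i * (x $ 2) ^ j) *\<^sub>R (if i = 0 \<and> j = 0 then a else 0)) = (if i = 0 then a else 0)" for i
    proof (cases "i = 0")
      case True
      have "(\<Sum>j\<le>l. ((x $ 2) ^ j) *\<^sub>R (if j = 0 then a else 0)) = (\<Sum>j\<le>l. if j = 0 then a else 0)"
        by (intro sum.cong) auto
      then show ?thesis using True by simp
    qed simp
    then show ?thesis by simp
  qed
  then show ?thesis unfolding polys_def by (intro CollectI exI[of _ "\<lambda>i j. if i = 0 \<and> j = 0 then a else 0"]) blast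
qed

lemma subspace_poly_on: "subspace {f :: real^2 \<Rightarrow> 'a::real_vector. poly_on l K f}"
proof (rule subspaceI)
  have "\<exists>p\<in>polys l. ae_eq K (0 :: real^2 \<Rightarrow> 'a) p"
    using subspace_0[OF subspace_polys] by (intro bexI[of _ 0]) simp_all
  then show "(0 :: real^2 \<Rightarrow> 'a) \<in> {f. poly_on l K f}" by (simp add: poly_on_def)
next
  fix f g :: "real^2 \<Rightarrow> 'a" assume f: "f \<in> {f. poly_on l K f}" and g: "g \<in> {f. poly_on l K f}"
  obtain p where p: "p \<in> polys l" "ae_eq K f p" using f unfolding poly_on_def by blast
  obtain q where q: "q \<in> polys l" "ae_eq K g q" using g unfolding poly_on_def by blast
  show "f + g \<in> {f. poly_on l K f}"
    unfolding poly_on_def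
    using subspace_add[OF subspace_polys p(1) q(1)] ae_eq_add[OF p(2) q(2)] by blast
next
  fix a and f :: "real^2 \<Rightarrow> 'a" assume f: "f \<in> {f. poly_on l K f}"
  obtain p where p: "p \<in> polys l" "ae_eq K f p" using f unfolding poly_on_def by blast
  show "a *\<^sub>R f \<in> {f. poly_on l K f}"
    unfolding poly_on_def
    using subspace_scale[OF subspace_polys p(1), of a] ae_eq_scaleR[OF p(2), of a] by blast
qed

lemma poly_on_zero: "poly_on l K 0"
  using subspace_0[OF subspace_poly_on, of l K] by simp

lemma poly_on_ae_cong: "poly_on l K f \<Longrightarrow> ae_eq K g f \<Longrightarrow> poly_on l K g"
  unfolding poly_on_def using ae_eq_trans by blast

lemma measurable_ae_eq:
  fixes f g :: "real^2 \<Rightarrow> 'a::euclidean_space"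
  assumes S: "S \<in> sets lebesgue" and f: "f \<in> borel_measurable (lebesgue_on S)" and eq: "ae_eq S f g"
  shows "g \<in> borel_measurable (lebesgue_on S)"
proof -
  have "(\<lambda>x. indicator S x *\<^sub>R f x) \<in> borel_measurable lebesgue"
    using f S by (simp add: borel_measurable_restrict_space_iff)
  moreover have "AE x in lebesgue. indicator S x *\<^sub>R f x = indicator S x *\<^sub>R g x"
    using eq S unfolding ae_eq_def by (auto simp: AE_restrict_space_iff indicator_def elim!: eventually_mono)
  ultimately have "(\<lambda>x. indicator S x *\<^sub>R g x) \<in> borel_measurable lebesgue"
    by (rule borel_measurable_AE)
  then show ?thesis using S by (simp add: borel_measurable_restrict_space_iff)
qed

lemma L2_poly_on:
  fixes f :: "real^2 \<Rightarrow> 'a::euclidean_space"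
  assumes "compact K" "poly_on l K f"
  shows "f \<in> L2 K"
proof -
  have K: "K \<in> sets lebesgue" using assms(1) by (simp add: borel_compact sets_completionI_sets)
  obtain p where p: "p \<in> polys l" "ae_eq K f p" using assms(2) by (auto simp: poly_on_def)
  have pm: "p \<in> borel_measurable (lebesgue_on K)"
    using polys_continuous[OF p(1)] by (rule borel_measurable_continuous_lebesgue_on)
  have "bounded (p ` K)" using assms(1) polys_continuous[OF p(1)]
    by (intro compact_imp_bounded compact_continuous_image)
  then obtain B where B: "\<And>x. x \<in> K \<Longrightarrow> norm (p x) \<le> B" by (auto simp: bounded_iff)
  have "AE x in lebesgue_on K. norm (f x) \<le> B"
    using p(2) unfolding ae_eq_def by (rule lebesgue_on_mono) (use B in auto)
  then show ?thesis
    using measurable_ae_eq[OF K pm ae_eq_sym[OF p(2)]] compact_imp_bounded[OF assms(1)] K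
    by (intro L2_bounded)
qed

lemma L2_subset:
  fixes f :: "real^2 \<Rightarrow> 'a::euclidean_space"
  assumes "f \<in> L2 S" "S' \<subseteq> S" "S \<in> sets lebesgue" "S' \<in> sets lebesgue"
  shows "f \<in> L2 S'"
proof -
  have m: "f \<in> borel_measurable (lebesgue_on S')"
    using L2_measurable[OF assms(1)] assms(2) measurable_restrict_mono by blast
  have "set_integrable lebesgue S (\<lambda>x. (norm (f x))\<^sup>2)"
    using L2_integrable_square[OF assms(1)] assms(3) by (simp add: set_integrable_def integrable_restrict_space)
  then have "set_integrable lebesgue S' (\<lambda>x. (norm (f x))\<^sup>2)"
    by (rule set_integrable_subset) (use assms in auto)
  then have "integrable (lebesgue_on S') (\<lambda>x. (norm (f x))\<^sup>2)"
    using assms(4) by (simp add: set_integrable_def integrable_restrict_space)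
  then show ?thesis using m by (simp add: L2_def)
qed

lemma sum_fun_apply: "(\<Sum>i\<in>I. f i) x = (\<Sum>i\<in>I. f i x)" for f :: "'i \<Rightarrow> 'b \<Rightarrow> 'c::comm_monoid_add"
  by (induction I rule: infinite_finite_induct) auto

lemma subspace_product:
  assumes "subspace A" "subspace B"
  shows "subspace (A \<times> B)"
  using assms by (auto simp: subspace_def zero_prod_def)

text \<open>As \<open>fin_gen\<close>, but the generators need not lie in \<open>A\<close>.\<close>

definition finite_mod :: "'a::real_vector set \<Rightarrow> 'a set \<Rightarrow> bool" where
  "finite_mod A N \<longleftrightarrow> (\<exists>F. finite F \<and> (\<forall>x\<in>A. \<exists>y\<in>span F. x - y \<in> N))"

lemma finite_mod_Times:
  assumes "finite_mod A M" "finite_mod B N"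
  shows "finite_mod (A \<times> B) (M \<times> N)"
proof -
  obtain F G where F: "finite F" "\<And>x. x \<in> A \<Longrightarrow> \<exists>y\<in>span F. x - y \<in> M"
    and G: "finite G" "\<And>x. x \<in> B \<Longrightarrow> \<exists>y\<in>span G. x - y \<in> N"
    using assms unfolding finite_mod_def by metis
  let ?H = "F \<times> {0} \<union> {0} \<times> G"
  have "subspace {y. (y, 0) \<in> span ?H}"
    using subspace_span[of ?H] by (fastforce simp: subspace_def zero_prod_def)
  then have 1: "(y, 0) \<in> span ?H" if "y \<in> span F" for y
    using span_minimal[of F "{y. (y, 0) \<in> span ?H}"] that by (auto intro: span_base)
  have "subspace {y. (0, y) \<in> span ?H}"
    using subspace_span[of ?H] by (fastforce simp: subspace_def zero_prod_def)
  then have 2: "(0, y) \<in> span ?H" if "y \<in> span G" for y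
    using span_minimal[of G "{y. (0, y) \<in> span ?H}"] that by (auto intro: span_base)
  have "\<exists>y\<in>span ?H. z - y \<in> M \<times> N" if z: "z \<in> A \<times> B" for z
  proof -
    obtain a where "fst z - a \<in> M" "a \<in> span F" using F(2)[of "fst z"] z by auto
    moreover obtain b where "snd z - b \<in> N" "b \<in> span G" using G(2)[of "snd z"] z by auto
    moreover have "(a, b) = (a, 0) + (0, b)" by simp
    ultimately show ?thesis using span_add[OF 1 2] by (intro bexI[of _ "(a, b)"]) (simp_all add: mem_Times_iff)
  qed
  then show ?thesis unfolding finite_mod_def using F(1) G(1) by (intro exI[of _ ?H]) auto
qed

lemma finite_mod_mono: "finite_mod B N \<Longrightarrow> A \<subseteq> B \<Longrightarrow> finite_mod A N"
  unfolding finite_mod_def by blast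

definition ae_zero :: "(real^2) set \<Rightarrow> (real^2 \<Rightarrow> 'a::real_vector) set" where
  "ae_zero \<Omega> = {f. ae_eq \<Omega> f 0}"

lemma subspace_ae_zero: "subspace (ae_zero \<Omega>)"
proof (rule subspaceI)
  show "f + g \<in> ae_zero \<Omega>" if "f \<in> ae_zero \<Omega>" "g \<in> ae_zero \<Omega>" for f g :: "real^2 \<Rightarrow> 'a"
    using ae_eq_add[of \<Omega> f 0 g 0] that by (simp add: ae_zero_def)
  show "c *\<^sub>R f \<in> ae_zero \<Omega>" if "f \<in> ae_zero \<Omega>" for c and f :: "real^2 \<Rightarrow> 'a"
    using ae_eq_scaleR[of \<Omega> f 0 c] that by (simp add: ae_zero_def)
qed (simp add: ae_zero_def)

locale mesh =
  fixes \<Omega> :: "(real^2) set" and T :: "(real^2) set set" and k :: nat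
  assumes lipschitz: "lipschitz_domain \<Omega>" and partition: "regular_partition \<Omega> T"
begin

sublocale plane_domain \<Omega>
  using lipschitz by unfold_locales (auto simp: lipschitz_domain_def)

lemma finite_T: "finite T" and T_simplex: "K \<in> T \<Longrightarrow> 2 simplex K" and T_cover: "\<Union>T = closure \<Omega>"
  using partition by (auto simp: regular_partition_def triangulation_def)

lemma T_compact: "K \<in> T \<Longrightarrow> compact K" and T_convex: "K \<in> T \<Longrightarrow> convex K"
  using T_simplex compact_simplex convex_simplex by blast+

lemma T_sets: "K \<in> T \<Longrightarrow> K \<in> sets lebesgue"
  using T_compact by (simp add: borel_compact sets_completionI_sets)

lemma domain_covered: "\<Omega> \<subseteq> \<Union>T"
  using T_cover closure_subset by blast

lemma interior_T_subset:
  assumes "K \<in> T"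
  shows "interior K \<subseteq> \<Omega>"
proof -
  have "K \<subseteq> closure \<Omega>" using assms T_cover by blast
  then have "interior K \<subseteq> interior (closure \<Omega>)" by (rule interior_mono)
  then show ?thesis
    using lipschitz_interior_closure[OF open_domain] lipschitz by (simp add: lipschitz_domain_def)
qed

lemma plane_domain_interior: "K \<in> T \<Longrightarrow> plane_domain (interior K)"
  using T_compact by unfold_locales (auto intro: bounded_interior compact_imp_bounded)

lemma interior_sets: "interior K \<in> sets lebesgue"
  by auto

text \<open>The part of \<open>K\<close> outside the domain lies in the frontier of \<open>K\<close>, which is negligible by convexity.\<close>

lemma ae_eq_on_T:
  assumes "ae_eq \<Omega> f g" "K \<in> T"
  shows "ae_eq K f g"
proof -
  have "frontier K \<in> null_sets lebesgue"
    using negligible_convex_frontier[OF T_convex[OF assms(2)]] negligible_iff_null_sets by blast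
  then have "AE x in lebesgue. x \<notin> frontier K" by (rule AE_not_in)
  moreover have "AE x in lebesgue. x \<in> \<Omega> \<longrightarrow> f x = g x"
    using assms(1) domain_sets by (simp add: ae_eq_def AE_restrict_space_iff)
  ultimately have "AE x in lebesgue. x \<in> K \<longrightarrow> f x = g x"
  proof eventually_elim
    case (elim x)
    then show ?case
      using interior_T_subset[OF assms(2)] closure_subset[of K] by (auto simp: frontier_def)
  qed
  then show ?thesis using T_sets[OF assms(2)] by (simp add: ae_eq_def AE_restrict_space_iff)
qed

lemma ae_on_all_T:
  assumes "\<And>K. K \<in> T \<Longrightarrow> AE x in lebesgue_on K. P K x"
  shows "AE x in lebesgue_on \<Omega>. \<forall>K\<in>T. x \<in> K \<longrightarrow> P K x"
proof -
  have "AE x in lebesgue. \<forall>K\<in>T. x \<in> K \<longrightarrow> P K x"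
    using assms T_sets finite_T by (intro AE_finite_allI) (auto simp: AE_restrict_space_iff)
  then show ?thesis using domain_sets by (auto simp: AE_restrict_space_iff elim!: eventually_mono)
qed

text \<open>Generators are the monomials times basis vectors, cut off to one triangle each.  A point on several
  triangles is attributed to a selected one, so that no term is counted twice.\<close>

lemma piecewise_poly_finite:
  "finite_mod {f :: real^2 \<Rightarrow> 'a::euclidean_space. \<forall>K\<in>T. poly_on l K f} (ae_zero \<Omega>)"
proof -
  define sel where "sel x = (SOME K. K \<in> T \<and> x \<in> K)" for x
  have sel: "sel x \<in> T \<and> x \<in> sel x" if "x \<in> \<Omega>" for x
    unfolding sel_def by (rule someI_ex) (use domain_covered that in blast)
  define m :: "(real^2) set \<Rightarrow> nat \<Rightarrow> nat \<Rightarrow> 'a \<Rightarrow> real^2 \<Rightarrow> 'a"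
    where "m K i j b x = (if sel x = K then ((x $ 1) ^ i * (x $ 2) ^ j) *\<^sub>R b else 0)" for K i j b x
  define F where "F = (\<lambda>(K, i, j, b). m K i j b) ` (T \<times> {..l} \<times> {..l} \<times> Basis)"
  have "finite F" unfolding F_def using finite_T by simp
  moreover have "\<exists>g\<in>span F. f - g \<in> ae_zero \<Omega>" if f: "\<forall>K\<in>T. poly_on l K f" for f
  proof -
    obtain p where p: "\<And>K. K \<in> T \<Longrightarrow> p K \<in> polys l \<and> ae_eq K f (p K)"
      using f unfolding poly_on_def by metis
    have "\<forall>K\<in>T. \<exists>c. \<forall>x. p K x = (\<Sum>i\<le>l. \<Sum>j\<le>l - i. ((x $ 1) ^ i * (x $ 2) ^ j) *\<^sub>R c i j)"
      using p unfolding polys_def by blast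
    from bchoice[OF this] obtain c where
      c: "\<And>K x. K \<in> T \<Longrightarrow> p K x = (\<Sum>i\<le>l. \<Sum>j\<le>l - i. ((x $ 1) ^ i * (x $ 2) ^ j) *\<^sub>R c K i j)"
      by blast
    define g where "g = (\<Sum>K\<in>T. \<Sum>i\<le>l. \<Sum>j\<le>l - i. \<Sum>b\<in>Basis. (c K i j \<bullet> b) *\<^sub>R m K i j b)"
    have "g \<in> span F"
      unfolding g_def F_def
      by (intro span_sum span_scale span_base) (force simp: image_iff)
    moreover have "g x = p (sel x) x" if x: "x \<in> \<Omega>" for x
    proof -
      have "(\<Sum>b\<in>Basis. (c K i j \<bullet> b) *\<^sub>R m K i j b x) =
          (if sel x = K then ((x $ 1) ^ i * (x $ 2) ^ j) *\<^sub>R c K i j else 0)" for K i j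
      proof (cases "sel x = K")
        case True
        have "((x $ 1) ^ i * (x $ 2) ^ j) *\<^sub>R c K i j =
            ((x $ 1) ^ i * (x $ 2) ^ j) *\<^sub>R (\<Sum>b\<in>Basis. (c K i j \<bullet> b) *\<^sub>R b)"
          by (simp add: euclidean_representation)
        then show ?thesis using True by (simp add: m_def scaleR_sum_right mult.commute)
      qed (simp add: m_def)
      then have "g x = (\<Sum>K\<in>T. \<Sum>i\<le>l. \<Sum>j\<le>l - i. if sel x = K then ((x $ 1) ^ i * (x $ 2) ^ j) *\<^sub>R c K i j else 0)"
        unfolding g_def by (simp add: sum_fun_apply)
      also have "\<dots> = (\<Sum>K\<in>T. if sel x = K then p K x else 0)"
        using c by (intro sum.cong) auto
      also have "\<dots> = p (sel x) x" using finite_T sel[OF x] by simp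
      finally show ?thesis .
    qed
    moreover have "AE x in lebesgue_on \<Omega>. \<forall>K\<in>T. x \<in> K \<longrightarrow> f x = p K x"
      using p by (intro ae_on_all_T) (auto simp: ae_eq_def)
    ultimately have "ae_eq \<Omega> f g"
      unfolding ae_eq_def using sel by (auto elim!: lebesgue_on_mono)
    then show ?thesis using \<open>g \<in> span F\<close> by (auto simp: ae_zero_def ae_eq_diff_0_iff)
  qed
  ultimately show ?thesis unfolding finite_mod_def by blast
qed

abbreviation "X1 \<equiv> X1h \<Omega> T k"
abbreviation "X2 \<equiv> X2h \<Omega> T k"
abbreviation "X \<equiv> Xh \<Omega> T k"
abbreviation "Y \<equiv> Yh \<Omega> T k"
abbreviation "Z \<equiv> Zh \<Omega> T k"

lemma subspace_L2_sym: "subspace (L2_sym \<Omega>)"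
proof (rule subspaceI)
  have tr: "transpose (A + B) = transpose A + transpose B" "transpose (c *\<^sub>R A) = c *\<^sub>R transpose A"
    for A B :: "real^2^2" and c by (simp_all add: transpose_def vec_eq_iff)
  show "f + g \<in> L2_sym \<Omega>" if "f \<in> L2_sym \<Omega>" "g \<in> L2_sym \<Omega>" for f g
  proof -
    have "AE x in lebesgue_on \<Omega>. transpose (f x) = f x" "AE x in lebesgue_on \<Omega>. transpose (g x) = g x"
      using that by (auto simp: L2_sym_def)
    then have "AE x in lebesgue_on \<Omega>. transpose ((f + g) x) = (f + g) x"
      by eventually_elim (simp add: tr)
    then show ?thesis using that L2_add by (auto simp: L2_sym_def)
  qed
  show "c *\<^sub>R f \<in> L2_sym \<Omega>" if "f \<in> L2_sym \<Omega>" for c f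
  proof -
    have "AE x in lebesgue_on \<Omega>. transpose (f x) = f x" using that by (auto simp: L2_sym_def)
    then have "AE x in lebesgue_on \<Omega>. transpose ((c *\<^sub>R f) x) = (c *\<^sub>R f) x"
      by eventually_elim (simp add: tr)
    then show ?thesis using that L2_scaleR by (auto simp: L2_sym_def)
  qed
  show "0 \<in> L2_sym \<Omega>"
    using subspace_0[OF subspace_L2] by (auto simp: L2_sym_def transpose_def vec_eq_iff)
qed

lemma X1_L2: "e \<in> X1 \<Longrightarrow> e \<in> L2 \<Omega>"
  by (simp add: X1h_def L2_sym_def)

lemma L2_interior:
  "K \<in> T \<Longrightarrow> f \<in> L2 \<Omega> \<Longrightarrow> f \<in> L2 (interior K)" for f :: "real^2 \<Rightarrow> 'a::euclidean_space"
  by (rule L2_subset[OF _ interior_T_subset domain_sets interior_sets])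

lemma L2_interior_poly:
  "K \<in> T \<Longrightarrow> poly_on l K f \<Longrightarrow> f \<in> L2 (interior K)" for f :: "real^2 \<Rightarrow> 'a::euclidean_space"
  by (rule L2_subset[OF L2_poly_on[OF T_compact] interior_subset T_sets interior_sets])

lemma subspace_X1: "subspace X1"
proof (rule subspaceI)
  fix e e' assume e: "e \<in> X1" "e' \<in> X1"
  have "poly_on (k + 2) K (e + e') \<and> (\<exists>D. has_weak_div (interior K) (e + e') D \<and> poly_on k K D)"
    if K: "K \<in> T" for K
  proof
    show "poly_on (k + 2) K (e + e')"
      using subspace_add[OF subspace_poly_on, of e] e K by (simp add: X1h_def)
    obtain D where D: "has_weak_div (interior K) e D" "poly_on k K D"
      using e(1) K unfolding X1h_def by blast
    obtain D' where D': "has_weak_div (interior K) e' D'" "poly_on k K D'"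
      using e(2) K unfolding X1h_def by blast
    have "has_weak_div (interior K) (e + e') (D + D')"
      using e D D'
      by (intro plane_domain.has_weak_div_add[OF plane_domain_interior[OF K]] L2_interior[OF K] X1_L2
          L2_interior_poly[OF K])
    moreover have "poly_on k K (D + D')" using subspace_add[OF subspace_poly_on, of D] D D' by simp
    ultimately show "\<exists>D. has_weak_div (interior K) (e + e') D \<and> poly_on k K D" by blast
  qed
  moreover have "e + e' \<in> L2_sym \<Omega>" using e subspace_add[OF subspace_L2_sym] by (simp add: X1h_def)
  ultimately show "e + e' \<in> X1" by (simp add: X1h_def)
next
  fix c e assume e: "e \<in> X1"
  have "poly_on (k + 2) K (c *\<^sub>R e) \<and> (\<exists>D. has_weak_div (interior K) (c *\<^sub>R e) D \<and> poly_on k K D)"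
    if K: "K \<in> T" for K
  proof
    show "poly_on (k + 2) K (c *\<^sub>R e)"
      using subspace_scale[OF subspace_poly_on, of e] e K by (simp add: X1h_def)
    obtain D where D: "has_weak_div (interior K) e D" "poly_on k K D"
      using e K by (auto simp: X1h_def)
    have "has_weak_div (interior K) (c *\<^sub>R e) (c *\<^sub>R D)"
      using D(1) by (rule plane_domain.has_weak_div_scaleR[OF plane_domain_interior[OF K]])
    moreover have "poly_on k K (c *\<^sub>R D)" using subspace_scale[OF subspace_poly_on, of D] D by simp
    ultimately show "\<exists>D. has_weak_div (interior K) (c *\<^sub>R e) D \<and> poly_on k K D" by blast
  qed
  moreover have "c *\<^sub>R e \<in> L2_sym \<Omega>" using e subspace_scale[OF subspace_L2_sym] by (simp add: X1h_def)
  ultimately show "c *\<^sub>R e \<in> X1" by (simp add: X1h_def)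
next
  show "0 \<in> X1"
    using subspace_0[OF subspace_L2_sym]
    by (auto simp: X1h_def intro!: exI[of _ 0] has_weak_div_zero poly_on_zero)
qed

lemma subspace_X2: "subspace X2"
proof (rule subspaceI)
  fix p q assume pq: "p \<in> X2" "q \<in> X2"
  have "\<exists>r\<in>polys (k + 1). \<forall>x\<in>K. (p + q) x = r x" if K: "K \<in> T" for K
  proof -
    obtain a where "a \<in> polys (k + 1)" "\<forall>x\<in>K. p x = a x" using pq(1) K unfolding X2h_def by blast
    moreover obtain b where "b \<in> polys (k + 1)" "\<forall>x\<in>K. q x = b x" using pq(2) K unfolding X2h_def by blast
    ultimately show ?thesis by (intro bexI[of _ "a + b"]) (auto intro: subspace_add[OF subspace_polys])
  qed
  moreover have "continuous_on (closure \<Omega>) (p + q)"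
    using pq by (auto simp: X2h_def plus_fun_def intro: continuous_on_add)
  ultimately show "p + q \<in> X2" by (simp add: X2h_def)
next
  fix c p assume p: "p \<in> X2"
  have "\<exists>r\<in>polys (k + 1). \<forall>x\<in>K. (c *\<^sub>R p) x = r x" if K: "K \<in> T" for K
  proof -
    obtain a where "a \<in> polys (k + 1)" "\<forall>x\<in>K. p x = a x" using p K unfolding X2h_def by blast
    then show ?thesis by (intro bexI[of _ "c *\<^sub>R a"]) (auto intro: subspace_scale[OF subspace_polys])
  qed
  moreover have "continuous_on (closure \<Omega>) (c *\<^sub>R p)"
    using p by (auto simp: X2h_def scaleR_fun_def intro: continuous_intros)
  ultimately show "c *\<^sub>R p \<in> X2" by (simp add: X2h_def)
next
  have "\<exists>p\<in>polys (k + 1). \<forall>x\<in>K. (0 :: scalar_field) x = p x" for K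
    using subspace_0[OF subspace_polys] by (intro bexI[of _ 0]) simp_all
  then show "0 \<in> X2"
    by (simp add: X2h_def)
qed

lemma X2_H1: "q \<in> X2 \<Longrightarrow> q \<in> H1 \<Omega>"
proof (rule H1_piecewise[OF finite_T])
  assume q: "q \<in> X2"
  show "continuous_on (closure \<Omega>) q" using q by (simp add: X2h_def)
  show "\<exists>p g. c1_grad p g \<and> (\<forall>x\<in>K. x \<in> \<Omega> \<longrightarrow> q x = p x)" if K: "K \<in> T" for K
  proof -
    obtain p where "p \<in> polys (k + 1)" "\<forall>x\<in>K. q x = p x" using q K unfolding X2h_def by blast
    then show ?thesis using polys_c1[of p "k + 1"] by blast
  qed
qed (use T_compact T_convex domain_covered in auto)

lemma Y_div_domain: "\<tau> \<in> Y \<Longrightarrow> \<tau> \<in> div_domain"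
  by (auto simp: Yh_def Y_space_def L2_sym_def div_domain_def)

lemma subspace_Y: "subspace Y"
proof (rule subspaceI)
  fix s t assume st: "s \<in> Y" "t \<in> Y"
  have d: "s + t \<in> div_domain" using st Y_div_domain subspace_add[OF subspace_div_domain] by blast
  have "s + t \<in> L2_sym \<Omega>" using st subspace_add[OF subspace_L2_sym] by (simp add: Yh_def Y_space_def)
  moreover have "poly_on (k + 2) K (s + t) \<and> poly_on k K (weak_div \<Omega> (s + t))" if K: "K \<in> T" for K
  proof
    show "poly_on (k + 2) K (s + t)"
      using subspace_add[OF subspace_poly_on, of s] st K by (simp add: Yh_def)
    have "poly_on k K (weak_div \<Omega> s + weak_div \<Omega> t)"
      using subspace_add[OF subspace_poly_on, of "weak_div \<Omega> s"] st K by (simp add: Yh_def)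
    then show "poly_on k K (weak_div \<Omega> (s + t))"
      using ae_linD(2)[OF ae_lin_weak_div] st Y_div_domain K
      by (blast intro: poly_on_ae_cong ae_eq_on_T)
  qed
  ultimately show "s + t \<in> Y" using d by (auto simp: Yh_def Y_space_def div_domain_def)
next
  fix c s assume s: "s \<in> Y"
  have d: "c *\<^sub>R s \<in> div_domain" using s Y_div_domain subspace_scale[OF subspace_div_domain] by blast
  have "c *\<^sub>R s \<in> L2_sym \<Omega>" using s subspace_scale[OF subspace_L2_sym] by (simp add: Yh_def Y_space_def)
  moreover have "poly_on (k + 2) K (c *\<^sub>R s) \<and> poly_on k K (weak_div \<Omega> (c *\<^sub>R s))" if K: "K \<in> T" for K
  proof
    show "poly_on (k + 2) K (c *\<^sub>R s)"
      using subspace_scale[OF subspace_poly_on, of s] s K by (simp add: Yh_def)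
    have "poly_on k K (c *\<^sub>R weak_div \<Omega> s)"
      using subspace_scale[OF subspace_poly_on, of "weak_div \<Omega> s"] s K by (simp add: Yh_def)
    then show "poly_on k K (weak_div \<Omega> (c *\<^sub>R s))"
      using ae_linD(3)[OF ae_lin_weak_div] s Y_div_domain K
      by (blast intro: poly_on_ae_cong ae_eq_on_T)
  qed
  ultimately show "c *\<^sub>R s \<in> Y" using d by (auto simp: Yh_def Y_space_def div_domain_def)
next
  have "poly_on k K (weak_div \<Omega> 0)" if "K \<in> T" for K
    using poly_on_ae_cong[OF poly_on_zero ae_eq_on_T[OF ae_lin_zero[OF ae_lin_weak_div subspace_div_domain] that]] .
  then show "0 \<in> Y"
    using subspace_0[OF subspace_div_domain] subspace_0[OF subspace_L2_sym] poly_on_zero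
    by (auto simp: Yh_def Y_space_def div_domain_def)
qed

lemma subspace_Z: "subspace Z"
proof -
  have "Z = L2 \<Omega> \<inter> (\<Inter>K\<in>T. {f. poly_on k K f})" by (auto simp: Zh_def)
  then show ?thesis
    by (simp add: subspace_inter subspace_L2 subspace_Inter subspace_poly_on image_iff)
qed

lemma Y_subset_X1: "\<tau> \<in> Y \<Longrightarrow> \<tau> \<in> X1"
proof -
  assume \<tau>: "\<tau> \<in> Y"
  have "has_weak_div (interior K) \<tau> (weak_div \<Omega> \<tau>)" if K: "K \<in> T" for K
    unfolding has_weak_div_def
  proof (intro ballI allI)
    fix \<phi> i assume \<phi>: "\<phi> \<in> test_functions (interior K)"
    have "\<phi> \<in> test_functions \<Omega>" using \<phi> test_functions_mono[OF interior_T_subset[OF K]] by blast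
    then show "(LINT x|lebesgue_on (interior K). \<tau> x $ i \<bullet> (\<chi> j. partial_deriv j \<phi> x)) =
        - (LINT x|lebesgue_on (interior K). weak_div \<Omega> \<tau> x $ i * \<phi> x)"
      using weak_div(2)[OF Y_div_domain[OF \<tau>]]
      unfolding LINT_test_subset[OF interior_T_subset[OF K] interior_sets domain_sets \<phi>] has_weak_div_def
      by blast
  qed
  then show "\<tau> \<in> X1" using \<tau> by (auto simp: X1h_def Yh_def Y_space_def)
qed

lemma weak_div_Z: "\<tau> \<in> Y \<Longrightarrow> weak_div \<Omega> \<tau> \<in> Z"
  using weak_div(1)[OF Y_div_domain] by (auto simp: Zh_def Yh_def)

lemma subspace_X: "subspace X"
  unfolding Xh_def by (rule subspace_product[OF subspace_X1 subspace_X2])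

lemma X_parts: "d \<in> X \<Longrightarrow> fst d \<in> X1" "d \<in> X \<Longrightarrow> snd d \<in> X2"
  by (auto simp: Xh_def)

lemma X_X_space: "d \<in> X \<Longrightarrow> d \<in> X_space \<Omega>"
  using X2_H1 by (auto simp: Xh_def X_space_def X1h_def)

lemma finite_X1: "finite_mod X1 (ae_zero \<Omega>)"
  by (rule finite_mod_mono[OF piecewise_poly_finite[of "k + 2"]]) (auto simp: X1h_def)

lemma finite_X2: "finite_mod X2 (ae_zero \<Omega>)"
proof (rule finite_mod_mono[OF piecewise_poly_finite[of "k + 1"]])
  have "poly_on (k + 1) K q" if q: "q \<in> X2" "K \<in> T" for q K
  proof -
    obtain p where p: "p \<in> polys (k + 1)" "\<forall>x\<in>K. q x = p x" using q unfolding X2h_def by blast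
    have "ae_eq K q p" unfolding ae_eq_def by (rule AE_I2) (use p(2) in simp)
    then show ?thesis using p(1) by (auto simp: poly_on_def)
  qed
  then show "X2 \<subseteq> {f. \<forall>K\<in>T. poly_on (k + 1) K f}" by blast
qed

lemma finite_Y: "finite_mod Y (ae_zero \<Omega>)"
  by (rule finite_mod_mono[OF piecewise_poly_finite[of "k + 2"]]) (auto simp: Yh_def)

lemma finite_Z: "finite_mod Z (ae_zero \<Omega>)"
  by (rule finite_mod_mono[OF piecewise_poly_finite[of k]]) (auto simp: Zh_def)

end

section \<open>Norms, forms and constants on the discrete spaces\<close>

lemma lin_on_plus: "lin_on V l \<Longrightarrow> lin_on V m \<Longrightarrow> lin_on V (\<lambda>x. l x + m x)"
  and lin_on_minus: "lin_on V l \<Longrightarrow> lin_on V m \<Longrightarrow> lin_on V (\<lambda>x. l x - m x)"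
  and lin_on_cmult: "lin_on V l \<Longrightarrow> lin_on V (\<lambda>x. a * l x)"
  and lin_on_uminus: "lin_on V l \<Longrightarrow> lin_on V (\<lambda>x. - l x)"
  by (simp_all add: lin_on_def algebra_simps)

lemma lin_on_compose:
  assumes "lin_on V l" "\<And>u. u \<in> U \<Longrightarrow> f u \<in> V" "\<And>u v. f (u + v) = f u + f v" "\<And>c u. f (c *\<^sub>R u) = c *\<^sub>R f u"
  shows "lin_on U (\<lambda>u. l (f u))"
  using assms by (simp add: lin_on_def)

lemma semi_inner_fin_gen:
  assumes "semi_inner V ip" "subspace N" "finite_mod V N" "\<And>x. x \<in> V \<Longrightarrow> x \<in> N \<Longrightarrow> ip x x = 0"
  shows "fin_gen V (semi_inner.null V ip)"
proof -
  interpret semi_inner V ip by fact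
  obtain G where "finite G" "\<And>x. x \<in> V \<Longrightarrow> \<exists>y\<in>span G. x - y \<in> N"
    using assms(3) unfolding finite_mod_def by blast
  then have "fin_gen V N" by (rule fin_gen_of_outer[OF sub assms(2)])
  then obtain F where F: "finite F" "F \<subseteq> V" "\<And>x. x \<in> V \<Longrightarrow> \<exists>y\<in>span F. x - y \<in> N"
    unfolding fin_gen_def by blast
  have "\<exists>y\<in>span F. x - y \<in> null" if x: "x \<in> V" for x
  proof -
    obtain y where y: "y \<in> span F" "x - y \<in> N" using F(3)[OF x] by blast
    have "y \<in> V" using y(1) span_minimal[OF F(2) sub] by blast
    then have "x - y \<in> null" using subspace_diff[OF sub x] assms(4) y(2) by (auto simp: null_def)
    then show ?thesis using y(1) by blast
  qed
  then show ?thesis unfolding fin_gen_def using F(1,2) by blast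
qed

lemma b1_eq: "b1 \<Omega> e \<tau> = - L2_ip \<Omega> \<tau> (fst e)"
  by (simp add: b1_def L2_ip_def)

lemma b2_eq: "b2 \<Omega> s v = - L2_ip \<Omega> v (weak_div \<Omega> (snd s))"
  by (simp add: b2_def L2_ip_def)

lemma F_fun_eq: "F_fun \<Omega> f v = L2_ip \<Omega> f v"
  by (simp add: F_fun_def L2_ip_def)

lemma G_fun_eq: "G_fun \<Omega> g r e = L2_ip \<Omega> g (snd e) + r (bdry_trace \<Omega> (snd e))"
  by (simp add: G_fun_def L2_ip_def)

lemma a_lin_eq:
  "a_lin \<Omega> lam mu \<alpha> c0 \<kappa> w d e =
    L2_ip \<Omega> (\<lambda>x. elast lam mu (fst d x)) (fst e) +
    L2_ip \<Omega> (\<lambda>x. \<kappa> (fst w) (snd w) x *v weak_grad \<Omega> (snd d) x) (weak_grad \<Omega> (snd e)) +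
    c0 * L2_ip \<Omega> (snd d) (snd e) + \<alpha> * L2_ip \<Omega> (snd e) (\<lambda>x. trace (fst d x)) -
    \<alpha> * L2_ip \<Omega> (snd d) (\<lambda>x. trace (fst e x))"
  by (simp add: a_lin_def L2_ip_def)

text \<open>Everything follows from \<open>\<gamma>\<^sub>1 \<ge> \<gamma>\<^sub>2 / \<beta>\<^sup>2\<close>, \<open>\<gamma>\<^sub>2 \<ge> 2\<close> and
  \<open>c \<gamma>\<^sub>2 = (C + 2) c + (C + 2) (C + 1) \<ge> 2 C + 2\<close>.  The second claim is the condition under which \<open>\<gamma> N\<close> dominates the solutions of
  the quadratic inequality of the a priori estimate.\<close>

lemma gamma_facts:
  fixes C c \<beta> :: real
  assumes "0 < c" "0 \<le> C" "0 < \<beta>" "\<beta> \<le> 1"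
  defines "\<gamma> \<equiv> gamma1 C c \<beta>"
  shows "0 < \<gamma>" "(2 * C + 1 / \<beta>) * \<gamma> + 2 / \<beta> \<le> c * \<gamma>\<^sup>2"
proof -
  define g2 where "g2 = gamma2 C c"
  have cg2: "c * g2 = (C + 2) * c + (C + 2) * (C + 1)"
  proof -
    have "c * g2 = (C + 2) * (c + 1 + C)" using assms(1) by (simp add: g2_def gamma2_def)
    then show ?thesis by (simp add: algebra_simps)
  qed
  have "g2 = (C + 2) + (C + 2) * (C + 1) / c"
    using cg2 assms(1) by (simp add: field_simps)
  moreover have "(C + 2) * (C + 1) / c \<ge> 0" using assms by auto
  ultimately have g2: "g2 \<ge> 2" using assms(2) by linarith
  have s: "0 \<le> C + 1 + \<beta>" using assms by simp
  have "g2\<^sup>2 \<le> (C + 1 + \<beta> + g2)\<^sup>2" using s g2 by (intro power_mono) auto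
  then have "g2\<^sup>2 / (\<beta>\<^sup>2 * g2) \<le> \<gamma>"
    unfolding \<gamma>_def gamma1_def g2_def[symmetric] using g2 by (intro divide_right_mono) auto
  then have \<gamma>: "g2 / \<beta>\<^sup>2 \<le> \<gamma>" using g2 by (simp add: power2_eq_square)
  have "0 < g2 / \<beta>\<^sup>2" using g2 assms by simp
  then show pos: "0 < \<gamma>" using \<gamma> by linarith
  have b: "1 \<le> 1 / \<beta>" using assms(3,4) by simp
  have bb: "1 / \<beta> \<le> 1 / \<beta>\<^sup>2" "1 \<le> 1 / \<beta>\<^sup>2"
    using mult_mono[OF b b] b mult_left_mono[OF b, of "1 / \<beta>"] assms(3) by (auto simp: power2_eq_square)
  have ge2: "2 / \<beta> \<le> \<gamma>"
  proof -
    have "2 * (1 / \<beta>) \<le> g2 * (1 / \<beta>\<^sup>2)" using g2 bb assms(3) by (intro mult_mono) auto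
    then show ?thesis using \<gamma> by simp
  qed
  have "2 * C + 1 / \<beta> + 1 \<le> c * \<gamma>"
  proof -
    have "2 * C + 1 / \<beta> + 1 \<le> (2 * C + 2) * (1 / \<beta>\<^sup>2)"
    proof -
      have "(2 * C + 1) * 1 \<le> (2 * C + 1) * (1 / \<beta>\<^sup>2)"
        using assms(2) by (intro mult_left_mono bb) auto
      moreover have "(2 * C + 2) * (1 / \<beta>\<^sup>2) = (2 * C + 1) * (1 / \<beta>\<^sup>2) + 1 / \<beta>\<^sup>2"
        by (simp add: distrib_right add_divide_distrib)
      moreover have "2 * C + 1 / \<beta> + 1 = (2 * C + 1) * 1 + 1 / \<beta>" by simp
      ultimately show ?thesis using bb(1) by (metis add_mono)
    qed
    also have "\<dots> \<le> (c * g2) * (1 / \<beta>\<^sup>2)"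
    proof (rule mult_right_mono)
      have "(C + 2) * (C + 1) \<ge> 2 * C + 2" using assms(2) by (simp add: algebra_simps)
      moreover have "(C + 2) * c \<ge> 0" using assms by simp
      ultimately show "2 * C + 2 \<le> c * g2" using cg2 by linarith
    qed auto
    also have "\<dots> = c * (g2 / \<beta>\<^sup>2)" by simp
    also have "\<dots> \<le> c * \<gamma>" using \<gamma> assms(1) by (intro mult_left_mono) auto
    finally show ?thesis .
  qed
  then have "(2 * C + 1 / \<beta> + 1) * \<gamma> \<le> (c * \<gamma>) * \<gamma>" using pos by (intro mult_right_mono) auto
  then show "(2 * C + 1 / \<beta>) * \<gamma> + 2 / \<beta> \<le> c * \<gamma>\<^sup>2"
    using ge2 by (simp add: power2_eq_square algebra_simps)
qed

text \<open>If \<open>D > \<gamma> N\<close>, then replacing \<open>N\<close> by \<open>D / \<gamma>\<close> on the right-hand side contradicts the assumption on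
  \<open>\<gamma>\<close>.\<close>

lemma quadratic_bound:
  fixes D N c A B \<gamma> :: real
  assumes "0 \<le> D" "0 \<le> N" "0 < \<gamma>" "0 \<le> A" "0 < B" "A * \<gamma> + B \<le> c * \<gamma>\<^sup>2"
    and quad: "c * D\<^sup>2 \<le> A * N * D + B * N\<^sup>2"
  shows "D \<le> \<gamma> * N"
proof (rule ccontr)
  assume "\<not> D \<le> \<gamma> * N"
  then have lt: "\<gamma> * N < D" by simp
  then have D: "0 < D" using assms(2,3) by (smt (verit) mult_nonneg_nonneg)
  have 1: "A * N * D * \<gamma>\<^sup>2 \<le> A * \<gamma> * D\<^sup>2"
    using mult_left_mono[OF less_imp_le[OF lt], of "A * D * \<gamma>"] assms(3,4) D
    by (simp add: power2_eq_square mult_ac)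
  have "(\<gamma> * N)\<^sup>2 < D\<^sup>2" using lt assms(2,3) by (intro power_strict_mono) auto
  then have "B * (\<gamma> * N)\<^sup>2 < B * D\<^sup>2" using assms(5) by simp
  moreover have "(A * \<gamma> + B) * D\<^sup>2 \<le> c * \<gamma>\<^sup>2 * D\<^sup>2" using assms(6) by (intro mult_right_mono) auto
  moreover have "c * D\<^sup>2 * \<gamma>\<^sup>2 \<le> (A * N * D + B * N\<^sup>2) * \<gamma>\<^sup>2" using quad by (intro mult_right_mono) auto
  ultimately show False using 1 by (simp add: power_mult_distrib algebra_simps)
qed

context mesh
begin

lemma X_comps:
  assumes "d \<in> X"
  shows "fst d \<in> L2 \<Omega>" "snd d \<in> H1 \<Omega>" "snd d \<in> L2 \<Omega>" "weak_grad \<Omega> (snd d) \<in> L2 \<Omega>"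
  using X_parts[OF assms] X1_L2 X2_H1 H1_L2 weak_grad(1) by blast+

lemma Y_comps: "\<tau> \<in> Y \<Longrightarrow> \<tau> \<in> L2 \<Omega>" "\<tau> \<in> Y \<Longrightarrow> weak_div \<Omega> \<tau> \<in> L2 \<Omega>"
  using Y_div_domain div_domain_L2 weak_div(1) by blast+

lemma Z_L2: "v \<in> Z \<Longrightarrow> v \<in> L2 \<Omega>"
  by (simp add: Zh_def)

lemma ae_lin_fst: "ae_lin \<Omega> X fst" and ae_lin_snd: "ae_lin \<Omega> X snd"
  and ae_lin_grad: "ae_lin \<Omega> X (\<lambda>d. weak_grad \<Omega> (snd d))"
  using ae_lin_compose[OF ae_lin_id, of X fst] ae_lin_compose[OF ae_lin_id, of X snd]
    ae_lin_compose[OF ae_lin_weak_grad, of X snd] X_comps by simp_all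

lemma ae_lin_Y: "ae_lin \<Omega> Y (\<lambda>\<tau>. \<tau>)" and ae_lin_div: "ae_lin \<Omega> Y (weak_div \<Omega>)"
  and ae_lin_Z: "ae_lin \<Omega> Z (\<lambda>v. v)"
proof -
  show "ae_lin \<Omega> Y (\<lambda>\<tau>. \<tau>)" using Y_comps(1) by (intro ae_lin_incl subsetI)
  show "ae_lin \<Omega> Z (\<lambda>v. v)" using Z_L2 by (intro ae_lin_incl subsetI)
  show "ae_lin \<Omega> Y (weak_div \<Omega>)"
    using ae_lin_compose[OF ae_lin_weak_div, of Y "\<lambda>\<tau>. \<tau>"] Y_div_domain by simp
qed

definition X_ip :: "xfield \<Rightarrow> xfield \<Rightarrow> real" where
  "X_ip d e = L2_ip \<Omega> (fst d) (fst e) +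
    (L2_ip \<Omega> (snd d) (snd e) + L2_ip \<Omega> (weak_grad \<Omega> (snd d)) (weak_grad \<Omega> (snd e)))"

lemma semi_inner_X: "semi_inner X X_ip"
  unfolding X_ip_def[abs_def]
  by (intro semi_inner_add semi_inner_ae_lin ae_lin_fst ae_lin_snd ae_lin_grad subspace_X)

lemma X_ip_self: "X_ip d d = (X_norm \<Omega> d)\<^sup>2"
  by (simp add: X_ip_def L2_ip_square X_norm_def H1_norm_def)

lemma X_norm_nonneg [simp]: "0 \<le> X_norm \<Omega> d" and Y_norm_nonneg [simp]: "0 \<le> Y_norm \<Omega> \<tau>"
  and XY_norm_nonneg [simp]: "0 \<le> XY_norm \<Omega> s" and XYZ_norm_nonneg [simp]: "0 \<le> XYZ_norm \<Omega> t"
  by (simp_all add: X_norm_def Y_norm_def XY_norm_def XYZ_norm_def)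

lemma sn_X_ip: "semi_inner.sn X_ip = X_norm \<Omega>"
  by (simp add: fun_eq_iff semi_inner.sn_def[OF semi_inner_X] X_ip_self)

sublocale XS: semi_inner X X_ip
  rewrites "semi_inner.sn X_ip = X_norm \<Omega>"
  by (rule semi_inner_X, rule sn_X_ip)

definition S :: "((xfield \<times> tensor_field) \<times> vector_field) set" where
  "S = (X \<times> Y) \<times> Z"

lemma subspace_S: "subspace S"
  unfolding S_def by (intro subspace_product subspace_X subspace_Y subspace_Z)

text \<open>The polarised squared norm of the product space: one summand for each of the six \<open>L\<^sup>2\<close>-valued
  maps that the norm measures.\<close>

definition S_ip :: "(xfield \<times> tensor_field) \<times> vector_field \<Rightarrow> (xfield \<times> tensor_field) \<times> vector_field \<Rightarrow> real" where
  "S_ip s t = ((L2_ip \<Omega> (fst (fst (fst s))) (fst (fst (fst t))) +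
      (L2_ip \<Omega> (snd (fst (fst s))) (snd (fst (fst t))) +
       L2_ip \<Omega> (weak_grad \<Omega> (snd (fst (fst s)))) (weak_grad \<Omega> (snd (fst (fst t)))))) +
     (L2_ip \<Omega> (snd (fst s)) (snd (fst t)) +
      L2_ip \<Omega> (weak_div \<Omega> (snd (fst s))) (weak_div \<Omega> (snd (fst t))))) +
     L2_ip \<Omega> (snd s) (snd t)"

lemma S_parts: "s \<in> S \<longleftrightarrow> fst (fst s) \<in> X \<and> snd (fst s) \<in> Y \<and> snd s \<in> Z"
  by (auto simp: S_def mem_Times_iff)

lemma semi_inner_S: "semi_inner S S_ip"
  unfolding S_ip_def[abs_def]
  by (intro semi_inner_add semi_inner_ae_lin subspace_S
      ae_lin_compose[OF ae_lin_fst, of S "\<lambda>s. fst (fst s)"] ae_lin_compose[OF ae_lin_snd, of S "\<lambda>s. fst (fst s)"]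
      ae_lin_compose[OF ae_lin_grad, of S "\<lambda>s. fst (fst s)"] ae_lin_compose[OF ae_lin_Y, of S "\<lambda>s. snd (fst s)"]
      ae_lin_compose[OF ae_lin_div, of S "\<lambda>s. snd (fst s)"] ae_lin_compose[OF ae_lin_Z, of S snd])
    (auto simp: S_parts)

lemma S_ip_self: "S_ip s s = (XYZ_norm \<Omega> s)\<^sup>2"
  by (simp add: S_ip_def L2_ip_square XYZ_norm_def XY_norm_def X_norm_def Y_norm_def Z_norm_def H1_norm_def)

lemma sn_S_ip: "semi_inner.sn S_ip = XYZ_norm \<Omega>"
  by (simp add: fun_eq_iff semi_inner.sn_def[OF semi_inner_S] S_ip_self)

sublocale SS: semi_inner S S_ip
  rewrites "semi_inner.sn S_ip = XYZ_norm \<Omega>"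
  by (rule semi_inner_S, rule sn_S_ip)

lemma L2_norm_ae_zero: "f \<in> L2 \<Omega> \<Longrightarrow> f \<in> ae_zero \<Omega> \<Longrightarrow> L2_norm \<Omega> f = 0"
  by (simp add: L2_norm_eq_0_iff ae_zero_def)

lemma H1_norm_ae_zero:
  assumes "q \<in> H1 \<Omega>" "q \<in> ae_zero \<Omega>"
  shows "H1_norm \<Omega> q = 0"
proof -
  have "ae_eq \<Omega> (weak_grad \<Omega> q) (weak_grad \<Omega> 0)"
    using weak_grad_ae_cong[OF assms(1) H1_zero] assms(2) by (simp add: ae_zero_def)
  then have "ae_eq \<Omega> (weak_grad \<Omega> q) 0"
    using ae_lin_zero[OF ae_lin_weak_grad subspace_H1] ae_eq_trans by blast
  then show ?thesis
    using L2_norm_ae_zero[OF H1_L2[OF assms(1)] assms(2)] L2_norm_eq_0_iff[OF weak_grad(1)[OF assms(1)]]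
    by (simp add: H1_norm_def)
qed

lemma X_norm_eq_0_iff:
  assumes "d \<in> X"
  shows "X_norm \<Omega> d = 0 \<longleftrightarrow> fst d \<in> ae_zero \<Omega> \<and> snd d \<in> ae_zero \<Omega>"
proof -
  have "X_norm \<Omega> d = 0 \<longleftrightarrow> L2_norm \<Omega> (fst d) = 0 \<and> H1_norm \<Omega> (snd d) = 0"
    by (simp add: X_norm_def real_sqrt_eq_0_iff add_nonneg_eq_0_iff)
  also have "L2_norm \<Omega> (fst d) = 0 \<longleftrightarrow> fst d \<in> ae_zero \<Omega>"
    using L2_norm_eq_0_iff[OF X_comps(1)[OF assms]] by (simp add: ae_zero_def)
  also have "H1_norm \<Omega> (snd d) = 0 \<longleftrightarrow> snd d \<in> ae_zero \<Omega>"
  proof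
    assume "H1_norm \<Omega> (snd d) = 0"
    then have "L2_norm \<Omega> (snd d) = 0"
      using L2_norm_le_H1_norm(1)[of "snd d"] L2_norm_nonneg[of \<Omega> "snd d"] by linarith
    then show "snd d \<in> ae_zero \<Omega>"
      using L2_norm_eq_0_iff[OF X_comps(3)[OF assms]] by (simp add: ae_zero_def)
  qed (rule H1_norm_ae_zero[OF X_comps(2)[OF assms]])
  finally show ?thesis .
qed

lemma Y_norm_eq_0_iff:
  assumes "\<tau> \<in> Y"
  shows "Y_norm \<Omega> \<tau> = 0 \<longleftrightarrow> \<tau> \<in> ae_zero \<Omega>"
proof
  assume "Y_norm \<Omega> \<tau> = 0"
  then have "L2_norm \<Omega> \<tau> = 0" by (simp add: Y_norm_def add_nonneg_eq_0_iff)
  then show "\<tau> \<in> ae_zero \<Omega>" using L2_norm_eq_0_iff[OF Y_comps(1)[OF assms]] by (simp add: ae_zero_def)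
next
  assume z: "\<tau> \<in> ae_zero \<Omega>"
  have "has_weak_div \<Omega> \<tau> 0"
    unfolding has_weak_div_def
  proof (intro ballI allI)
    fix \<phi> i assume \<phi>: "\<phi> \<in> test_functions \<Omega>"
    have "ae_eq \<Omega> (\<lambda>x. \<tau> x $ i) 0"
      using z unfolding ae_zero_def ae_eq_def by (auto elim!: eventually_mono)
    then have "L2_ip \<Omega> (\<lambda>x. \<tau> x $ i) (\<lambda>x. \<chi> j. partial_deriv j \<phi> x) = L2_ip \<Omega> 0 (\<lambda>x. \<chi> j. partial_deriv j \<phi> x)"
      by (rule L2_ip_ae_cong[OF L2_comp[OF Y_comps(1)[OF assms]] subspace_0[OF subspace_L2] L2_test_grad[OF \<phi>]])
    then show "(LINT x|lebesgue_on \<Omega>. \<tau> x $ i \<bullet> (\<chi> j. partial_deriv j \<phi> x)) = - (LINT x|lebesgue_on \<Omega>. 0 x $ i * \<phi> x)"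
      by (simp add: L2_ip_def)
  qed
  then have "ae_eq \<Omega> (weak_div \<Omega> \<tau>) 0"
    by (rule weak_div_eqI[OF Y_comps(1)[OF assms] subspace_0[OF subspace_L2]])
  then show "Y_norm \<Omega> \<tau> = 0"
    using L2_norm_eq_0_iff[OF Y_comps(2)[OF assms]] L2_norm_ae_zero[OF Y_comps(1)[OF assms] z]
    by (simp add: Y_norm_def)
qed

lemma XYZ_norm_eq_0_iff:
  assumes "s \<in> S"
  shows "XYZ_norm \<Omega> s = 0 \<longleftrightarrow> s \<in> ((ae_zero \<Omega> \<times> ae_zero \<Omega>) \<times> ae_zero \<Omega>) \<times> ae_zero \<Omega>"
proof -
  have "XYZ_norm \<Omega> s = 0 \<longleftrightarrow> X_norm \<Omega> (fst (fst s)) = 0 \<and> Y_norm \<Omega> (snd (fst s)) = 0 \<and> Z_norm \<Omega> (snd s) = 0"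
    by (simp add: XYZ_norm_def XY_norm_def add_nonneg_eq_0_iff conj_assoc)
  also have "\<dots> \<longleftrightarrow> s \<in> ((ae_zero \<Omega> \<times> ae_zero \<Omega>) \<times> ae_zero \<Omega>) \<times> ae_zero \<Omega>"
    using assms X_norm_eq_0_iff Y_norm_eq_0_iff L2_norm_eq_0_iff[OF Z_L2]
    by (simp add: S_parts mem_Times_iff ae_zero_def Z_norm_def conj_assoc)
  finally show ?thesis .
qed

lemma XYZ_eq_iff:
  assumes "s \<in> S" "t \<in> S"
  shows "XYZ_eq \<Omega> s t \<longleftrightarrow> XYZ_norm \<Omega> (s - t) = 0"
  using XYZ_norm_eq_0_iff[OF subspace_diff[OF subspace_S assms]]
  by (simp add: XYZ_eq_def X_eq_def mem_Times_iff ae_zero_def ae_eq_diff_0_iff conj_assoc)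

lemma X_eq_iff:
  assumes "d \<in> X" "e \<in> X"
  shows "X_eq \<Omega> d e \<longleftrightarrow> X_norm \<Omega> (d - e) = 0"
  using X_norm_eq_0_iff[OF subspace_diff[OF subspace_X assms]]
  by (simp add: X_eq_def ae_zero_def ae_eq_diff_0_iff)

lemma fin_gen_X: "fin_gen X XS.null"
proof (rule semi_inner_fin_gen[OF semi_inner_X])
  show "subspace ((ae_zero \<Omega> :: tensor_field set) \<times> (ae_zero \<Omega> :: scalar_field set))"
    by (intro subspace_product subspace_ae_zero)
  show "finite_mod X (ae_zero \<Omega> \<times> ae_zero \<Omega>)"
    unfolding Xh_def by (intro finite_mod_Times finite_X1 finite_X2)
  show "X_ip x x = 0" if "x \<in> X" "x \<in> ae_zero \<Omega> \<times> ae_zero \<Omega>" for x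
    using that X_norm_eq_0_iff by (auto simp: X_ip_self)
qed

lemma fin_gen_S: "fin_gen S SS.null"
proof (rule semi_inner_fin_gen[OF semi_inner_S])
  show "subspace ((((ae_zero \<Omega> :: tensor_field set) \<times> (ae_zero \<Omega> :: scalar_field set)) \<times>
      (ae_zero \<Omega> :: tensor_field set)) \<times> (ae_zero \<Omega> :: vector_field set))"
    by (intro subspace_product subspace_ae_zero)
  show "finite_mod S (((ae_zero \<Omega> \<times> ae_zero \<Omega>) \<times> ae_zero \<Omega>) \<times> ae_zero \<Omega>)"
    unfolding S_def Xh_def by (intro finite_mod_Times finite_X1 finite_X2 finite_Y finite_Z)
  show "S_ip x x = 0" if "x \<in> S" "x \<in> ((ae_zero \<Omega> \<times> ae_zero \<Omega>) \<times> ae_zero \<Omega>) \<times> ae_zero \<Omega>" for x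
    using that XYZ_norm_eq_0_iff by (auto simp: S_ip_self)
qed

lemma X_norm_ge: "L2_norm \<Omega> (fst d) \<le> X_norm \<Omega> d" "H1_norm \<Omega> (snd d) \<le> X_norm \<Omega> d"
  by (auto simp: X_norm_def intro!: real_le_rsqrt)

lemma X_norm_ge': "L2_norm \<Omega> (snd d) \<le> X_norm \<Omega> d"
  using X_norm_ge(2)[of d] L2_norm_le_H1_norm(1)[of "snd d"] by linarith

lemma Y_norm_ge: "L2_norm \<Omega> \<tau> \<le> Y_norm \<Omega> \<tau>" "L2_norm \<Omega> (weak_div \<Omega> \<tau>) \<le> Y_norm \<Omega> \<tau>"
  by (auto simp: Y_norm_def intro!: real_le_rsqrt)

lemma XY_norm_ge: "X_norm \<Omega> (fst s) \<le> XY_norm \<Omega> s" "Y_norm \<Omega> (snd s) \<le> XY_norm \<Omega> s"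
  by (auto simp: XY_norm_def intro!: real_le_rsqrt)

lemma Y_norm_le: "Y_norm \<Omega> \<tau> \<le> L2_norm \<Omega> \<tau> + L2_norm \<Omega> (weak_div \<Omega> \<tau>)"
  unfolding Y_norm_def by (intro sqrt_sum_squares_le_sum) auto

lemma XYZ_norm_le: "XYZ_norm \<Omega> s \<le> X_norm \<Omega> (fst (fst s)) + Y_norm \<Omega> (snd (fst s)) + Z_norm \<Omega> (snd s)"
proof -
  have "XY_norm \<Omega> (fst s) \<le> X_norm \<Omega> (fst (fst s)) + Y_norm \<Omega> (snd (fst s))"
    unfolding XY_norm_def by (intro sqrt_sum_squares_le_sum) auto
  moreover have "XYZ_norm \<Omega> s \<le> XY_norm \<Omega> (fst s) + Z_norm \<Omega> (snd s)"
    unfolding XYZ_norm_def by (intro sqrt_sum_squares_le_sum) (auto simp: Z_norm_def)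
  ultimately show ?thesis by linarith
qed

lemma L2_norm_const_nonzero: "L2_norm \<Omega> (\<lambda>x. a) \<noteq> 0" if "a \<noteq> 0" for a :: "'a::euclidean_space"
proof
  assume 0: "L2_norm \<Omega> (\<lambda>x. a) = 0"
  have "(\<lambda>x. a) \<in> L2 \<Omega>" by (intro L2_bounded[OF bounded_domain domain_sets, where C = "norm a"]) auto
  then have "ae_eq \<Omega> (\<lambda>x. a) 0" using 0 by (simp add: L2_norm_eq_0_iff)
  then have "AE x in lebesgue. x \<notin> \<Omega>"
    using that domain_sets by (simp add: ae_eq_def AE_restrict_space_iff)
  then have "\<Omega> \<in> null_sets lebesgue" using domain_sets by (simp add: AE_iff_null_sets)
  then have "negligible \<Omega>" by (simp add: negligible_iff_null_sets)
  then show False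
    using open_not_negligible[OF open_domain] lipschitz by (auto simp: lipschitz_domain_def)
qed

lemma const_X2: "(\<lambda>x. 1) \<in> X2"
  using polys_const[of "1::real" "k + 1"] by (auto simp: X2h_def)

lemma const_Z: "(\<lambda>x. a) \<in> Z"
proof -
  have "(\<lambda>x. a) \<in> L2 \<Omega>" by (intro L2_bounded[OF bounded_domain domain_sets, where C = "norm a"]) auto
  then show ?thesis using polys_const[of a k] by (auto simp: Zh_def poly_on_def intro!: bexI[of _ "\<lambda>x. a"])
qed

text \<open>The supremum runs over a nonempty set, because the constant pressure has nonzero norm.\<close>

lemma inf_sup_use:
  assumes inf_sup: "discrete_inf_sup \<Omega> T k \<beta>" and v: "v \<in> Z"
    and le: "\<And>e \<tau>. e \<in> X \<Longrightarrow> \<tau> \<in> Y \<Longrightarrow> b2 \<Omega> (e, \<tau>) v \<le> M * XY_norm \<Omega> (e, \<tau>)"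
  shows "\<beta> * Z_norm \<Omega> v \<le> M"
proof -
  let ?A = "{s \<in> X \<times> Y. XY_norm \<Omega> s \<noteq> 0}"
  have "\<beta> * Z_norm \<Omega> v \<le> (SUP s\<in>?A. b2 \<Omega> s v / XY_norm \<Omega> s)"
    using inf_sup v by (simp add: discrete_inf_sup_def)
  also have "\<dots> \<le> M"
  proof (rule cSUP_least)
    have e: "(0, \<lambda>x. 1) \<in> X" using const_X2 subspace_0[OF subspace_X1] by (simp add: Xh_def)
    have "L2_norm \<Omega> (\<lambda>x. 1::real) \<le> XY_norm \<Omega> ((0, \<lambda>x. 1), 0)"
      using X_norm_ge'[of "(0, \<lambda>x. 1)"] XY_norm_ge(1)[of "((0, \<lambda>x. 1), 0)"] by simp
    then have "XY_norm \<Omega> ((0, \<lambda>x. 1), 0) \<noteq> 0"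
      using L2_norm_const_nonzero[of "1::real"] L2_norm_nonneg[of \<Omega> "\<lambda>x. 1::real"] by fastforce
    then have "((0, \<lambda>x. 1), 0) \<in> ?A" using e subspace_0[OF subspace_Y] by simp
    then show "?A \<noteq> {}" by blast
    show "b2 \<Omega> s v / XY_norm \<Omega> s \<le> M" if "s \<in> ?A" for s
    proof -
      have "0 < XY_norm \<Omega> s" using that XY_norm_nonneg[of s] by (simp add: less_le)
      then show ?thesis using le[of "fst s" "snd s"] that by (auto simp: divide_le_eq mem_Times_iff)
    qed
  qed
  finally show ?thesis .
qed

text \<open>The norm of \<open>b\<^sub>2\<close> is at most one, and the discrete displacement space contains a nonzero
  constant.\<close>

lemma inf_sup_le_1:
  assumes "discrete_inf_sup \<Omega> T k \<beta>"
  shows "\<beta> \<le> 1"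
proof -
  let ?v = "\<lambda>x::real^2. (axis 1 1 :: real^2)"
  have v: "?v \<in> Z" by (rule const_Z)
  have "\<beta> * Z_norm \<Omega> ?v \<le> Z_norm \<Omega> ?v"
  proof (rule inf_sup_use[OF assms v])
    fix e \<tau> assume "e \<in> X" "\<tau> \<in> Y"
    have "\<bar>L2_ip \<Omega> ?v (weak_div \<Omega> \<tau>)\<bar> \<le> L2_norm \<Omega> ?v * L2_norm \<Omega> (weak_div \<Omega> \<tau>)"
      by (rule L2.cauchy_schwarz[OF Z_L2[OF v] Y_comps(2)[OF \<open>\<tau> \<in> Y\<close>]])
    also have "\<dots> \<le> L2_norm \<Omega> ?v * XY_norm \<Omega> (e, \<tau>)"
      using Y_norm_ge(2)[of \<tau>] XY_norm_ge(2)[of "(e, \<tau>)"] by (intro mult_left_mono) auto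
    finally show "b2 \<Omega> (e, \<tau>) ?v \<le> Z_norm \<Omega> ?v * XY_norm \<Omega> (e, \<tau>)"
      by (simp add: b2_eq Z_norm_def)
  qed
  moreover have "0 < Z_norm \<Omega> ?v"
    using L2_norm_const_nonzero[of "axis 1 1 :: real^2"] by (simp add: Z_norm_def less_le)
  ultimately show ?thesis by simp
qed

end

section \<open>The linearised discrete problem\<close>

locale mixed_problem = mesh \<Omega> T k for \<Omega> T k +
  fixes lam mu \<alpha> c0 \<kappa>1 \<kappa>2 \<beta> r :: real and \<kappa> :: perm
  assumes par: "lam > 0" "mu > 0" "0 \<le> \<alpha>" "\<alpha> \<le> 1" "c0 > 0"
    and perm: "\<kappa>1 > 0" "\<kappa>2 > 0" "permeability \<Omega> \<kappa>1 \<kappa>2 \<kappa>"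
    and beta: "\<beta> > 0" and r: "r > 0"
    and inf_sup: "discrete_inf_sup \<Omega> T k \<beta>"
begin

definition "C = Ca lam mu \<alpha> c0 \<kappa>2 r"
definition "c = ca mu c0 \<kappa>1"
definition "\<gamma> = gamma1 C c \<beta>"

abbreviation "a \<equiv> a_lin \<Omega> lam mu \<alpha> c0 \<kappa>"

lemma C_ge: "2 * mu + 2 * lam \<le> C" "2 * \<alpha> \<le> C"
  by (simp_all add: C_def Ca_def)

lemma c_le: "c \<le> \<kappa>1" "c \<le> 2 * mu" "c \<le> c0" and c_pos: "0 < c"
  using par perm by (simp_all add: c_def ca_def)

lemma C_nonneg: "0 \<le> C"
  using C_ge(1) par by linarith

lemma gamma_pos: "0 < \<gamma>" and gamma_quad: "(2 * C + 1 / \<beta>) * \<gamma> + 2 / \<beta> \<le> c * \<gamma>\<^sup>2"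
  unfolding \<gamma>_def using gamma_facts[OF c_pos C_nonneg beta inf_sup_le_1[OF inf_sup]] by simp_all

lemma kappa_Linf: "w \<in> X \<Longrightarrow> \<kappa> (fst w) (snd w) \<in> Linf \<Omega>"
  and kappa_elliptic: "w \<in> X \<Longrightarrow>
    AE x in lebesgue_on \<Omega>. \<forall>v. v \<noteq> 0 \<longrightarrow> \<kappa>1 * (norm v)\<^sup>2 \<le> v \<bullet> (\<kappa> (fst w) (snd w) x *v v)"
proof -
  assume "w \<in> X"
  then have "(fst w, snd w) \<in> X_space \<Omega>" using X_X_space by simp
  then show "\<kappa> (fst w) (snd w) \<in> Linf \<Omega>"
    "AE x in lebesgue_on \<Omega>. \<forall>v. v \<noteq> 0 \<longrightarrow> \<kappa>1 * (norm v)\<^sup>2 \<le> v \<bullet> (\<kappa> (fst w) (snd w) x *v v)"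
    using perm(3) unfolding permeability_def by blast+
qed

lemma kappa_lipschitz:
  assumes "w \<in> X" "w' \<in> X"
  shows "Linf_norm \<Omega> (\<lambda>x. \<kappa> (fst w) (snd w) x - \<kappa> (fst w') (snd w') x) \<le> \<kappa>2 * X_norm \<Omega> (w - w')"
proof -
  have "(fst w, snd w) \<in> X_space \<Omega>" "(fst w', snd w') \<in> X_space \<Omega>" using assms X_X_space by simp_all
  then have "Linf_norm \<Omega> (\<lambda>x. \<kappa> (fst w) (snd w) x - \<kappa> (fst w') (snd w') x)
      \<le> \<kappa>2 * H1_norm \<Omega> (\<lambda>x. snd w x - snd w' x)"
    using perm(3) unfolding permeability_def by blast
  also have "(\<lambda>x. snd w x - snd w' x) = snd (w - w')" by auto
  also have "\<kappa>2 * H1_norm \<Omega> (snd (w - w')) \<le> \<kappa>2 * X_norm \<Omega> (w - w')"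
    using perm(2) by (intro mult_left_mono X_norm_ge(2)) simp
  finally show ?thesis .
qed

lemma ae_lin_elast: "ae_lin \<Omega> X (\<lambda>d x. elast lam mu (fst d x))"
  by (rule ae_lin_pointwise[OF ae_lin_fst, where T = "\<lambda>x. elast lam mu"])
    (auto intro: L2_elast X_comps linearI simp: elast_add elast_scaleR)

lemma ae_lin_trace: "ae_lin \<Omega> X (\<lambda>d x. trace (fst d x))"
  by (rule ae_lin_pointwise[OF ae_lin_fst, where T = "\<lambda>x. trace"])
    (auto intro: L2_trace X_comps linearI simp: trace_add' trace_scaleR')

lemma ae_lin_flux:
  fixes A :: tensor_field
  assumes "A \<in> Linf \<Omega>"
  shows "ae_lin \<Omega> X (\<lambda>d x. A x *v weak_grad \<Omega> (snd d) x)"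
proof (rule ae_lin_pointwise[OF ae_lin_grad, where T = "\<lambda>x v. A x *v v"])
  show "(\<lambda>x. A x *v weak_grad \<Omega> (snd d) x) \<in> L2 \<Omega>" if "d \<in> X" for d
    using L2_Linf_mult[OF assms X_comps(4)[OF that]] .
qed (rule matrix_vector_mul_linear)

lemma a_lin_right:
  assumes "w \<in> X" "d \<in> X"
  shows "lin_on X (a w d)"
  unfolding a_lin_eq[abs_def]
  using X_comps[OF assms(2)] ae_linD(1)[OF ae_lin_elast assms(2)] ae_linD(1)[OF ae_lin_trace assms(2)]
    ae_linD(1)[OF ae_lin_flux[OF kappa_Linf[OF assms(1)]] assms(2)]
  by (intro lin_on_plus lin_on_minus lin_on_cmult lin_on_L2_ip subspace_X
      ae_lin_fst ae_lin_snd ae_lin_grad ae_lin_trace)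

lemma a_lin_left:
  assumes "w \<in> X" "e \<in> X"
  shows "lin_on X (\<lambda>d. a w d e)"
  unfolding a_lin_eq
  using X_comps[OF assms(2)] ae_linD(1)[OF ae_lin_trace assms(2)]
  by (intro lin_on_plus lin_on_minus lin_on_cmult lin_on_L2_ip subspace_X
      ae_lin_fst ae_lin_snd ae_lin_grad ae_lin_trace ae_lin_elast ae_lin_flux kappa_Linf[OF assms(1)])

text \<open>The two coupling terms cancel on the diagonal.\<close>

lemma coercive:
  assumes w: "w \<in> X" and d: "d \<in> X"
  shows "c * (X_norm \<Omega> d)\<^sup>2 \<le> a w d d"
proof -
  note L = X_comps[OF d]
  let ?K = "\<lambda>x. \<kappa> (fst w) (snd w) x *v weak_grad \<Omega> (snd d) x"
  have "2 * mu * (L2_norm \<Omega> (fst d))\<^sup>2 \<le> L2_ip \<Omega> (\<lambda>x. elast lam mu (fst d x)) (fst d)"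
  proof -
    have "(LINT x|lebesgue_on \<Omega>. 2 * mu * (norm (fst d x))\<^sup>2) \<le> (LINT x|lebesgue_on \<Omega>. elast lam mu (fst d x) \<bullet> fst d x)"
    proof (rule integral_mono)
      show "integrable (lebesgue_on \<Omega>) (\<lambda>x. elast lam mu (fst d x) \<bullet> fst d x)"
        by (rule L2_inner_integrable[OF L2_elast[OF L(1)] L(1)])
      show "integrable (lebesgue_on \<Omega>) (\<lambda>x. 2 * mu * (norm (fst d x))\<^sup>2)"
        using L2_integrable_square[OF L(1)] by simp
      show "2 * mu * (norm (fst d x))\<^sup>2 \<le> elast lam mu (fst d x) \<bullet> fst d x" for x
      proof -
        have "0 \<le> lam * (trace (fst d x) * trace (fst d x))" using par by simp
        then show ?thesis by (simp add: elast_inner dot_square_norm mult.assoc)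
      qed
    qed
    then show ?thesis by (simp add: L2_norm_square L2_ip_def)
  qed
  moreover have "\<kappa>1 * (L2_norm \<Omega> (weak_grad \<Omega> (snd d)))\<^sup>2 \<le> L2_ip \<Omega> ?K (weak_grad \<Omega> (snd d))"
  proof -
    have "(LINT x|lebesgue_on \<Omega>. \<kappa>1 * (norm (weak_grad \<Omega> (snd d) x))\<^sup>2) \<le>
        (LINT x|lebesgue_on \<Omega>. ?K x \<bullet> weak_grad \<Omega> (snd d) x)"
    proof (rule integral_mono_AE)
      show "integrable (lebesgue_on \<Omega>) (\<lambda>x. ?K x \<bullet> weak_grad \<Omega> (snd d) x)"
        by (rule L2_inner_integrable[OF L2_Linf_mult[OF kappa_Linf[OF w] L(4)] L(4)])
      show "integrable (lebesgue_on \<Omega>) (\<lambda>x. \<kappa>1 * (norm (weak_grad \<Omega> (snd d) x))\<^sup>2)"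
        using L2_integrable_square[OF L(4)] by simp
      show "AE x in lebesgue_on \<Omega>. \<kappa>1 * (norm (weak_grad \<Omega> (snd d) x))\<^sup>2 \<le> ?K x \<bullet> weak_grad \<Omega> (snd d) x"
        using kappa_elliptic[OF w]
      proof eventually_elim
        case (elim x)
        then show ?case by (cases "weak_grad \<Omega> (snd d) x = 0") (auto simp: inner_commute)
      qed
    qed
    then show ?thesis by (simp add: L2_norm_square L2_ip_def)
  qed
  moreover have "L2_ip \<Omega> (snd d) (\<lambda>x. trace (fst d x)) = L2_ip \<Omega> (snd d) (\<lambda>x. trace (fst d x))" ..
  ultimately have "2 * mu * (L2_norm \<Omega> (fst d))\<^sup>2 + \<kappa>1 * (L2_norm \<Omega> (weak_grad \<Omega> (snd d)))\<^sup>2 +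
      c0 * (L2_norm \<Omega> (snd d))\<^sup>2 \<le> a w d d"
    unfolding a_lin_eq by (simp add: L2_ip_square)
  moreover have "c * (L2_norm \<Omega> (fst d))\<^sup>2 \<le> 2 * mu * (L2_norm \<Omega> (fst d))\<^sup>2"
    "c * (L2_norm \<Omega> (weak_grad \<Omega> (snd d)))\<^sup>2 \<le> \<kappa>1 * (L2_norm \<Omega> (weak_grad \<Omega> (snd d)))\<^sup>2"
    "c * (L2_norm \<Omega> (snd d))\<^sup>2 \<le> c0 * (L2_norm \<Omega> (snd d))\<^sup>2"
    using c_le by (auto intro: mult_right_mono)
  moreover have "c * (X_norm \<Omega> d)\<^sup>2 = c * (L2_norm \<Omega> (fst d))\<^sup>2 + c * (L2_norm \<Omega> (snd d))\<^sup>2 +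
      c * (L2_norm \<Omega> (weak_grad \<Omega> (snd d)))\<^sup>2"
    by (simp add: X_norm_def H1_norm_def algebra_simps)
  ultimately show ?thesis by linarith
qed

lemma Y_pair_X: "\<sigma> \<in> Y \<Longrightarrow> (\<sigma>, 0) \<in> X"
  using Y_subset_X1 subspace_0[OF subspace_X2] by (simp add: Xh_def)

text \<open>The permeability does not appear: it only acts on the gradient of the second pressure, which is
  zero.\<close>

lemma a_stress_bound:
  assumes "w \<in> X" "d \<in> X" "\<sigma> \<in> Y"
  shows "a w d (\<sigma>, 0) \<le> 2 * C * X_norm \<Omega> d * L2_norm \<Omega> \<sigma>"
proof -
  note L = X_comps[OF assms(2)] and Ls = Y_comps(1)[OF assms(3)]
  note Ld = X_norm_ge(1)[of d] X_norm_ge'[of d]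
  have wg: "weak_grad \<Omega> 0 \<in> L2 \<Omega>" "L2_norm \<Omega> (weak_grad \<Omega> 0) = 0"
    using weak_grad(1)[OF H1_zero] L2_norm_le_H1_norm(2)[of 0] L2_norm_nonneg[of \<Omega> "weak_grad \<Omega> 0"]
    by (auto simp: H1.sn_zero)
  have "L2_ip \<Omega> (\<lambda>x. \<kappa> (fst w) (snd w) x *v weak_grad \<Omega> (snd d) x) (weak_grad \<Omega> 0) = 0"
    using L2.cauchy_schwarz[OF L2_Linf_mult[OF kappa_Linf[OF assms(1)] L(4)] wg(1)] wg(2) by simp
  moreover have "L2_ip \<Omega> (snd d) 0 = 0" "L2_ip \<Omega> 0 (\<lambda>x. trace (fst d x)) = 0" by (simp_all add: L2_ip_def)
  ultimately have eq: "a w d (\<sigma>, 0) = L2_ip \<Omega> (\<lambda>x. elast lam mu (fst d x)) \<sigma> - \<alpha> * L2_ip \<Omega> (snd d) (\<lambda>x. trace (\<sigma> x))"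
    unfolding a_lin_eq by simp
  have "L2_norm \<Omega> (\<lambda>x. elast lam mu (fst d x)) \<le> (2 * mu + 2 * lam) * L2_norm \<Omega> (fst d)"
    using par norm_elast_le by (intro L2_norm_le_of_ae L2_elast L) auto
  also have "\<dots> \<le> C * X_norm \<Omega> d"
    using C_ge(1) C_nonneg Ld by (intro mult_mono) auto
  finally have 1: "L2_ip \<Omega> (\<lambda>x. elast lam mu (fst d x)) \<sigma> \<le> C * X_norm \<Omega> d * L2_norm \<Omega> \<sigma>"
    using L2.cauchy_schwarz[OF L2_elast[OF L(1)] Ls, of lam mu]
      mult_right_mono[of "L2_norm \<Omega> (\<lambda>x. elast lam mu (fst d x))" "C * X_norm \<Omega> d" "L2_norm \<Omega> \<sigma>"]
    by simp
  have "\<alpha> * \<bar>L2_ip \<Omega> (snd d) (\<lambda>x. trace (\<sigma> x))\<bar> \<le> \<alpha> * (X_norm \<Omega> d * (2 * L2_norm \<Omega> \<sigma>))"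
  proof (intro mult_left_mono)
    have "sqrt 2 \<le> 2" using sqrt2_less_2 by simp
    then have "sqrt 2 * L2_norm \<Omega> \<sigma> \<le> 2 * L2_norm \<Omega> \<sigma>" by (intro mult_right_mono) auto
    then have "L2_norm \<Omega> (\<lambda>x. trace (\<sigma> x)) \<le> 2 * L2_norm \<Omega> \<sigma>" using L2_norm_trace[OF Ls] by linarith
    then show "\<bar>L2_ip \<Omega> (snd d) (\<lambda>x. trace (\<sigma> x))\<bar> \<le> X_norm \<Omega> d * (2 * L2_norm \<Omega> \<sigma>)"
      using Ld(2) by (intro order_trans[OF L2.cauchy_schwarz[OF L(3) L2_trace[OF Ls]]] mult_mono) auto
  qed (use par in auto)
  also have "\<dots> = (2 * \<alpha>) * (X_norm \<Omega> d * L2_norm \<Omega> \<sigma>)" by simp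
  also have "\<dots> \<le> C * (X_norm \<Omega> d * L2_norm \<Omega> \<sigma>)" using C_ge(2) by (intro mult_right_mono) auto
  finally have 2: "\<alpha> * \<bar>L2_ip \<Omega> (snd d) (\<lambda>x. trace (\<sigma> x))\<bar> \<le> C * X_norm \<Omega> d * L2_norm \<Omega> \<sigma>"
    by (simp add: mult.assoc)
  have "- (\<alpha> * L2_ip \<Omega> (snd d) (\<lambda>x. trace (\<sigma> x))) \<le> \<alpha> * \<bar>L2_ip \<Omega> (snd d) (\<lambda>x. trace (\<sigma> x))\<bar>"
    using par(3) by (metis abs_ge_minus_self minus_mult_right mult_left_mono)
  then show ?thesis using eq 1 2 by linarith
qed

lemma mixed_solutionD:
  assumes "mixed_solution \<Omega> T k A G H F ((d, \<sigma>), u)"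
  shows "d \<in> X" "\<sigma> \<in> Y" "u \<in> Z"
    "e \<in> X \<Longrightarrow> A d e + b1 \<Omega> e \<sigma> = G e"
    "\<tau> \<in> Y \<Longrightarrow> b1 \<Omega> d \<tau> + b2 \<Omega> (e', \<tau>) u = H \<tau>"
    "v \<in> Z \<Longrightarrow> b2 \<Omega> (d, \<sigma>) v = F v"
proof -
  show m: "d \<in> X" "\<sigma> \<in> Y" "u \<in> Z" using assms by (auto simp: mixed_solution_def)
  have *: "A d e + b1 \<Omega> e \<sigma> = G e \<and> b1 \<Omega> d \<tau> + b2 \<Omega> (e, \<tau>) u = H \<tau> \<and> b2 \<Omega> (d, \<sigma>) v = F v"
    if "e \<in> X" "\<tau> \<in> Y" "v \<in> Z" for e \<tau> v
    using assms that unfolding mixed_solution_def by auto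
  show "e \<in> X \<Longrightarrow> A d e + b1 \<Omega> e \<sigma> = G e" using *[of e \<sigma> u] m by blast
  show "\<tau> \<in> Y \<Longrightarrow> b1 \<Omega> d \<tau> + b2 \<Omega> (e', \<tau>) u = H \<tau>" using *[of d \<tau> u] m by (simp add: b2_eq)
  show "v \<in> Z \<Longrightarrow> b2 \<Omega> (d, \<sigma>) v = F v" using *[of d \<sigma> v] m by blast
qed

lemma mixed_solutionI:
  assumes "d \<in> X" "\<sigma> \<in> Y" "u \<in> Z" "\<And>e. e \<in> X \<Longrightarrow> A d e + b1 \<Omega> e \<sigma> = G e"
    "\<And>\<tau> e. \<tau> \<in> Y \<Longrightarrow> b1 \<Omega> d \<tau> + b2 \<Omega> (e, \<tau>) u = H \<tau>"
    "\<And>v. v \<in> Z \<Longrightarrow> b2 \<Omega> (d, \<sigma>) v = F v"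
  shows "mixed_solution \<Omega> T k A G H F ((d, \<sigma>), u)"
  using assms by (auto simp: mixed_solution_def)

text \<open>Stated for arbitrary bounded functionals, since it is applied to the given data and to the difference
  of two solutions.\<close>

lemma apriori:
  assumes w: "w \<in> X" and sol: "mixed_solution \<Omega> T k (a w) G H F ((d, \<sigma>), u)"
    and G: "\<And>e. e \<in> X \<Longrightarrow> \<bar>G e\<bar> \<le> NG * H1_norm \<Omega> (snd e)"
    and H: "\<And>\<tau>. \<tau> \<in> Y \<Longrightarrow> \<bar>H \<tau>\<bar> \<le> NH * Y_norm \<Omega> \<tau>"
    and F: "\<And>v. v \<in> Z \<Longrightarrow> \<bar>F v\<bar> \<le> NF * Z_norm \<Omega> v"
    and N: "0 \<le> NG" "0 \<le> NH" "0 \<le> NF"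
  shows "X_norm \<Omega> d \<le> \<gamma> * (NG + NH + NF)"
    "Y_norm \<Omega> \<sigma> \<le> 2 * C * X_norm \<Omega> d + NF"
    "Z_norm \<Omega> u \<le> (NH + X_norm \<Omega> d) / \<beta>"
proof -
  note s = mixed_solutionD[OF sol]
  let ?D = "X_norm \<Omega> d"
  have div: "L2_norm \<Omega> (weak_div \<Omega> \<sigma>) \<le> NF"
  proof -
    have "(L2_norm \<Omega> (weak_div \<Omega> \<sigma>))\<^sup>2 = - F (weak_div \<Omega> \<sigma>)"
      using s(6)[OF weak_div_Z[OF s(2)]] by (simp add: b2_eq L2_ip_square)
    also have "\<dots> \<le> NF * L2_norm \<Omega> (weak_div \<Omega> \<sigma>)"
      using F[OF weak_div_Z[OF s(2)]] by (simp add: Z_norm_def)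
    finally show ?thesis
      using N(3) by (cases "L2_norm \<Omega> (weak_div \<Omega> \<sigma>) = 0") (auto simp: power2_eq_square less_le)
  qed
  \<comment> \<open>\<open>G\<close> vanishes at \<open>(\<sigma>, 0)\<close> because it is bounded by the pressure alone.\<close>
  have stress: "L2_norm \<Omega> \<sigma> \<le> 2 * C * ?D"
  proof -
    have "G (\<sigma>, 0) = 0" using G[OF Y_pair_X[OF s(2)]] by (simp add: H1.sn_zero)
    then have "(L2_norm \<Omega> \<sigma>)\<^sup>2 = a w d (\<sigma>, 0)"
      using s(4)[OF Y_pair_X[OF s(2)]] by (simp add: b1_eq L2_ip_square)
    also have "\<dots> \<le> 2 * C * ?D * L2_norm \<Omega> \<sigma>" by (rule a_stress_bound[OF w s(1,2)])
    finally show ?thesis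
      using C_nonneg by (cases "L2_norm \<Omega> \<sigma> = 0") (auto simp: power2_eq_square less_le)
  qed
  show sig: "Y_norm \<Omega> \<sigma> \<le> 2 * C * ?D + NF" using Y_norm_le[of \<sigma>] div stress by linarith
  have "\<beta> * Z_norm \<Omega> u \<le> NH + ?D"
  proof (rule inf_sup_use[OF inf_sup s(3)])
    fix e \<tau> assume e: "e \<in> X" and \<tau>: "\<tau> \<in> Y"
    have "b2 \<Omega> (e, \<tau>) u = H \<tau> + L2_ip \<Omega> \<tau> (fst d)" using s(5)[OF \<tau>, of e] by (simp add: b1_eq)
    also have "\<dots> \<le> NH * Y_norm \<Omega> \<tau> + L2_norm \<Omega> \<tau> * L2_norm \<Omega> (fst d)"
      using H[OF \<tau>] L2.cauchy_schwarz[OF Y_comps(1)[OF \<tau>] X_comps(1)[OF s(1)]] by linarith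
    also have "\<dots> \<le> NH * Y_norm \<Omega> \<tau> + Y_norm \<Omega> \<tau> * ?D"
      using Y_norm_ge(1)[of \<tau>] X_norm_ge(1)[of d] by (intro add_left_mono mult_mono) auto
    also have "\<dots> = (NH + ?D) * Y_norm \<Omega> \<tau>" by (simp add: algebra_simps)
    also have "\<dots> \<le> (NH + ?D) * XY_norm \<Omega> (e, \<tau>)"
      using XY_norm_ge(2)[of "(e, \<tau>)"] N(2) by (intro mult_left_mono) auto
    finally show "b2 \<Omega> (e, \<tau>) u \<le> (NH + ?D) * XY_norm \<Omega> (e, \<tau>)" .
  qed
  then show disp: "Z_norm \<Omega> u \<le> (NH + ?D) / \<beta>" using beta by (simp add: field_simps)
  have energy: "a w d d = G d - H \<sigma> + F u"
    using s(4)[OF s(1)] s(5)[OF s(2), of d] s(6)[OF s(3)] by simp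
  have b1: "1 \<le> 1 / \<beta>" using beta inf_sup_le_1[OF inf_sup] by simp
  let ?N = "NG + NH + NF"
  have "c * ?D\<^sup>2 \<le> NG * ?D + NH * (2 * C * ?D + NF) + NF * ((NH + ?D) / \<beta>)"
  proof -
    have "G d \<le> NG * ?D"
      using G[OF s(1)] mult_left_mono[OF X_norm_ge(2)[of d] N(1)] by linarith
    moreover have "- H \<sigma> \<le> NH * (2 * C * ?D + NF)"
      using H[OF s(2)] mult_left_mono[OF sig N(2)] by linarith
    moreover have "F u \<le> NF * ((NH + ?D) / \<beta>)"
      using F[OF s(3)] mult_left_mono[OF disp N(3)] by linarith
    ultimately show ?thesis using coercive[OF w s(1)] energy by linarith
  qed
  also have "\<dots> = (NG + 2 * C * NH + NF * (1 / \<beta>)) * ?D + (1 + 1 / \<beta>) * (NH * NF)"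
    by (simp add: algebra_simps add_divide_distrib)
  also have "\<dots> \<le> ((2 * C + 1 / \<beta>) * ?N) * ?D + (2 / \<beta>) * ?N\<^sup>2"
  proof (intro add_mono mult_right_mono mult_mono)
    have "NG + 2 * C * NH + NF * q \<le> (2 * C + q) * ?N" if q: "1 \<le> q" for q
    proof -
      have "NG * 1 \<le> NG * q" using q N(1) by (rule mult_left_mono)
      moreover have "0 \<le> NH * q" "0 \<le> C * NG" "0 \<le> C * NF" using N q C_nonneg by simp_all
      ultimately show ?thesis by (simp add: algebra_simps)
    qed
    then show "NG + 2 * C * NH + NF * (1 / \<beta>) \<le> (2 * C + 1 / \<beta>) * ?N" using b1 .
    show "1 + 1 / \<beta> \<le> 2 / \<beta>" using b1 by (simp add: field_simps)
    show "NH * NF \<le> ?N\<^sup>2"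
      unfolding power2_eq_square using N by (intro mult_mono) auto
  qed (use N beta in auto)
  finally have "c * ?D\<^sup>2 \<le> (2 * C + 1 / \<beta>) * ?N * ?D + (2 / \<beta>) * ?N\<^sup>2" .
  then show "?D \<le> \<gamma> * ?N"
    using N gamma_pos gamma_quad C_nonneg beta
    by (intro quadratic_bound[of ?D ?N \<gamma> "2 * C + 1 / \<beta>" "2 / \<beta>" c]) auto
qed

text \<open>The whole system as one bilinear form; the trial argument comes first.\<close>

definition B :: "xfield \<Rightarrow> (xfield \<times> tensor_field) \<times> vector_field \<Rightarrow> (xfield \<times> tensor_field) \<times> vector_field \<Rightarrow> real" where
  "B w s t = a w (fst (fst s)) (fst (fst t)) + b1 \<Omega> (fst (fst t)) (snd (fst s)) +
     b1 \<Omega> (fst (fst s)) (snd (fst t)) + b2 \<Omega> (fst t) (snd s) + b2 \<Omega> (fst s) (snd t)"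

lemma S_comps:
  assumes "s \<in> S"
  shows "fst (fst s) \<in> X" "snd (fst s) \<in> Y" "snd s \<in> Z"
  using assms by (simp_all add: S_parts)

lemma lin_on_b_forms:
  "s \<in> S \<Longrightarrow> lin_on S (\<lambda>t. b1 \<Omega> (fst (fst t)) (snd (fst s)))"
  "s \<in> S \<Longrightarrow> lin_on S (\<lambda>t. b1 \<Omega> (fst (fst s)) (snd (fst t)))"
  "s \<in> S \<Longrightarrow> lin_on S (\<lambda>t. b2 \<Omega> (fst t) (snd s))"
  "s \<in> S \<Longrightarrow> lin_on S (\<lambda>t. b2 \<Omega> (fst s) (snd t))"
  unfolding b1_eq b2_eq
  using lin_on_compose[OF lin_on_L2_ip(2)[OF ae_lin_fst subspace_X Y_comps(1)[OF S_comps(2)]], of s S "\<lambda>t. fst (fst t)"]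
    lin_on_compose[OF lin_on_L2_ip(1)[OF ae_lin_Y subspace_Y X_comps(1)[OF S_comps(1)]], of s S "\<lambda>t. snd (fst t)"]
    lin_on_compose[OF lin_on_L2_ip(2)[OF ae_lin_div subspace_Y Z_L2[OF S_comps(3)]], of s S "\<lambda>t. snd (fst t)"]
    lin_on_compose[OF lin_on_L2_ip(1)[OF ae_lin_Z subspace_Z Y_comps(2)[OF S_comps(2)]], of s S snd]
  by (simp_all add: lin_on_uminus S_comps)

lemma B_lin_right:
  assumes "w \<in> X" "s \<in> S"
  shows "lin_on S (B w s)"
proof -
  have "lin_on S (\<lambda>t. a w (fst (fst s)) (fst (fst t)))"
    by (rule lin_on_compose[OF a_lin_right[OF assms(1) S_comps(1)[OF assms(2)]]]) (auto simp: S_comps)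
  then show ?thesis
    unfolding B_def[abs_def] using lin_on_b_forms[OF assms(2)] by (intro lin_on_plus)
qed

lemma B_lin_left:
  assumes "w \<in> X" "t \<in> S"
  shows "lin_on S (\<lambda>s. B w s t)"
proof -
  have "lin_on S (\<lambda>s. a w (fst (fst s)) (fst (fst t)))"
    by (rule lin_on_compose[OF a_lin_left[OF assms(1) S_comps(1)[OF assms(2)]]]) (auto simp: S_comps)
  then show ?thesis
    unfolding B_def using lin_on_b_forms[OF assms(2)] by (intro lin_on_plus)
qed

lemma L2_ip_zero:
  assumes "f \<in> L2 \<Omega>" "g \<in> L2 \<Omega>" "L2_norm \<Omega> f = 0 \<or> L2_norm \<Omega> g = 0"
  shows "L2_ip \<Omega> f g = 0"
  using L2.cauchy_schwarz[OF assms(1,2)] assms(3) by auto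

lemma X_null_comps:
  assumes "X_norm \<Omega> d = 0"
  shows "L2_norm \<Omega> (fst d) = 0" "L2_norm \<Omega> (snd d) = 0" "L2_norm \<Omega> (weak_grad \<Omega> (snd d)) = 0"
  using X_norm_ge[of d] X_norm_ge'[of d] L2_norm_le_H1_norm(2)[of "snd d"] assms
    L2_norm_nonneg[of \<Omega> "fst d"] L2_norm_nonneg[of \<Omega> "snd d"] L2_norm_nonneg[of \<Omega> "weak_grad \<Omega> (snd d)"]
  by linarith+

lemma a_null:
  assumes "w \<in> X" "d \<in> X" "e \<in> X" "X_norm \<Omega> d = 0 \<or> X_norm \<Omega> e = 0"
  shows "a w d e = 0"
proof -
  note Ld = X_comps[OF assms(2)] and Le = X_comps[OF assms(3)]
  have K: "(\<lambda>x. \<kappa> (fst w) (snd w) x *v weak_grad \<Omega> (snd d) x) \<in> L2 \<Omega>"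
    by (rule L2_Linf_mult[OF kappa_Linf[OF assms(1)] Ld(4)])
  have small: "L2_norm \<Omega> (\<lambda>x. elast lam mu (fst d x)) = 0 \<and> L2_norm \<Omega> (\<lambda>x. trace (fst d x)) = 0 \<and>
      L2_norm \<Omega> (\<lambda>x. \<kappa> (fst w) (snd w) x *v weak_grad \<Omega> (snd d) x) = 0" if "X_norm \<Omega> d = 0"
  proof -
    have d: "ae_eq \<Omega> (fst d) 0" "ae_eq \<Omega> (weak_grad \<Omega> (snd d)) 0"
      using X_null_comps[OF that] L2_norm_eq_0_iff Ld(1,4) by blast+
    have "ae_eq \<Omega> (\<lambda>x. elast lam mu (fst d x)) 0" "ae_eq \<Omega> (\<lambda>x. trace (fst d x)) 0"
      using d(1) unfolding ae_eq_def
      by (auto simp: elast_def trace_def mat_def elim!: eventually_mono)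
    moreover have "ae_eq \<Omega> (\<lambda>x. \<kappa> (fst w) (snd w) x *v weak_grad \<Omega> (snd d) x) 0"
      using d(2) unfolding ae_eq_def by (auto elim!: eventually_mono)
    ultimately show ?thesis
      by (simp add: L2_norm_eq_0_iff K L2_elast[OF Ld(1)] L2_trace[OF Ld(1)])
  qed
  have small': "L2_norm \<Omega> (\<lambda>x. trace (fst e x)) = 0" if "X_norm \<Omega> e = 0"
    using L2_norm_trace[OF Le(1)] X_null_comps(1)[OF that] L2_norm_nonneg[of \<Omega> "\<lambda>x. trace (fst e x)"] by simp
  note L = Ld Le K L2_elast[OF Ld(1)] L2_trace[OF Ld(1)] L2_trace[OF Le(1)]
  show ?thesis
    using assms(4)
  proof
    assume 0: "X_norm \<Omega> d = 0"
    show ?thesis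
      unfolding a_lin_eq using small[OF 0] X_null_comps[OF 0] by (simp add: L2_ip_zero L)
  next
    assume 0: "X_norm \<Omega> e = 0"
    show ?thesis
      unfolding a_lin_eq using small'[OF 0] X_null_comps[OF 0] by (simp add: L2_ip_zero L)
  qed
qed

lemma S_null_comps:
  assumes "s \<in> SS.null"
  shows "s \<in> S" "X_norm \<Omega> (fst (fst s)) = 0" "Y_norm \<Omega> (snd (fst s)) = 0" "Z_norm \<Omega> (snd s) = 0"
    "L2_norm \<Omega> (snd (fst s)) = 0" "L2_norm \<Omega> (weak_div \<Omega> (snd (fst s))) = 0"
proof -
  show "s \<in> S" using assms by (simp add: SS.null_iff)
  have "XYZ_norm \<Omega> s = 0" using assms by (simp add: SS.null_iff)
  then show *: "X_norm \<Omega> (fst (fst s)) = 0" "Y_norm \<Omega> (snd (fst s)) = 0" "Z_norm \<Omega> (snd s) = 0"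
    by (simp_all add: XYZ_norm_def XY_norm_def add_nonneg_eq_0_iff)
  show "L2_norm \<Omega> (snd (fst s)) = 0" "L2_norm \<Omega> (weak_div \<Omega> (snd (fst s))) = 0"
    using *(2) by (simp_all add: Y_norm_def add_nonneg_eq_0_iff)
qed

lemma B_null:
  assumes "w \<in> X" "s \<in> SS.null" "t \<in> S"
  shows "B w s t = 0 \<and> B w t s = 0"
proof -
  note n = S_null_comps[OF assms(2)]
  note cs = S_comps[OF n(1)] and ct = S_comps[OF assms(3)]
  note z = X_null_comps(1)[OF n(2)]
  have "a w (fst (fst s)) (fst (fst t)) = 0" "a w (fst (fst t)) (fst (fst s)) = 0"
    using a_null[OF assms(1) cs(1) ct(1)] a_null[OF assms(1) ct(1) cs(1)] n(2) by auto
  moreover have "L2_norm \<Omega> (snd s) = 0" using n(4) by (simp add: Z_norm_def)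
  ultimately show ?thesis
    unfolding B_def b1_eq b2_eq
    using n(5,6) z cs ct by (auto simp: L2_ip_zero X_comps Y_comps Z_L2)
qed

text \<open>Testing with \<open>((e, -\<tau>), v)\<close> cancels all terms except \<open>a(e, e)\<close>, so \<open>e\<close> is null.  Then
  \<open>((\<tau>, 0), 0), div \<tau>\<close> leaves only the squared norm of \<open>\<tau>\<close>, and the inf-sup condition takes care of
  \<open>v\<close>.\<close>

lemma adjoint_injective:
  assumes w: "w \<in> X" and t: "t \<in> S" and 0: "\<And>s. s \<in> S \<Longrightarrow> B w s t = 0"
  shows "t \<in> SS.null"
proof -
  obtain e \<tau> v where t_eq: "t = ((e, \<tau>), v)" by (metis prod.exhaust)
  have c: "e \<in> X" "\<tau> \<in> Y" "v \<in> Z" using S_comps[OF t] by (simp_all add: t_eq)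
  have z: "(0::xfield) \<in> X" "(0::tensor_field) \<in> Y" "(0::vector_field) \<in> Z"
    using subspace_0 subspace_X subspace_Y subspace_Z by blast+
  have z2: "weak_div \<Omega> 0 \<in> L2 \<Omega>" "L2_norm \<Omega> (weak_div \<Omega> 0) = 0"
    using Y_comps(2)[OF z(2)] Y_norm_eq_0_iff[OF z(2)] Y_norm_ge(2)[of 0] L2_norm_nonneg[of \<Omega> "weak_div \<Omega> 0"]
    by (auto simp: ae_zero_def)
  have dm: "L2_ip \<Omega> v (weak_div \<Omega> (- \<tau>)) = - L2_ip \<Omega> v (weak_div \<Omega> \<tau>)"
    using lin_on_scale[OF lin_on_L2_ip(2)[OF ae_lin_div subspace_Y Z_L2[OF c(3)]] c(2), of "-1"] by simp
  \<comment> \<open>Since \<open>b2\<close> enters once with \<open>\<tau>\<close> and once with \<open>- \<tau>\<close>, and likewise \<open>b1\<close>, all but one term cancel.\<close>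
  have "((e, - \<tau>), v) \<in> S" using c subspace_neg[OF subspace_Y] by (simp add: S_def)
  from 0[OF this] have "a w e e = 0"
    by (simp add: B_def t_eq b1_eq b2_eq dm) (simp add: L2_ip_def)
  then have "c * (X_norm \<Omega> e)\<^sup>2 \<le> 0" using coercive[OF w c(1)] by simp
  then have e0: "X_norm \<Omega> e = 0" using c_pos by (simp add: mult_le_0_iff)
  have "(((\<tau>, 0), 0), weak_div \<Omega> \<tau>) \<in> S"
    using Y_pair_X[OF c(2)] z weak_div_Z[OF c(2)] by (simp add: S_def)
  from 0[OF this] have "L2_ip \<Omega> \<tau> \<tau> + L2_ip \<Omega> (weak_div \<Omega> \<tau>) (weak_div \<Omega> \<tau>) = 0"
    using a_null[OF w Y_pair_X[OF c(2)] c(1)] e0 L2_ip_zero[OF Z_L2[OF c(3)] z2(1)] z2(2)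
    by (simp add: B_def t_eq b1_eq b2_eq) (simp add: L2_ip_def)
  then have \<tau>0: "Y_norm \<Omega> \<tau> = 0" by (simp add: L2_ip_square Y_norm_def)
  have "\<beta> * Z_norm \<Omega> v \<le> 0"
  proof (rule inf_sup_use[OF inf_sup c(3)])
    fix e' \<sigma> assume "e' \<in> X" and \<sigma>: "\<sigma> \<in> Y"
    have "((0, \<sigma>), 0) \<in> S" using \<sigma> z by (simp add: S_def)
    from 0[OF this] have "b2 \<Omega> (0, \<sigma>) v = 0"
      using a_null[OF w z(1) c(1)] e0 L2_ip_zero[OF Y_comps(1)[OF \<sigma>] X_comps(1)[OF c(1)]] X_null_comps(1)[OF e0]
      by (simp add: B_def t_eq b1_eq b2_eq) (simp add: L2_ip_def)
    then show "b2 \<Omega> (e', \<sigma>) v \<le> 0 * XY_norm \<Omega> (e', \<sigma>)" by (simp add: b2_eq)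
  qed
  then have "Z_norm \<Omega> v = 0" using beta L2_norm_nonneg[of \<Omega> v] by (simp add: Z_norm_def mult_le_0_iff)
  then have "XYZ_norm \<Omega> t = 0" using e0 \<tau>0 by (simp add: t_eq XYZ_norm_def XY_norm_def)
  then show ?thesis using t by (simp add: SS.null_iff)
qed

lemma linear_problem_solvable:
  assumes w: "w \<in> X"
    and G: "lin_on X G" "\<And>e. e \<in> X \<Longrightarrow> \<bar>G e\<bar> \<le> NG * H1_norm \<Omega> (snd e)"
    and H: "lin_on Y H" "\<And>\<tau>. \<tau> \<in> Y \<Longrightarrow> \<bar>H \<tau>\<bar> \<le> NH * Y_norm \<Omega> \<tau>"
    and F: "lin_on Z F" "\<And>v. v \<in> Z \<Longrightarrow> \<bar>F v\<bar> \<le> NF * Z_norm \<Omega> v"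
  shows "\<exists>s. mixed_solution \<Omega> T k (a w) G H F s"
proof -
  define l where "l t = G (fst (fst t)) + H (snd (fst t)) + F (snd t)" for t :: "(xfield \<times> tensor_field) \<times> vector_field"
  have l: "lin_on S l"
    unfolding l_def
    by (intro lin_on_plus lin_on_compose[OF G(1), of S "\<lambda>t. fst (fst t)"]
        lin_on_compose[OF H(1), of S "\<lambda>t. snd (fst t)"] lin_on_compose[OF F(1), of S snd])
      (auto simp: S_comps)
  have l0: "l t = 0" if t: "t \<in> SS.null" for t
  proof -
    note n = S_null_comps[OF t]
    have "H1_norm \<Omega> (snd (fst (fst t))) = 0"
      using X_norm_ge(2)[of "fst (fst t)"] n(2) H1_norm_nonneg[of "snd (fst (fst t))"] by linarith
    then show ?thesis
      using G(2)[OF S_comps(1)[OF n(1)]] H(2)[OF S_comps(2)[OF n(1)]] F(2)[OF S_comps(3)[OF n(1)]] n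
      by (simp add: l_def)
  qed
  obtain s where s: "s \<in> S" "\<And>t. t \<in> S \<Longrightarrow> B w s t = l t"
    using SS.solve_bilinear[OF fin_gen_S B_lin_left[OF w] B_lin_right[OF w] B_null[OF w] adjoint_injective[OF w] l l0]
    by metis
  obtain d \<sigma> u where s_eq: "s = ((d, \<sigma>), u)" by (metis prod.exhaust)
  have c: "d \<in> X" "\<sigma> \<in> Y" "u \<in> Z" using S_comps[OF s(1)] by (simp_all add: s_eq)
  have z: "(0::xfield) \<in> X" "(0::tensor_field) \<in> Y" "(0::vector_field) \<in> Z"
    using subspace_0 subspace_X subspace_Y subspace_Z by blast+
  have z0: "G 0 = 0" "H 0 = 0" "F 0 = 0"
    using lin_on_zero G(1) H(1) F(1) subspace_X subspace_Y subspace_Z by blast+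
  have wd: "weak_div \<Omega> 0 \<in> L2 \<Omega>" "L2_norm \<Omega> (weak_div \<Omega> 0) = 0"
    using Y_comps(2)[OF z(2)] Y_norm_eq_0_iff[OF z(2)] Y_norm_ge(2)[of 0] L2_norm_nonneg[of \<Omega> "weak_div \<Omega> 0"]
    by (auto simp: ae_zero_def)
  have i0: "L2_ip \<Omega> 0 f = 0" "L2_ip \<Omega> f 0 = 0" for f :: "real^2 \<Rightarrow> 'b::euclidean_space"
    by (simp_all add: L2_ip_def)
  have X0: "X_norm \<Omega> 0 = 0" by (rule XS.sn_zero)
  have "mixed_solution \<Omega> T k (a w) G H F ((d, \<sigma>), u)"
  proof (rule mixed_solutionI[OF c])
    fix e assume e: "e \<in> X"
    have "((e, 0), 0) \<in> S" using e z by (simp add: S_def)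
    from s(2)[OF this] show "a w d e + b1 \<Omega> e \<sigma> = G e"
      using L2_ip_zero[OF Z_L2[OF c(3)] wd(1)] wd(2) z0
      by (simp add: B_def l_def s_eq b1_eq b2_eq) (simp add: L2_ip_def)
  next
    fix \<tau> and e :: xfield assume \<tau>: "\<tau> \<in> Y"
    have "((0, \<tau>), 0) \<in> S" using \<tau> z by (simp add: S_def)
    from s(2)[OF this] show "b1 \<Omega> d \<tau> + b2 \<Omega> (e, \<tau>) u = H \<tau>"
      using a_null[OF w c(1) z(1)] X0 z0
      by (simp add: B_def l_def s_eq b1_eq b2_eq) (simp add: L2_ip_def)
  next
    fix v assume v: "v \<in> Z"
    have "((0, 0), v) \<in> S" using v z by (simp add: S_def)
    from s(2)[OF this] show "b2 \<Omega> (d, \<sigma>) v = F v"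
      using a_null[OF w c(1) z(1)] X0 z0 L2_ip_zero[OF Z_L2[OF c(3)] wd(1)] wd(2)
      by (simp add: B_def l_def s_eq b1_eq b2_eq) (simp add: L2_ip_def)
  qed
  then show ?thesis by blast
qed

end

section \<open>The fixed point\<close>

locale mixed_data = mixed_problem \<Omega> T k lam mu \<alpha> c0 \<kappa>1 \<kappa>2 \<beta> r \<kappa>
  for \<Omega> T k lam mu \<alpha> c0 \<kappa>1 \<kappa>2 \<beta> r \<kappa> +
  fixes f :: vector_field and g :: scalar_field and u\<Gamma> :: "bvalue^2" and r\<Gamma> :: "bvalue \<Rightarrow> real"
  assumes f: "f \<in> L2 \<Omega>" and g: "g \<in> L2 \<Omega>" and u\<Gamma>: "u\<Gamma> \<in> H_half_vec \<Omega>" and r\<Gamma>: "r\<Gamma> \<in> H_mhalf \<Omega>"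
    and small: "\<gamma> / r * max (\<gamma> * \<kappa>2 * r) 1 * data_norm \<Omega> f g u\<Gamma> r\<Gamma> < 1"
begin

abbreviation "G \<equiv> G_fun \<Omega> g r\<Gamma>"
abbreviation "H \<equiv> H_fun \<Omega> u\<Gamma>"
abbreviation "F \<equiv> F_fun \<Omega> f"
abbreviation "N \<equiv> data_norm \<Omega> f g u\<Gamma> r\<Gamma>"
abbreviation "NG \<equiv> L2_norm \<Omega> g + H_mhalf_norm \<Omega> r\<Gamma>"
abbreviation "NH \<equiv> H_half_vec_norm \<Omega> u\<Gamma>"
abbreviation "NF \<equiv> L2_norm \<Omega> f"

lemma N_eq: "NG + NH + NF = N"
  by (simp add: data_norm_def)

lemma NG_nonneg: "0 \<le> NG" and NH_nonneg: "0 \<le> NH" and NF_nonneg: "0 \<le> NF"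
  using H_mhalf_norm_nonneg[OF r\<Gamma>] H_half_vec_norm_nonneg by (auto intro: add_nonneg_nonneg)

lemma N_nonneg: "0 \<le> N"
  using N_eq NG_nonneg NH_nonneg NF_nonneg by linarith

lemma G_bound:
  assumes e: "e \<in> X"
  shows "\<bar>G e\<bar> \<le> NG * H1_norm \<Omega> (snd e)"
proof -
  have "\<bar>L2_ip \<Omega> g (snd e)\<bar> \<le> L2_norm \<Omega> g * L2_norm \<Omega> (snd e)"
    by (rule L2.cauchy_schwarz[OF g X_comps(3)[OF e]])
  also have "\<dots> \<le> L2_norm \<Omega> g * H1_norm \<Omega> (snd e)"
    by (intro mult_left_mono L2_norm_le_H1_norm) simp
  finally show ?thesis
    using H_mhalf_bound[OF r\<Gamma> X_comps(2)[OF e]] unfolding G_fun_eq distrib_right by linarith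
qed

lemma H_bound: "\<tau> \<in> Y \<Longrightarrow> \<bar>H \<tau>\<bar> \<le> NH * Y_norm \<Omega> \<tau>"
  by (rule H_fun_bound[OF u\<Gamma> Y_div_domain])

lemma F_bound: "v \<in> Z \<Longrightarrow> \<bar>F v\<bar> \<le> NF * Z_norm \<Omega> v"
  unfolding F_fun_eq Z_norm_def by (rule L2.cauchy_schwarz[OF f Z_L2])

lemma G_lin: "lin_on X G"
  unfolding G_fun_eq[abs_def]
  by (intro lin_on_plus lin_on_L2_ip(2)[OF ae_lin_snd subspace_X g]
      lin_on_compose[OF H_mhalf_lin[OF r\<Gamma>], of X snd]) (simp_all add: X_comps)

lemma H_lin: "lin_on Y H"
  using lin_on_compose[OF H_fun_lin[OF u\<Gamma>], of Y "\<lambda>\<tau>. \<tau>"] Y_div_domain by simp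

lemma F_lin: "lin_on Z F"
  unfolding F_fun_eq[abs_def] by (rule lin_on_L2_ip(2)[OF ae_lin_Z subspace_Z f])

abbreviation "Phw \<equiv> Phw_solution \<Omega> T k lam mu \<alpha> c0 \<kappa> f g u\<Gamma> r\<Gamma>"
abbreviation "Ph \<equiv> Ph_solution \<Omega> T k lam mu \<alpha> c0 \<kappa> f g u\<Gamma> r\<Gamma>"
abbreviation "J \<equiv> Jh \<Omega> T k lam mu \<alpha> c0 \<kappa> f g u\<Gamma> r\<Gamma>"

lemma Phw_exists: "w \<in> X \<Longrightarrow> \<exists>s. Phw w s"
  unfolding Phw_solution_def
  by (rule linear_problem_solvable[OF _ G_lin G_bound H_lin H_bound F_lin F_bound])

lemma Phw_bounds:
  assumes "w \<in> X" "Phw w ((d, \<sigma>), u)"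
  shows "X_norm \<Omega> d \<le> \<gamma> * N" "Y_norm \<Omega> \<sigma> \<le> 2 * C * X_norm \<Omega> d + N" "Z_norm \<Omega> u \<le> (N + X_norm \<Omega> d) / \<beta>"
proof -
  note A = apriori[OF assms(1) assms(2)[unfolded Phw_solution_def] G_bound H_bound F_bound
      NG_nonneg NH_nonneg NF_nonneg]
  show "X_norm \<Omega> d \<le> \<gamma> * N" using A(1) N_eq by simp
  show "Y_norm \<Omega> \<sigma> \<le> 2 * C * X_norm \<Omega> d + N" using A(2) N_eq NG_nonneg NH_nonneg by linarith
  have "(NH + X_norm \<Omega> d) / \<beta> \<le> (N + X_norm \<Omega> d) / \<beta>"
    using beta N_eq NG_nonneg NF_nonneg by (intro divide_right_mono) linarith+
  then show "Z_norm \<Omega> u \<le> (N + X_norm \<Omega> d) / \<beta>" using A(3) by linarith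
qed

lemma Phw_D:
  assumes "Phw w ((d, \<sigma>), u)"
  shows "d \<in> X" "\<sigma> \<in> Y" "u \<in> Z"
  using mixed_solutionD(1-3)[OF assms[unfolded Phw_solution_def]] by blast+

text \<open>This is where the Lipschitz condition on the permeability enters.\<close>

lemma permeability_change:
  assumes "w \<in> X" "w' \<in> X" "d \<in> X" "e \<in> X"
  shows "\<bar>a w' d e - a w d e\<bar> \<le> \<kappa>2 * X_norm \<Omega> (w - w') * X_norm \<Omega> d * H1_norm \<Omega> (snd e)"
proof -
  let ?K = "\<lambda>x. \<kappa> (fst w') (snd w') x - \<kappa> (fst w) (snd w) x"
  let ?p = "weak_grad \<Omega> (snd d)" and ?q = "weak_grad \<Omega> (snd e)"
  note L = X_comps(4)[OF assms(3)] X_comps(4)[OF assms(4)]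
  have K: "?K \<in> Linf \<Omega>" by (intro Linf_diff kappa_Linf assms)
  have i: "integrable (lebesgue_on \<Omega>) (\<lambda>x. (\<kappa> (fst v) (snd v) x *v ?p x) \<bullet> ?q x)" if "v \<in> X" for v
    by (rule L2_inner_integrable[OF L2_Linf_mult[OF kappa_Linf[OF that] L(1)] L(2)])
  have "a w' d e - a w d e = (LINT x|lebesgue_on \<Omega>. (?K x *v ?p x) \<bullet> ?q x)"
    unfolding a_lin_def using i[OF assms(1)] i[OF assms(2)]
    by (simp add: matrix_vector_mult_diff_rdistrib inner_diff_left)
  also have "\<bar>\<dots>\<bar> \<le> (\<kappa>2 * X_norm \<Omega> (w' - w)) * L2_norm \<Omega> ?p * L2_norm \<Omega> ?q"
    by (rule Linf_mult_inner_bound[OF K L kappa_lipschitz[OF assms(2,1)]]) (use perm(2) in simp)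
  also have "\<dots> \<le> (\<kappa>2 * X_norm \<Omega> (w' - w)) * X_norm \<Omega> d * H1_norm \<Omega> (snd e)"
    using perm(2) L2_norm_le_H1_norm(2)[of "snd e"] order_trans[OF L2_norm_le_H1_norm(2)[of "snd d"] X_norm_ge(2)[of d]]
    by (intro mult_mono) auto
  finally show ?thesis using XS.sn_diff_commute[OF assms(1,2)] by simp
qed

text \<open>The difference of two solutions solves the linearised problem for \<open>w\<close> with the change of
  permeability, applied to \<open>d'\<close>, as its only load.\<close>

lemma Phw_difference:
  assumes w: "w \<in> X" "w' \<in> X" and s: "Phw w ((d, \<sigma>), u)" "Phw w' ((d', \<sigma>'), u')"
  shows "X_norm \<Omega> (d - d') \<le> \<gamma> * \<kappa>2 * X_norm \<Omega> d' * X_norm \<Omega> (w - w')"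
    "Y_norm \<Omega> (\<sigma> - \<sigma>') \<le> 2 * C * X_norm \<Omega> (d - d')"
    "Z_norm \<Omega> (u - u') \<le> X_norm \<Omega> (d - d') / \<beta>"
proof -
  note c = Phw_D[OF s(1)] and c' = Phw_D[OF s(2)]
  note D = mixed_solutionD(4-6)[OF s(1)[unfolded Phw_solution_def]]
  note D' = mixed_solutionD(4-6)[OF s(2)[unfolded Phw_solution_def]]
  have sol: "mixed_solution \<Omega> T k (a w) (\<lambda>e. a w' d' e - a w d' e) (\<lambda>_. 0) (\<lambda>_. 0) ((d - d', \<sigma> - \<sigma>'), u - u')"
  proof (rule mixed_solutionI)
    show "d - d' \<in> X" "\<sigma> - \<sigma>' \<in> Y" "u - u' \<in> Z"
      using c c' subspace_diff subspace_X subspace_Y subspace_Z by blast+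
    show "a w (d - d') e + b1 \<Omega> e (\<sigma> - \<sigma>') = a w' d' e - a w d' e" if e: "e \<in> X" for e
    proof -
      have "a w (d - d') e = a w d e - a w d' e"
        using lin_on_diff[OF a_lin_left[OF w(1) e] subspace_X c(1) c'(1)] .
      moreover have "b1 \<Omega> e (\<sigma> - \<sigma>') = b1 \<Omega> e \<sigma> - b1 \<Omega> e \<sigma>'"
        using L2.diff_left[OF Y_comps(1)[OF c(2)] Y_comps(1)[OF c'(2)] X_comps(1)[OF e]] by (simp add: b1_eq)
      ultimately show ?thesis using D(1)[OF e] D'(1)[OF e] by simp
    qed
    show "b1 \<Omega> (d - d') \<tau> + b2 \<Omega> (e, \<tau>) (u - u') = 0" if \<tau>: "\<tau> \<in> Y" for \<tau> e
    proof -
      have "b1 \<Omega> (d - d') \<tau> = b1 \<Omega> d \<tau> - b1 \<Omega> d' \<tau>"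
        using L2.diff_right[OF X_comps(1)[OF c(1)] X_comps(1)[OF c'(1)] Y_comps(1)[OF \<tau>]] by (simp add: b1_eq)
      moreover have "b2 \<Omega> (e, \<tau>) (u - u') = b2 \<Omega> (e, \<tau>) u - b2 \<Omega> (e, \<tau>) u'"
        using L2.diff_left[OF Z_L2[OF c(3)] Z_L2[OF c'(3)] Y_comps(2)[OF \<tau>]] by (simp add: b2_eq)
      ultimately show ?thesis using D(2)[OF \<tau>, of e] D'(2)[OF \<tau>, of e] by simp
    qed
    show "b2 \<Omega> (d - d', \<sigma> - \<sigma>') v = 0" if v: "v \<in> Z" for v
    proof -
      have "b2 \<Omega> (d - d', \<sigma> - \<sigma>') v = b2 \<Omega> (d, \<sigma>) v - b2 \<Omega> (d', \<sigma>') v"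
        using lin_on_diff[OF lin_on_L2_ip(2)[OF ae_lin_div subspace_Y Z_L2[OF v]] subspace_Y c(2) c'(2)]
        by (simp add: b2_eq)
      then show ?thesis using D(3)[OF v] D'(3)[OF v] by simp
    qed
  qed
  note A = apriori[OF w(1) sol, of "\<kappa>2 * X_norm \<Omega> (w - w') * X_norm \<Omega> d'" 0 0]
  have G': "\<bar>a w' d' e - a w d' e\<bar> \<le> \<kappa>2 * X_norm \<Omega> (w - w') * X_norm \<Omega> d' * H1_norm \<Omega> (snd e)" if "e \<in> X" for e
    by (rule permeability_change[OF w c'(1) that])
  have nn: "0 \<le> \<kappa>2 * X_norm \<Omega> (w - w') * X_norm \<Omega> d'" using perm(2) by simp
  show "X_norm \<Omega> (d - d') \<le> \<gamma> * \<kappa>2 * X_norm \<Omega> d' * X_norm \<Omega> (w - w')"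
    using A(1)[OF G' _ _ nn] by (simp add: mult_ac)
  show "Y_norm \<Omega> (\<sigma> - \<sigma>') \<le> 2 * C * X_norm \<Omega> (d - d')" using A(2)[OF G' _ _ nn] by simp
  show "Z_norm \<Omega> (u - u') \<le> X_norm \<Omega> (d - d') / \<beta>" using A(3)[OF G' _ _ nn] by simp
qed

lemma J_solution:
  assumes "w \<in> X"
  shows "\<exists>\<sigma> u. Phw w ((J w, \<sigma>), u)"
  unfolding Jh_def using someI_ex[OF Phw_exists[OF assms]] by (metis prod.collapse)

lemma J_in_X: "w \<in> X \<Longrightarrow> J w \<in> X"
  using J_solution Phw_D(1) by blast

lemma gamma_N_le_r: "\<gamma> * N \<le> r"
proof -
  have "\<gamma> / r * 1 * N \<le> \<gamma> / r * max (\<gamma> * \<kappa>2 * r) 1 * N"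
    using gamma_pos r N_nonneg by (intro mult_right_mono mult_left_mono) auto
  then have "\<gamma> * N / r < 1" using small by simp
  then show ?thesis using r by (simp add: divide_less_eq)
qed

definition "L = \<gamma> * \<kappa>2 * (\<gamma> * N)"

lemma L_bounds: "0 \<le> L" "L < 1"
proof -
  show "0 \<le> L" using gamma_pos perm(2) N_nonneg by (simp add: L_def)
  have "\<gamma> / r * (\<gamma> * \<kappa>2 * r) * N \<le> \<gamma> / r * max (\<gamma> * \<kappa>2 * r) 1 * N"
    using gamma_pos r N_nonneg by (intro mult_right_mono mult_left_mono) auto
  moreover have "\<gamma> / r * (\<gamma> * \<kappa>2 * r) * N = L" using r by (simp add: L_def)
  ultimately show "L < 1" using small by linarith
qed

lemma Phw_contraction:
  assumes "w \<in> X" "w' \<in> X" "Phw w ((d, \<sigma>), u)" "Phw w' ((d', \<sigma>'), u')"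
  shows "X_norm \<Omega> (d - d') \<le> L * X_norm \<Omega> (w - w')"
proof -
  have "X_norm \<Omega> (d - d') \<le> \<gamma> * \<kappa>2 * X_norm \<Omega> d' * X_norm \<Omega> (w - w')"
    by (rule Phw_difference(1)[OF assms])
  also have "\<dots> \<le> L * X_norm \<Omega> (w - w')"
    unfolding L_def using gamma_pos perm(2) Phw_bounds(1)[OF assms(2,4)]
    by (intro mult_right_mono mult_left_mono) auto
  finally show ?thesis .
qed

lemma J_contraction: "w \<in> X \<Longrightarrow> w' \<in> X \<Longrightarrow> X_norm \<Omega> (J w - J w') \<le> L * X_norm \<Omega> (w - w')"
  using J_solution[of w] J_solution[of w'] Phw_contraction by blast

lemma contraction_null:
  assumes "x \<in> X" "X_norm \<Omega> x \<le> L * X_norm \<Omega> x"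
  shows "X_norm \<Omega> x = 0"
proof (rule ccontr)
  assume "X_norm \<Omega> x \<noteq> 0"
  then have "X_norm \<Omega> x > 0" using X_norm_nonneg[of x] by linarith
  then have "L * X_norm \<Omega> x < 1 * X_norm \<Omega> x" using L_bounds by (intro mult_strict_right_mono)
  then show False using assms(2) by simp
qed

lemma Ph_iff_Phw: "Ph ((d, \<sigma>), u) \<longleftrightarrow> Phw d ((d, \<sigma>), u)"
  by (simp add: Ph_solution_def Phw_solution_def mixed_solution_def a_form_def)

lemma Wh_iff: "d \<in> Wh \<Omega> T k r \<longleftrightarrow> d \<in> X \<and> X_norm \<Omega> d \<le> r"
  by (simp add: Wh_def)

text \<open>The value of \<open>\<J>\<^sub>h\<close> is an arbitrary representative, which need not be \<open>d\<close> itself; all terms of the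
  problem are insensitive to a null change of \<open>d\<close>.\<close>

lemma fixed_point_iff:
  assumes d: "d \<in> X"
  shows "X_eq \<Omega> (J d) d \<longleftrightarrow> (\<exists>\<sigma> u. Ph ((d, \<sigma>), u))"
proof
  assume "X_eq \<Omega> (J d) d"
  then have z: "X_norm \<Omega> (J d - d) = 0" using X_eq_iff[OF J_in_X[OF d] d] by simp
  have dX: "J d - d \<in> X" using subspace_diff[OF subspace_X J_in_X[OF d] d] .
  obtain \<sigma> u where s: "Phw d ((J d, \<sigma>), u)" using J_solution[OF d] by blast
  note m = mixed_solutionD[OF s[unfolded Phw_solution_def]]
  have "mixed_solution \<Omega> T k (a d) G H F ((d, \<sigma>), u)"
  proof (rule mixed_solutionI[OF d m(2,3)])
    show "a d d e + b1 \<Omega> e \<sigma> = G e" if e: "e \<in> X" for e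
      using lin_on_diff[OF a_lin_left[OF d e] subspace_X J_in_X[OF d] d] a_null[OF d dX e] z m(4)[OF e] by simp
    show "b1 \<Omega> d \<tau> + b2 \<Omega> (e, \<tau>) u = H \<tau>" if \<tau>: "\<tau> \<in> Y" for \<tau> e
    proof -
      have "L2_ip \<Omega> \<tau> (fst (J d - d)) = 0"
        using X_null_comps(1)[OF z] by (intro L2_ip_zero Y_comps(1)[OF \<tau>] X_comps(1)[OF dX]) simp
      then have "b1 \<Omega> (J d) \<tau> = b1 \<Omega> d \<tau>"
        using L2.diff_right[OF X_comps(1)[OF J_in_X[OF d]] X_comps(1)[OF d] Y_comps(1)[OF \<tau>]] by (simp add: b1_eq)
      then show ?thesis using m(5)[OF \<tau>, of e] by simp
    qed
    show "b2 \<Omega> (d, \<sigma>) v = F v" if "v \<in> Z" for v using m(6)[OF that] by (simp add: b2_eq)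
  qed
  then show "\<exists>\<sigma> u. Ph ((d, \<sigma>), u)" unfolding Ph_iff_Phw Phw_solution_def by blast
next
  assume "\<exists>\<sigma> u. Ph ((d, \<sigma>), u)"
  then obtain \<sigma> u where s: "Phw d ((d, \<sigma>), u)" unfolding Ph_iff_Phw by blast
  obtain \<sigma>' u' where s': "Phw d ((J d, \<sigma>'), u')" using J_solution[OF d] by blast
  have "X_norm \<Omega> (J d - d) \<le> L * X_norm \<Omega> (d - d)" by (rule Phw_contraction[OF d d s' s])
  then have "X_norm \<Omega> (J d - d) = 0" using X_norm_nonneg[of "J d - d"] XS.sn_zero by simp
  then show "X_eq \<Omega> (J d) d" using X_eq_iff[OF J_in_X[OF d] d] by simp
qed

lemma fixed_point_exists: "\<exists>d. d \<in> Wh \<Omega> T k r \<and> X_eq \<Omega> (J d) d"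
proof -
  have "J w \<in> X \<and> X_norm \<Omega> (J w) \<le> r" if w: "w \<in> X" for w
    using J_solution[OF w] Phw_bounds(1)[OF w] gamma_N_le_r J_in_X[OF w] by (meson order_trans)
  then obtain d where "d \<in> X" "X_norm \<Omega> d \<le> r" "X_norm \<Omega> (J d - d) = 0"
    using XS.contraction_fixed_point[OF fin_gen_X less_imp_le[OF r] L_bounds, of J] J_contraction by blast
  then have "d \<in> Wh \<Omega> T k r \<and> X_eq \<Omega> (J d) d" using X_eq_iff[OF J_in_X, of d d] by (simp add: Wh_iff)
  then show ?thesis by blast
qed

lemma fixed_point_unique:
  assumes "d \<in> Wh \<Omega> T k r" "X_eq \<Omega> (J d) d" "e \<in> Wh \<Omega> T k r" "X_eq \<Omega> (J e) e"
  shows "X_eq \<Omega> d e"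
proof -
  have X: "d \<in> X" "e \<in> X" using assms(1,3) by (simp_all add: Wh_iff)
  obtain \<sigma> u where 1: "Phw d ((d, \<sigma>), u)"
    using fixed_point_iff[OF X(1)] assms(2) unfolding Ph_iff_Phw by blast
  obtain \<sigma>' u' where 2: "Phw e ((e, \<sigma>'), u')"
    using fixed_point_iff[OF X(2)] assms(4) unfolding Ph_iff_Phw by blast
  from contraction_null[OF subspace_diff[OF subspace_X X] Phw_contraction[OF X 1 2]]
  show ?thesis using X_eq_iff[OF X] by simp
qed

lemma Ph_parts:
  assumes "Ph s"
  obtains d \<sigma> u where "s = ((d, \<sigma>), u)" "Phw d ((d, \<sigma>), u)" "d \<in> X" "\<sigma> \<in> Y" "u \<in> Z"
proof -
  obtain d \<sigma> u where s: "s = ((d, \<sigma>), u)" by (metis prod.exhaust)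
  then have P: "Phw d ((d, \<sigma>), u)" using assms by (simp add: Ph_iff_Phw)
  show thesis by (rule that[OF s P Phw_D[OF P]])
qed

lemma Ph_unique:
  assumes "Ph s" "Ph t"
  shows "XYZ_eq \<Omega> s t"
proof -
  obtain d \<sigma> u where s: "s = ((d, \<sigma>), u)" "Phw d ((d, \<sigma>), u)" "d \<in> X" "\<sigma> \<in> Y" "u \<in> Z"
    by (rule Ph_parts[OF assms(1)])
  obtain d' \<sigma>' u' where t: "t = ((d', \<sigma>'), u')" "Phw d' ((d', \<sigma>'), u')" "d' \<in> X" "\<sigma>' \<in> Y" "u' \<in> Z"
    by (rule Ph_parts[OF assms(2)])
  have d0: "X_norm \<Omega> (d - d') = 0"
    by (rule contraction_null[OF subspace_diff[OF subspace_X s(3) t(3)] Phw_contraction[OF s(3) t(3) s(2) t(2)]])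
  have "Y_norm \<Omega> (\<sigma> - \<sigma>') \<le> 0" "Z_norm \<Omega> (u - u') \<le> 0"
    using Phw_difference(2,3)[OF s(3) t(3) s(2) t(2)] d0 by simp_all
  then have "XYZ_norm \<Omega> (s - t) \<le> 0"
    using XYZ_norm_le[of "s - t"] d0 by (simp add: s(1) t(1))
  then have "XYZ_norm \<Omega> (s - t) = 0" using XYZ_norm_nonneg[of "s - t"] by linarith
  then show ?thesis
    using XYZ_eq_iff[of s t] s t by (simp add: S_def)
qed

lemma Ph_bound:
  assumes "Ph s"
  shows "XYZ_norm \<Omega> s \<le> (\<gamma> + 2 * C * \<gamma> + 1 + (1 + \<gamma>) / \<beta>) * N"
proof -
  obtain d \<sigma> u where s: "s = ((d, \<sigma>), u)" "Phw d ((d, \<sigma>), u)" "d \<in> X" "\<sigma> \<in> Y" "u \<in> Z"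
    by (rule Ph_parts[OF assms])
  note B = Phw_bounds[OF s(3) s(2)]
  have "2 * C * X_norm \<Omega> d \<le> 2 * C * (\<gamma> * N)" using B(1) C_nonneg by (intro mult_left_mono) auto
  moreover have "(N + X_norm \<Omega> d) / \<beta> \<le> (N + \<gamma> * N) / \<beta>" using B(1) beta by (intro divide_right_mono) auto
  moreover have "XYZ_norm \<Omega> s \<le> X_norm \<Omega> d + Y_norm \<Omega> \<sigma> + Z_norm \<Omega> u" using XYZ_norm_le[of s] by (simp add: s(1))
  ultimately have "XYZ_norm \<Omega> s \<le> \<gamma> * N + (2 * C * (\<gamma> * N) + N) + (N + \<gamma> * N) / \<beta>" using B by linarith
  also have "\<dots> = (\<gamma> + 2 * C * \<gamma> + 1 + (1 + \<gamma>) / \<beta>) * N"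
    by (simp add: distrib_right add_divide_distrib)
  finally show ?thesis .
qed

end

theorem theorem4p1:
  fixes \<Omega> :: "(real^2) set" and lam mu \<alpha> c0 \<kappa>1 \<kappa>2 \<beta> r :: real and \<kappa> :: perm and k :: nat
  assumes dom: "lipschitz_domain \<Omega>"
    and par: "lam > 0" "mu > 0" "0 \<le> \<alpha>" "\<alpha> \<le> 1" "c0 > 0"
    and perm: "\<kappa>1 > 0" "\<kappa>2 > 0" "permeability \<Omega> \<kappa>1 \<kappa>2 \<kappa>"
    and k: "k \<ge> 1"
    and beta: "\<beta> > 0"
    and r: "r > 0"
  defines "\<gamma> \<equiv> gamma1 (Ca lam mu \<alpha> c0 \<kappa>2 r) (ca mu c0 \<kappa>1) \<beta>"
  shows "\<exists>Cstar>0. \<forall>T f g u\<Gamma> r\<Gamma>.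
    regular_partition \<Omega> T \<and> discrete_inf_sup \<Omega> T k \<beta> \<and>
    f \<in> L2 \<Omega> \<and> g \<in> L2 \<Omega> \<and> u\<Gamma> \<in> H_half_vec \<Omega> \<and> r\<Gamma> \<in> H_mhalf \<Omega> \<and>
    \<gamma> / r * max (\<gamma> * \<kappa>2 * r) 1 * data_norm \<Omega> f g u\<Gamma> r\<Gamma> < 1 \<longrightarrow>
      ex1_upto (X_eq \<Omega>)
        (\<lambda>d. d \<in> Wh \<Omega> T k r \<and> X_eq \<Omega> (Jh \<Omega> T k lam mu \<alpha> c0 \<kappa> f g u\<Gamma> r\<Gamma> d) d) \<and>
      (\<forall>d\<in>Wh \<Omega> T k r.
        X_eq \<Omega> (Jh \<Omega> T k lam mu \<alpha> c0 \<kappa> f g u\<Gamma> r\<Gamma> d) d \<longleftrightarrow>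
        (\<exists>\<sigma> u. Ph_solution \<Omega> T k lam mu \<alpha> c0 \<kappa> f g u\<Gamma> r\<Gamma> ((d, \<sigma>), u))) \<and>
      ex1_upto (XYZ_eq \<Omega>)
        (\<lambda>s. Ph_solution \<Omega> T k lam mu \<alpha> c0 \<kappa> f g u\<Gamma> r\<Gamma> s \<and> fst (fst s) \<in> Wh \<Omega> T k r) \<and>
      (\<forall>s. Ph_solution \<Omega> T k lam mu \<alpha> c0 \<kappa> f g u\<Gamma> r\<Gamma> s \<and> fst (fst s) \<in> Wh \<Omega> T k r \<longrightarrow>
        XYZ_norm \<Omega> s \<le> Cstar * data_norm \<Omega> f g u\<Gamma> r\<Gamma>)"
proof -
  define C where "C = Ca lam mu \<alpha> c0 \<kappa>2 r"
  \<comment> \<open>The second argument comes from \<open>Ph_bound\<close>; the maximum makes positivity evident.\<close>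
  define K where "K = max 1 (\<gamma> + 2 * C * \<gamma> + 1 + (1 + \<gamma>) / \<beta>)"
  show ?thesis
  proof (intro exI[of _ K] conjI allI impI)
    show "0 < K" by (simp add: K_def)
  next
    fix T f g u\<Gamma> r\<Gamma>
    assume *: "regular_partition \<Omega> T \<and> discrete_inf_sup \<Omega> T k \<beta> \<and>
      f \<in> L2 \<Omega> \<and> g \<in> L2 \<Omega> \<and> u\<Gamma> \<in> H_half_vec \<Omega> \<and> r\<Gamma> \<in> H_mhalf \<Omega> \<and>
      \<gamma> / r * max (\<gamma> * \<kappa>2 * r) 1 * data_norm \<Omega> f g u\<Gamma> r\<Gamma> < 1"
    interpret P: mixed_problem \<Omega> T k lam mu \<alpha> c0 \<kappa>1 \<kappa>2 \<beta> r \<kappa>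
      using dom par perm beta r * by unfold_locales auto
    have constants: "P.\<gamma> = \<gamma>" "P.C = C"
      by (simp_all add: \<gamma>_def C_def P.\<gamma>_def P.C_def P.c_def)
    interpret D: mixed_data \<Omega> T k lam mu \<alpha> c0 \<kappa>1 \<kappa>2 \<beta> r \<kappa> f g u\<Gamma> r\<Gamma>
      using * by unfold_locales (simp_all add: constants)
    show "ex1_upto (X_eq \<Omega>)
        (\<lambda>d. d \<in> Wh \<Omega> T k r \<and> X_eq \<Omega> (Jh \<Omega> T k lam mu \<alpha> c0 \<kappa> f g u\<Gamma> r\<Gamma> d) d)"
      unfolding ex1_upto_def using D.fixed_point_exists D.fixed_point_unique by blast
    show "\<forall>d\<in>Wh \<Omega> T k r.
        X_eq \<Omega> (Jh \<Omega> T k lam mu \<alpha> c0 \<kappa> f g u\<Gamma> r\<Gamma> d) d \<longleftrightarrow>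
        (\<exists>\<sigma> u. Ph_solution \<Omega> T k lam mu \<alpha> c0 \<kappa> f g u\<Gamma> r\<Gamma> ((d, \<sigma>), u))"
      using D.fixed_point_iff by (simp add: D.Wh_iff)
    obtain d where d: "d \<in> Wh \<Omega> T k r" "X_eq \<Omega> (Jh \<Omega> T k lam mu \<alpha> c0 \<kappa> f g u\<Gamma> r\<Gamma> d) d"
      using D.fixed_point_exists by blast
    then obtain \<sigma> u where "Ph_solution \<Omega> T k lam mu \<alpha> c0 \<kappa> f g u\<Gamma> r\<Gamma> ((d, \<sigma>), u)"
      using D.fixed_point_iff[of d] by (auto simp: D.Wh_iff)
    then have "\<exists>s. Ph_solution \<Omega> T k lam mu \<alpha> c0 \<kappa> f g u\<Gamma> r\<Gamma> s \<and> fst (fst s) \<in> Wh \<Omega> T k r"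
      using d(1) by (intro exI[of _ "((d, \<sigma>), u)"]) simp
    then show "ex1_upto (XYZ_eq \<Omega>)
        (\<lambda>s. Ph_solution \<Omega> T k lam mu \<alpha> c0 \<kappa> f g u\<Gamma> r\<Gamma> s \<and> fst (fst s) \<in> Wh \<Omega> T k r)"
      unfolding ex1_upto_def using D.Ph_unique by blast
    fix s assume s: "Ph_solution \<Omega> T k lam mu \<alpha> c0 \<kappa> f g u\<Gamma> r\<Gamma> s \<and> fst (fst s) \<in> Wh \<Omega> T k r"
    have "XYZ_norm \<Omega> s \<le> (\<gamma> + 2 * C * \<gamma> + 1 + (1 + \<gamma>) / \<beta>) * data_norm \<Omega> f g u\<Gamma> r\<Gamma>"
      using D.Ph_bound[of s] s by (simp add: constants)
    also have "\<dots> \<le> K * data_norm \<Omega> f g u\<Gamma> r\<Gamma>"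
      using D.N_nonneg by (intro mult_right_mono) (auto simp: K_def)
    finally show "XYZ_norm \<Omega> s \<le> K * data_norm \<Omega> f g u\<Gamma> r\<Gamma>" .
  qed
qed

end
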